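(* Let $\Gamma$ be a finitely generated word hyperbolic group. Suppose $n$ is even, $\rho:\Gamma\to\mathsf{G}=\mathsf{SO}_0(n,n)$ is an injective homomorphism which is Anosov with respect to $\mathsf{P}^\pm$, and $\gamma,\eta\in\Gamma$ are two infinite order elements such that the four points $\gamma^\pm,\eta^\pm\in\partial_\infty\Gamma$ are distinct and the sequence $\{\gamma^m\eta^m\}_{m\in\mathbb{N}}\subset\Gamma$ contains a subsequence $\{\gamma^{n_i}\eta^{n_i}\}_{i\in\mathbb{N}}$ consisting only of infinite order elements. Then $$\lim_{i\to\infty}\frac{\lambda(\gamma^{n_i}\eta^{n_i})^2}{\lambda(\gamma^{n_i})^2\lambda(\eta^{n_i})^2}=\theta(\eta^-,\gamma^-,\gamma^+,\eta^+)^2.$$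
   Context: Setting. On $\mathbb{R}^{n,n}=\mathbb{R}^{2n}$ with standard basis $e_1,\dots,e_{2n}$ put $\langle v\mid w\rangle=v^tI_{n,n}w$, $I_{n,n}=\mathrm{diag}(I_n,-I_n)$. $\mathsf{G}=\mathsf{SO}_0(n,n)$ is the identity component of $\mathsf{SO}(n,n)$. Let $W_\pm=\mathrm{span}\{e_j\pm e_{n+j}:1\le j\le n-1\}$, $\overrightarrow{W}_\pm$ be $W_\pm$ oriented by the ordered basis $(e_1\pm e_{n+1},\dots,e_{n-1}\pm e_{2n-1})$, and $\mathsf{P}^\pm=\mathrm{Stab}_{\mathsf{G}}(\overrightarrow{W}_\pm)$. Let $V_+=\mathrm{span}\{e_j+e_{n+j}:1\le j\le n\}$ and $V'=JV_+$ with $J=\mathrm{diag}(1,\dots,1,-1)$. Crossratio. Two $(n-1)$-dimensional isotropic subspaces $W,W'$ of $\mathbb{R}^{n,n}$ are said to have transverse orthogonals if $W^\perp\cap W'=\{0\}$; then $W^\perp\cap W'^\perp$ is a plane with exactly two isotropic lines. For $(n-1)$-dimensional isotropic $W_1,\dots,W_4$ with pairwise transverse orthogonals and $i\ne j$, let $v_{i,j}^+$ (resp. $v_{i,j}^-$) be a nonzero vector on the isotropic line of $W_i^\perp\cap W_j^\perp$ for which $\mathbb{R}v_{i,j}^\pm\oplus W_i$ lies in the $\mathsf{G}$-orbit of $V_+$ (resp. of $V'$). Then $$\theta(W_1,W_2,W_3,W_4)=\frac{\langle v^+_{1,3}\mid v^-_{2,3}\rangle\langle v^+_{2,4}\mid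 v^-_{1,4}\rangle}{\langle v^+_{2,4}\mid v^-_{2,3}\rangle\langle v^+_{1,3}\mid v^-_{1,4}\rangle},$$ independent of choices. Anosov. Let $\widetilde{\mathsf{U}\Gamma}=\{(p_+,p_-,t):p_+\ne p_-\in\partial_\infty\Gamma,t\in\mathbb{R}\}$, $\phi_s(p_+,p_-,t)=(p_+,p_-,t+s)$, with Gromov's proper cocompact isometric $\Gamma$-action commuting with $\phi$, covering the diagonal action on pairs, normalized so that for infinite order $\gamma$ with attracting/repelling points $\gamma^\pm$ one has $\gamma(\gamma^+,\gamma^-,t)=\phi_{l(\gamma)}(\gamma^+,\gamma^-,t)$ with $l(\gamma)>0$. $\rho:\Gamma\to\mathsf{G}$ is Anosov with respect to $\mathsf{P}^\pm$ if there are continuous injective equivariant maps $\xi^\pm:\partial_\infty\Gamma\to\mathsf{G}/\mathsf{P}^\pm$ with $\xi(p)=(\xi^+(p_+),\xi^-(p_-))\in\mathcal{X}=\mathsf{G}/(\mathsf{P}^+\cap\mathsf{P}^-)\subset\mathsf{G}/\mathsf{P}^+\times\mathsf{G}/\mathsf{P}^-$ for all $p$, and $C,c>0$ and a continuous equivariant family of Euclidean norms on $T_{\xi(p)}\mathcal{X}$ with $\|v^\pm\|_{\phi_{\mp t}p}\le Ce^{-ct}\|v^\pm\|_p$ for $v^\pm\in T_{\xi^\pm(p_\pm)}\mathsf{G}/\mathsf{P}^\pm$, $t\ge0$. For such $\rho$ and infinite order $\gamma$, $\rho(\gamma)$ has an attracting fixed point $\xi(\gamma^+)$ and a repelling fixed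 point $\xi(\gamma^-)$ on the space of $(n-1)$-dimensional isotropic subspaces of $\mathbb{R}^{n,n}$; fixed points attached to distinct boundary points have transverse orthogonals. $\theta(a,b,c,d):=\theta(\xi(a),\xi(b),\xi(c),\xi(d))$. With $W_a=\xi(\gamma^+)$, $W_r=\xi(\gamma^-)$, the number $\lambda(\gamma)$ is the eigenvalue of $\rho(\gamma)$ on the line $\mathbb{R}v^+_{a,r}$, i.e. the isotropic line $\ell$ of $W_a^\perp\cap W_r^\perp$ with $\ell\oplus W_a$ in the $\mathsf{G}$-orbit of $V_+$. *)

theory Defs
  imports
    "HOL-Analysis.Analysis"
    "HOL-Algebra.Generated_Groups"
    "HOL-Algebra.Group_Action"
    "HOL-Algebra.Multiplicative_Group"
begin

section \<open>The pseudo-Euclidean space of signature (n,n)\<close>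

text \<open>
  Here n is the cardinality of the finite index type \<open>'n\<close>.  The basis vectors
  \<open>e\<^sub>1, \<dots>, e\<^sub>n\<close> are indexed by \<open>Inl j\<close>, and
  \<open>e\<^bsub>n+1\<^esub>, \<dots>, e\<^bsub>2n\<^esub>\<close> by \<open>Inr j\<close>.  The linear order on \<open>'n\<close> serves only to
  single out the last index, which plays the role of n.
\<close>

type_synonym 'n vec_nn = "real ^ ('n + 'n)"
type_synonym 'n mat_nn = "real ^ ('n + 'n) ^ ('n + 'n)"

definition I_nn :: "'n::finite mat_nn" where
  "I_nn = (\<chi> i j. if i = j then (case i of Inl _ \<Rightarrow> 1 | Inr _ \<Rightarrow> -1) else 0)"

definition form :: "'n::finite vec_nn \<Rightarrow> 'n vec_nn \<Rightarrow> real" where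
  "form v w = v \<bullet> (I_nn *v w)"

definition perp :: "'n::finite vec_nn set \<Rightarrow> 'n vec_nn set" where
  "perp W = {v. \<forall>w\<in>W. form v w = 0}"

definition SO_nn :: "'n::finite mat_nn set" where
  "SO_nn = {A. (\<forall>v w. form (A *v v) (A *v w) = form v w) \<and> det A = 1}"

definition SO0 :: "'n::finite mat_nn set" where
  "SO0 = connected_component_set SO_nn (mat 1)"

definition SO0_group :: "'n::finite mat_nn monoid" where
  "SO0_group = \<lparr>carrier = SO0, mult = (**), one = mat 1\<rparr>"

definition last_index :: "'n::{finite,linorder}" where
  "last_index = Max UNIV"

text \<open>The vectors \<open>e\<^sub>j + s e\<^bsub>n+j\<^esub>\<close>, for the sign \<open>s = 1\<close> or \<open>s = -1\<close>.\<close>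

definition frame :: "real \<Rightarrow> 'n::finite \<Rightarrow> 'n vec_nn" where
  "frame s j = axis (Inl j) 1 + s *\<^sub>R axis (Inr j) 1"

definition V_plus :: "'n::finite vec_nn set" where
  "V_plus = span (range (frame 1))"

definition J_mat :: "'n::{finite,linorder} mat_nn" where
  "J_mat = (\<chi> i j. if i = j then (if i = Inr last_index then -1 else 1) else 0)"

definition V_prime :: "'n::{finite,linorder} vec_nn set" where
  "V_prime = (*v) J_mat ` V_plus"

definition isotropic_spaces :: "'n::finite vec_nn set set" where
  "isotropic_spaces =
     {W. subspace W \<and> dim W = CARD('n) - 1 \<and> (\<forall>v\<in>W. \<forall>w\<in>W. form v w = 0)}"


section \<open>Oriented subspaces and the groups \<open>P\<^sup>\<plusminus>\<close>\<close>

text \<open>The determinant of the square matrix \<open>(A i j)\<close> with \<open>i, j \<in> I\<close>, by the Leibniz formula.\<close>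

definition det_on :: "'i set \<Rightarrow> ('i \<Rightarrow> 'i \<Rightarrow> real) \<Rightarrow> real" where
  "det_on I A = (\<Sum>p | p permutes I. of_int (sign p) * (\<Prod>i\<in>I. A i (p i)))"

text \<open>
  The bases b and c (indexed by \<open>I\<close>) span the same subspace and induce the same orientation on it:
  the transition matrix has positive determinant.
\<close>

definition same_oriented_span ::
    "'i set \<Rightarrow> ('i \<Rightarrow> 'v::real_vector) \<Rightarrow> ('i \<Rightarrow> 'v) \<Rightarrow> bool" where
  "same_oriented_span I b c \<longleftrightarrow>
     (\<exists>A. (\<forall>j\<in>I. c j = (\<Sum>i\<in>I. A i j *\<^sub>R b i)) \<and> det_on I A > 0)"

definition oriented_stab :: "real \<Rightarrow> 'n::{finite,linorder} mat_nn set" where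
  "oriented_stab s =
     {g \<in> SO0. same_oriented_span (UNIV - {last_index}) (frame s) (\<lambda>j. g *v frame s j)}"

abbreviation P_plus :: "'n::{finite,linorder} mat_nn set" where
  "P_plus \<equiv> oriented_stab 1"

abbreviation P_minus :: "'n::{finite,linorder} mat_nn set" where
  "P_minus \<equiv> oriented_stab (-1)"


section \<open>Homogeneous spaces of G and their tangent spaces\<close>

text \<open>
  Points of \<open>G/P\<close> are left cosets \<open>g <# P\<close>; the same operation \<open><#\<close> is the action of G on them.
\<close>

definition quotient_points :: "'n::finite mat_nn set \<Rightarrow> 'n mat_nn set set" where
  "quotient_points P = (\<lambda>g. g <#\<^bsub>SO0_group\<^esub> P) ` SO0"

definition quotient_topology :: "'n::finite mat_nn set \<Rightarrow> 'n mat_nn set topology" where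
  "quotient_topology P = topology (\<lambda>U. U \<subseteq> quotient_points P \<and>
     openin (top_of_set SO0) {g \<in> SO0. g <#\<^bsub>SO0_group\<^esub> P \<in> U})"

lemma istopology_quotient:
  "istopology (\<lambda>U. U \<subseteq> quotient_points P \<and>
     openin (top_of_set SO0) {g \<in> SO0. g <#\<^bsub>SO0_group\<^esub> P \<in> U})"
proof -
  have int: "{g \<in> SO0. g <#\<^bsub>SO0_group\<^esub> P \<in> U \<inter> V} =
      {g \<in> SO0. g <#\<^bsub>SO0_group\<^esub> P \<in> U} \<inter> {g \<in> SO0. g <#\<^bsub>SO0_group\<^esub> P \<in> V}" for U V
    by auto
  have un: "{g \<in> SO0. g <#\<^bsub>SO0_group\<^esub> P \<in> \<Union>\<K>} =
      \<Union>((\<lambda>U. {g \<in> SO0. g <#\<^bsub>SO0_group\<^esub> P \<in> U}) ` \<K>)" for \<K>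
    by auto
  show ?thesis
    unfolding istopology_def int un by (auto intro!: openin_Int openin_Union)
qed

lemma openin_quotient_topology:
  "openin (quotient_topology P) U \<longleftrightarrow> U \<subseteq> quotient_points P \<and>
     openin (top_of_set SO0) {g \<in> SO0. g <#\<^bsub>SO0_group\<^esub> P \<in> U}"
  unfolding quotient_topology_def using istopology_quotient[of P]
  by (simp add: topology_inverse')

text \<open>\<open>G/(P\<^sup>+ \<inter> P\<^sup>-)\<close>, viewed as a subset of \<open>G/P\<^sup>+ \<times> G/P\<^sup>-\<close>.\<close>

definition X_space :: "('n::{finite,linorder} mat_nn set \<times> 'n mat_nn set) set" where
  "X_space = (\<lambda>g. (g <#\<^bsub>SO0_group\<^esub> P_plus, g <#\<^bsub>SO0_group\<^esub> P_minus)) ` SO0"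

text \<open>The Lie algebra of a closed matrix group, as its tangent space at the identity.\<close>

definition lie_algebra :: "'n::finite mat_nn set \<Rightarrow> 'n mat_nn set" where
  "lie_algebra H = {Z. \<exists>c. c 0 = mat 1 \<and> (\<forall>t. c t \<in> H) \<and>
     (c has_vector_derivative Z) (at (0::real))}"

definition Ad :: "'n::finite mat_nn \<Rightarrow> 'n mat_nn \<Rightarrow> 'n mat_nn" where
  "Ad g Z = g ** Z ** matrix_inv g"

text \<open>
  For \<open>x \<in> G/P\<close>, differentiating \<open>t \<mapsto> c(t) x\<close> at 0 along curves c in G through the identity
  identifies \<open>T\<^sub>x(G/P)\<close> with \<open>\<gg>/stab_algebra x\<close>, where \<open>\<gg> = lie_algebra SO0\<close>.  The differential
  \<open>T\<^sub>x(G/P) \<rightarrow> T\<^bsub>gx\<^esub>(G/P)\<close> of the action of g is then induced by \<open>Ad g\<close>.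
\<close>

definition stab_algebra :: "'n::finite mat_nn set \<Rightarrow> 'n mat_nn set" where
  "stab_algebra x = lie_algebra (stabilizer SO0_group (l_coset SO0_group) x)"

text \<open>
  \<open>N\<close> is the pull-back to V of a Euclidean norm on the quotient space \<open>V/U\<close>.
\<close>

definition euclidean_norm_mod :: "'v::real_vector set \<Rightarrow> 'v set \<Rightarrow> ('v \<Rightarrow> real) \<Rightarrow> bool" where
  "euclidean_norm_mod V U N \<longleftrightarrow>
     (\<exists>B. bilinear B \<and> (\<forall>v w. B v w = B w v) \<and>
       (\<forall>v\<in>V. B v v \<ge> 0 \<and> (B v v = 0 \<longleftrightarrow> v \<in> U) \<and> N v = sqrt (B v v)))"


section \<open>Word hyperbolic groups and their Gromov boundary\<close>

definition word_length :: "('a, 'b) monoid_scheme \<Rightarrow> 'a set \<Rightarrow> 'a \<Rightarrow> nat" where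
  "word_length G S g = (LEAST k. \<exists>ws. length ws = k \<and>
     set ws \<subseteq> S \<union> (\<lambda>s. inv\<^bsub>G\<^esub> s) ` S \<and> foldr (\<lambda>x y. x \<otimes>\<^bsub>G\<^esub> y) ws \<one>\<^bsub>G\<^esub> = g)"

definition word_dist :: "('a, 'b) monoid_scheme \<Rightarrow> 'a set \<Rightarrow> 'a \<Rightarrow> 'a \<Rightarrow> real" where
  "word_dist G S g h = real (word_length G S (inv\<^bsub>G\<^esub> g \<otimes>\<^bsub>G\<^esub> h))"

definition gromov_product :: "('a, 'b) monoid_scheme \<Rightarrow> 'a set \<Rightarrow> 'a \<Rightarrow> 'a \<Rightarrow> 'a \<Rightarrow> real" where
  "gromov_product G S w x y =
     (word_dist G S w x + word_dist G S w y - word_dist G S x y) / 2"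

text \<open>Gromov's four-point inequality for the word metric of the finite generating set \<open>S\<close>.\<close>

definition word_hyperbolic :: "('a, 'b) monoid_scheme \<Rightarrow> 'a set \<Rightarrow> bool" where
  "word_hyperbolic G S \<longleftrightarrow>
     group G \<and> finite S \<and> S \<subseteq> carrier G \<and> generate G S = carrier G \<and>
     (\<exists>\<delta>. \<forall>w\<in>carrier G. \<forall>x\<in>carrier G. \<forall>y\<in>carrier G. \<forall>z\<in>carrier G.
        gromov_product G S w x z \<ge>
          min (gromov_product G S w x y) (gromov_product G S w y z) - \<delta>)"

text \<open>
  Points of \<open>\<partial>\<^sub>\<infinity>\<Gamma>\<close> are equivalence classes of sequences in the group that converge to infinity,
  that is \<open>(x\<^sub>i | x\<^sub>j) \<longlonglongrightarrow> \<infinity>\<close>; sequences x and y are equivalent if \<open>(x\<^sub>i | y\<^sub>j) \<longlonglongrightarrow> \<infinity>\<close>.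
  The Gromov products are based at the identity.
\<close>

type_synonym 'a bdpoint = "(nat \<Rightarrow> 'a) set"

definition asymptotic ::
    "('a, 'b) monoid_scheme \<Rightarrow> 'a set \<Rightarrow> (nat \<Rightarrow> 'a) \<Rightarrow> (nat \<Rightarrow> 'a) \<Rightarrow> bool" where
  "asymptotic G S x y \<longleftrightarrow>
     filterlim (\<lambda>(i, j). gromov_product G S \<one>\<^bsub>G\<^esub> (x i) (y j)) at_top (sequentially \<times>\<^sub>F sequentially)"

definition seqs_to_infinity :: "('a, 'b) monoid_scheme \<Rightarrow> 'a set \<Rightarrow> (nat \<Rightarrow> 'a) set" where
  "seqs_to_infinity G S = {x. range x \<subseteq> carrier G \<and> asymptotic G S x x}"

definition bdclass :: "('a, 'b) monoid_scheme \<Rightarrow> 'a set \<Rightarrow> (nat \<Rightarrow> 'a) \<Rightarrow> 'a bdpoint" where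
  "bdclass G S x = {y \<in> seqs_to_infinity G S. asymptotic G S x y}"

definition boundary :: "('a, 'b) monoid_scheme \<Rightarrow> 'a set \<Rightarrow> 'a bdpoint set" where
  "boundary G S = bdclass G S ` seqs_to_infinity G S"

text \<open>
  The basic neighbourhoods of a boundary point a consist of the b that have representing sequences
  with \<open>liminf (x\<^sub>i | y\<^sub>j) \<ge> r\<close>; the word metric being integral, the limes inferior condition
  amounts to \<open>(x\<^sub>i | y\<^sub>j) \<ge> r\<close> for all large i, j when r is a half-integer.
\<close>

definition bd_nhd :: "('a, 'b) monoid_scheme \<Rightarrow> 'a set \<Rightarrow> 'a bdpoint \<Rightarrow> real \<Rightarrow> 'a bdpoint set" where
  "bd_nhd G S a r = {b \<in> boundary G S. \<exists>x\<in>a. \<exists>y\<in>b.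
     \<forall>\<^sub>F (i, j) in sequentially \<times>\<^sub>F sequentially. r \<le> gromov_product G S \<one>\<^bsub>G\<^esub> (x i) (y j)}"

definition boundary_topology :: "('a, 'b) monoid_scheme \<Rightarrow> 'a set \<Rightarrow> 'a bdpoint topology" where
  "boundary_topology G S =
     topology (\<lambda>U. U \<subseteq> boundary G S \<and> (\<forall>a\<in>U. \<exists>r. bd_nhd G S a r \<subseteq> U))"

lemma bd_nhd_antimono:
  assumes "r \<le> r'"
  shows "bd_nhd G S a r' \<subseteq> bd_nhd G S a r"
proof
  fix b assume "b \<in> bd_nhd G S a r'"
  then obtain x y where b: "b \<in> boundary G S" and xy: "x \<in> a" "y \<in> b"
    and ev: "\<forall>\<^sub>F (i, j) in sequentially \<times>\<^sub>F sequentially.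
      r' \<le> gromov_product G S \<one>\<^bsub>G\<^esub> (x i) (y j)"
    unfolding bd_nhd_def by auto
  have "\<forall>\<^sub>F (i, j) in sequentially \<times>\<^sub>F sequentially.
      r \<le> gromov_product G S \<one>\<^bsub>G\<^esub> (x i) (y j)"
    using ev by (rule eventually_mono) (use assms in auto)
  with b xy show "b \<in> bd_nhd G S a r"
    unfolding bd_nhd_def by blast
qed

lemma istopology_boundary:
  "istopology (\<lambda>U. U \<subseteq> boundary G S \<and> (\<forall>a\<in>U. \<exists>r. bd_nhd G S a r \<subseteq> U))"
  unfolding istopology_def
proof (intro conjI allI impI ballI)
  fix U V a
  assume U: "U \<subseteq> boundary G S \<and> (\<forall>a\<in>U. \<exists>r. bd_nhd G S a r \<subseteq> U)"
    and V: "V \<subseteq> boundary G S \<and> (\<forall>a\<in>V. \<exists>r. bd_nhd G S a r \<subseteq> V)"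
  show "U \<inter> V \<subseteq> boundary G S" using U by blast
  assume "a \<in> U \<inter> V"
  then obtain r r' where "bd_nhd G S a r \<subseteq> U" "bd_nhd G S a r' \<subseteq> V"
    using U V by blast
  then have "bd_nhd G S a (max r r') \<subseteq> U \<inter> V"
    using bd_nhd_antimono[of r "max r r'" G S a] bd_nhd_antimono[of r' "max r r'" G S a] by auto
  then show "\<exists>r. bd_nhd G S a r \<subseteq> U \<inter> V" by blast
next
  fix \<K> assume "\<forall>K\<in>\<K>. K \<subseteq> boundary G S \<and> (\<forall>a\<in>K. \<exists>r. bd_nhd G S a r \<subseteq> K)"
  then show "\<Union>\<K> \<subseteq> boundary G S" by blast
next
  fix \<K> a
  assume K: "\<forall>K\<in>\<K>. K \<subseteq> boundary G S \<and> (\<forall>a\<in>K. \<exists>r. bd_nhd G S a r \<subseteq> K)" and "a \<in> \<Union>\<K>"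
  then obtain K where "K \<in> \<K>" "a \<in> K" by blast
  with K obtain r where "bd_nhd G S a r \<subseteq> K" by blast
  with \<open>K \<in> \<K>\<close> show "\<exists>r. bd_nhd G S a r \<subseteq> \<Union>\<K>" by blast
qed

lemma openin_boundary_topology:
  "openin (boundary_topology G S) U \<longleftrightarrow>
     U \<subseteq> boundary G S \<and> (\<forall>a\<in>U. \<exists>r. bd_nhd G S a r \<subseteq> U)"
  unfolding boundary_topology_def using istopology_boundary[of G S]
  by (simp add: topology_inverse')

lemma topspace_boundary_topology: "topspace (boundary_topology G S) = boundary G S"
proof
  show "topspace (boundary_topology G S) \<subseteq> boundary G S"
    unfolding topspace_def openin_boundary_topology by auto
  have "openin (boundary_topology G S) (boundary G S)"
    unfolding openin_boundary_topology bd_nhd_def by auto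
  then show "boundary G S \<subseteq> topspace (boundary_topology G S)"
    by (rule openin_subset)
qed

definition bd_act :: "('a, 'b) monoid_scheme \<Rightarrow> 'a \<Rightarrow> 'a bdpoint \<Rightarrow> 'a bdpoint" where
  "bd_act G g a = (\<lambda>x i. g \<otimes>\<^bsub>G\<^esub> x i) ` a"

definition infinite_order :: "('a, 'b) monoid_scheme \<Rightarrow> 'a \<Rightarrow> bool" where
  "infinite_order G g \<longleftrightarrow> g \<in> carrier G \<and> group.ord G g = 0"

text \<open>The attracting and repelling points \<open>\<gamma>\<^sup>+ = lim \<gamma>\<^sup>m\<close> and \<open>\<gamma>\<^sup>- = lim \<gamma>\<^bsup>-m\<^esup>\<close> on the boundary.\<close>

definition bd_attr :: "('a, 'b) monoid_scheme \<Rightarrow> 'a set \<Rightarrow> 'a \<Rightarrow> 'a bdpoint" where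
  "bd_attr G S g = bdclass G S (\<lambda>m. g [^]\<^bsub>G\<^esub> m)"

definition bd_rep :: "('a, 'b) monoid_scheme \<Rightarrow> 'a set \<Rightarrow> 'a \<Rightarrow> 'a bdpoint" where
  "bd_rep G S g = bdclass G S (\<lambda>m. (inv\<^bsub>G\<^esub> g) [^]\<^bsub>G\<^esub> m)"


section \<open>The flow space\<close>

type_synonym 'a flowpoint = "'a bdpoint \<times> 'a bdpoint \<times> real"

definition flow_space :: "('a, 'b) monoid_scheme \<Rightarrow> 'a set \<Rightarrow> 'a flowpoint set" where
  "flow_space G S = {(p, q, t). p \<in> boundary G S \<and> q \<in> boundary G S \<and> p \<noteq> q}"

definition flow_topology :: "('a, 'b) monoid_scheme \<Rightarrow> 'a set \<Rightarrow> 'a flowpoint topology" where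
  "flow_topology G S = subtopology
     (prod_topology (boundary_topology G S) (prod_topology (boundary_topology G S) euclideanreal))
     (flow_space G S)"

definition flow :: "real \<Rightarrow> 'a flowpoint \<Rightarrow> 'a flowpoint" where
  "flow s = (\<lambda>(p, q, t). (p, q, t + s))"

text \<open>
  Gromov's action is unique only up to a suitable equivalence, so it is described by its properties
  instead of being fixed.
\<close>

definition gromov_action ::
    "('a, 'b) monoid_scheme \<Rightarrow> 'a set \<Rightarrow> ('a \<Rightarrow> 'a flowpoint \<Rightarrow> 'a flowpoint) \<Rightarrow> bool" where
  "gromov_action G S act \<longleftrightarrow>
     group_action G (flow_space G S) act \<and>
     (\<forall>g\<in>carrier G. continuous_map (flow_topology G S) (flow_topology G S) (act g)) \<and>
     (\<exists>d. Metric_space (flow_space G S) d \<and>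
        Metric_space.mtopology (flow_space G S) d = flow_topology G S \<and>
        (\<forall>g\<in>carrier G. \<forall>z\<in>flow_space G S. \<forall>w\<in>flow_space G S. d (act g z) (act g w) = d z w)) \<and>
     (\<forall>K. compactin (flow_topology G S) K \<longrightarrow> finite {g \<in> carrier G. act g ` K \<inter> K \<noteq> {}}) \<and>
     (\<exists>K. compactin (flow_topology G S) K \<and> (\<Union>g\<in>carrier G. act g ` K) = flow_space G S) \<and>
     (\<forall>g\<in>carrier G. \<forall>z\<in>flow_space G S. \<forall>s. act g (flow s z) = flow s (act g z)) \<and>
     (\<forall>g\<in>carrier G. \<forall>p q t. (p, q, t) \<in> flow_space G S \<longrightarrow>
        (\<exists>t'. act g (p, q, t) = (bd_act G g p, bd_act G g q, t'))) \<and>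
     (\<forall>g. infinite_order G g \<longrightarrow>
        (\<exists>l>0. \<forall>t. act g (bd_attr G S g, bd_rep G S g, t) =
                   flow l (bd_attr G S g, bd_rep G S g, t)))"


section \<open>Anosov representations\<close>

definition boundary_map ::
    "('a, 'b) monoid_scheme \<Rightarrow> 'a set \<Rightarrow> ('a \<Rightarrow> 'n::finite mat_nn) \<Rightarrow> 'n mat_nn set \<Rightarrow>
     ('a bdpoint \<Rightarrow> 'n mat_nn set) \<Rightarrow> bool" where
  "boundary_map G S \<rho> P \<xi> \<longleftrightarrow>
     continuous_map (boundary_topology G S) (quotient_topology P) \<xi> \<and>
     inj_on \<xi> (boundary G S) \<and>
     (\<forall>g\<in>carrier G. \<forall>a\<in>boundary G S. \<xi> (bd_act G g a) = \<rho> g <#\<^bsub>SO0_group\<^esub> \<xi> a)"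

text \<open>
  As \<open>X_space\<close> is open in \<open>G/P\<^sup>+ \<times> G/P\<^sup>-\<close>, its tangent space at \<open>(x, y)\<close> is
  \<open>T\<^sub>x(G/P\<^sup>+) \<oplus> T\<^sub>y(G/P\<^sup>-) = (\<gg> \<times> \<gg>) / (stab_algebra x \<times> stab_algebra y)\<close>.  A vector tangent to
  \<open>G/P\<^sup>+\<close> is represented by \<open>(Z, 0)\<close>, and one tangent to \<open>G/P\<^sup>-\<close> by \<open>(0, Z)\<close>.
\<close>

definition anosov ::
    "('a, 'b) monoid_scheme \<Rightarrow> 'a set \<Rightarrow> ('a \<Rightarrow> 'a flowpoint \<Rightarrow> 'a flowpoint) \<Rightarrow>
     ('a \<Rightarrow> 'n::{finite,linorder} mat_nn) \<Rightarrow> bool" where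
  "anosov G S act \<rho> \<longleftrightarrow>
     (\<exists>\<xi>p \<xi>m N C c.
        boundary_map G S \<rho> P_plus \<xi>p \<and> boundary_map G S \<rho> P_minus \<xi>m \<and>
        (\<forall>(p, q, t)\<in>flow_space G S. (\<xi>p p, \<xi>m q) \<in> X_space) \<and>
        C > 0 \<and> c > 0 \<and>
        (\<forall>(p, q, t)\<in>flow_space G S.
           euclidean_norm_mod (lie_algebra SO0 \<times> lie_algebra SO0)
             (stab_algebra (\<xi>p p) \<times> stab_algebra (\<xi>m q)) (N (p, q, t))) \<and>
        continuous_map
          (prod_topology (flow_topology G S) (top_of_set (lie_algebra SO0 \<times> lie_algebra SO0)))
          euclideanreal (\<lambda>(z, v). N z v) \<and>
        (\<forall>g\<in>carrier G. \<forall>z\<in>flow_space G S. \<forall>Z\<in>lie_algebra SO0. \<forall>Y\<in>lie_algebra SO0.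
           N (act g z) (Ad (\<rho> g) Z, Ad (\<rho> g) Y) = N z (Z, Y)) \<and>
        (\<forall>z\<in>flow_space G S. \<forall>t\<ge>0. \<forall>Z\<in>lie_algebra SO0.
           N (flow (- t) z) (Z, 0) \<le> C * exp (- c * t) * N z (Z, 0) \<and>
           N (flow t z) (0, Z) \<le> C * exp (- c * t) * N z (0, Z)))"


section \<open>Attracting and repelling fixed points, crossratio and eigenvalue\<close>

text \<open>The gap metric on linear subspaces; \<open>closest_point V\<close> is the orthogonal projection onto V.\<close>

definition gap :: "'v::euclidean_space set \<Rightarrow> 'v set \<Rightarrow> real" where
  "gap V W = onorm (\<lambda>x. closest_point V x - closest_point W x)"

definition attracting_fixed_point :: "'n::finite mat_nn \<Rightarrow> 'n vec_nn set \<Rightarrow> bool" where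
  "attracting_fixed_point g W \<longleftrightarrow>
     W \<in> isotropic_spaces \<and> (*v) g ` W = W \<and>
     (\<exists>\<epsilon>>0. \<forall>W'\<in>isotropic_spaces. gap W' W < \<epsilon> \<longrightarrow>
        (\<lambda>m. gap (((\<lambda>V. (*v) g ` V) ^^ m) W') W) \<longlonglongrightarrow> 0)"

definition repelling_fixed_point :: "'n::finite mat_nn \<Rightarrow> 'n vec_nn set \<Rightarrow> bool" where
  "repelling_fixed_point g W \<longleftrightarrow> attracting_fixed_point (matrix_inv g) W"

text \<open>
  The isotropic subspace \<open>\<xi>(a)\<close> attached to a boundary point a that is fixed by an infinite order
  element: \<open>\<xi>(\<gamma>\<^sup>+)\<close> is the attracting and \<open>\<xi>(\<gamma>\<^sup>-)\<close> the repelling fixed point of \<open>\<rho>(\<gamma>)\<close>.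
\<close>

definition limit_space ::
    "('a, 'b) monoid_scheme \<Rightarrow> 'a set \<Rightarrow> ('a \<Rightarrow> 'n::finite mat_nn) \<Rightarrow> 'a bdpoint \<Rightarrow> 'n vec_nn set"
  where
  "limit_space G S \<rho> a = (THE W. \<forall>g. infinite_order G g \<longrightarrow>
     (bd_attr G S g = a \<longrightarrow> attracting_fixed_point (\<rho> g) W) \<and>
     (bd_rep G S g = a \<longrightarrow> repelling_fixed_point (\<rho> g) W))"

definition G_orbit :: "'n::finite vec_nn set \<Rightarrow> 'n vec_nn set set" where
  "G_orbit V = orbit SO0_group (\<lambda>g U. (*v) g ` U) V"

text \<open>For \<open>W = W\<^sub>i\<close> and \<open>W' = W\<^sub>j\<close>, these are the vectors \<open>v\<^sup>+\<^bsub>i,j\<^esub>\<close> and \<open>v\<^sup>-\<^bsub>i,j\<^esub>\<close>.\<close>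

definition v_plus :: "'n::finite vec_nn set \<Rightarrow> 'n vec_nn set \<Rightarrow> 'n vec_nn" where
  "v_plus W W' = (SOME v. v \<noteq> 0 \<and> v \<in> perp W \<inter> perp W' \<and> form v v = 0 \<and>
     span (insert v W) \<in> G_orbit V_plus)"

definition v_minus :: "'n::{finite,linorder} vec_nn set \<Rightarrow> 'n vec_nn set \<Rightarrow> 'n vec_nn" where
  "v_minus W W' = (SOME v. v \<noteq> 0 \<and> v \<in> perp W \<inter> perp W' \<and> form v v = 0 \<and>
     span (insert v W) \<in> G_orbit V_prime)"

definition crossratio ::
    "'n::{finite,linorder} vec_nn set \<Rightarrow> 'n vec_nn set \<Rightarrow> 'n vec_nn set \<Rightarrow> 'n vec_nn set \<Rightarrow> real"
  where
  "crossratio W1 W2 W3 W4 =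
     (form (v_plus W1 W3) (v_minus W2 W3) * form (v_plus W2 W4) (v_minus W1 W4)) /
     (form (v_plus W2 W4) (v_minus W2 W3) * form (v_plus W1 W3) (v_minus W1 W4))"

definition theta ::
    "('a, 'b) monoid_scheme \<Rightarrow> 'a set \<Rightarrow> ('a \<Rightarrow> 'n::{finite,linorder} mat_nn) \<Rightarrow>
     'a bdpoint \<Rightarrow> 'a bdpoint \<Rightarrow> 'a bdpoint \<Rightarrow> 'a bdpoint \<Rightarrow> real" where
  "theta G S \<rho> a b c d = crossratio (limit_space G S \<rho> a) (limit_space G S \<rho> b)
     (limit_space G S \<rho> c) (limit_space G S \<rho> d)"

definition lambda ::
    "('a, 'b) monoid_scheme \<Rightarrow> 'a set \<Rightarrow> ('a \<Rightarrow> 'n::finite mat_nn) \<Rightarrow> 'a \<Rightarrow> real" where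
  "lambda G S \<rho> g =
     (let v = v_plus (limit_space G S \<rho> (bd_attr G S g)) (limit_space G S \<rho> (bd_rep G S g))
      in THE \<mu>. \<rho> g *v v = \<mu> *\<^sub>R v)"

end

(*
  Let g be the image of an element of infinite order.  It preserves R^{n,n} = W_a + P + W_r, where
  W_a, W_r are isotropic of dimension n - 1 and the plane P = W_a^perp Int W_r^perp is spanned by
  two null eigenvectors, with eigenvalues a and 1/a.  Contraction of the tangent vectors
  y |-> <x|y> u - <u|y> x (u in P null, x in W_r) says that a^m g^m x and a^{-m} g^m x tend to 0
  on W_r.  So g is dominated on W_a: it has a unique attracting fixed point, and a cone argument
  (ping-pong) shows that the attracting and repelling spaces of A^k B^k tend to those of A and of B
  respectively, where A, B are the images of gamma, eta.

  Let C = A^k B^k, let v be its null eigenvector with eigenvalue 1/lambda(C) and put u = B^k v.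
  With W_1, ..., W_4 attached to eta^-, gamma^-, gamma^+, eta^+, the vector v^-_{1,4} is an
  eigenvector of B for lambda(B) and v^-_{2,3} is one of A for lambda(A).  As n is even,
  v^+_{i,j} and v^-_{j,i} are proportional.  Pairing u = B^k v with v^-_{1,4} and A^k u = v / lambda(C)
  with v^-_{2,3} yields
    lambda(C) / (lambda(A) lambda(B))^k = <v|v^-_{2,3}> <u|v^-_{1,4}> / (<u|v^-_{2,3}> <v|v^-_{1,4}>),
  and the directions of v and u tend to those of v^+_{1,3} and v^+_{2,4}.
*)

theory Submission
  imports Defs
begin

section \<open>The gap metric on subspaces\<close>

text \<open>Domination is stated as contraction of cones, with no spectral decomposition:
  \<open>g\<close> preserves the form, which pairs W_a with W_r perfectly, so decay on W_r is
  expansion on W_a. An attracting fixed point is only required to attract nearby isotropic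
  subspaces. A rival attractor is excluded by an isotropic subspace in its basin that is transverse
  to the repelling space; that such subspaces are dense is proved by induction on the dimension of
  the intersection. Parity enters through one sign. The isotropic n-plane spanned by the model space
  W_s, s = 1 or -1, and e_n + t e_{2n} is the graph of a diagonal isometry of determinant t s^(n-1).
  For n even, passing from W_+ to W_- flips this sign, so each null line of the plane P belongs to
  opposite families over its two subspaces. The same sign identifies the limits of null directions:
  a limit plane has just two null lines, and continuity of a determinant decides between them.
  Directions converge only up to scale and along subsequences, which the quotients of pairings do
  not notice; as these carry no absolute values, the limit is found before squaring.\<close>

lemma closest_point_subspace:
  fixes V :: "'v::euclidean_space set"
  assumes "subspace V"
  shows closest_point_subspace_mem: "closest_point V x \<in> V"
    and closest_point_subspace_orth: "y \<in> V \<Longrightarrow> (x - closest_point V x) \<bullet> y = 0"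
proof -
  have cl: "closed V" and cv: "convex V" and ne: "V \<noteq> {}"
    using assms closed_subspace subspace_imp_convex subspace_0 by auto
  show m: "closest_point V x \<in> V"
    by (rule closest_point_in_set[OF cl ne])
  assume y: "y \<in> V"
  have "closest_point V x + y \<in> V" "closest_point V x - y \<in> V"
    using m y assms by (auto intro: subspace_add subspace_diff)
  from closest_point_dot[OF cv cl this(1), of x] closest_point_dot[OF cv cl this(2), of x]
  show "(x - closest_point V x) \<bullet> y = 0"
    by (simp add: inner_diff_right)
qed

lemma closest_point_subspace_unique:
  fixes V :: "'v::euclidean_space set"
  assumes V: "subspace V" and y: "y \<in> V" and o: "\<And>z. z \<in> V \<Longrightarrow> (x - y) \<bullet> z = 0"
  shows "closest_point V x = y"
proof -
  let ?p = "closest_point V x"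
  have d: "y - ?p \<in> V" using V y closest_point_subspace_mem[OF V] by (auto intro: subspace_diff)
  have "(y - ?p) \<bullet> (y - ?p) = (x - ?p) \<bullet> (y - ?p) - (x - y) \<bullet> (y - ?p)"
    by (simp add: inner_diff_left)
  also have "\<dots> = 0" using closest_point_subspace_orth[OF V d] o[OF d] by simp
  finally show ?thesis by simp
qed

lemma linear_closest_point:
  fixes V :: "'v::euclidean_space set"
  assumes V: "subspace V"
  shows "linear (closest_point V)"
proof (rule linearI)
  note m = closest_point_subspace_mem[OF V] and o = closest_point_subspace_orth[OF V]
  show "closest_point V (x + y) = closest_point V x + closest_point V y" for x y
  proof (rule closest_point_subspace_unique[OF V])
    fix z assume "z \<in> V"
    then show "(x + y - (closest_point V x + closest_point V y)) \<bullet> z = 0"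
      using o[of z x] o[of z y] by (simp add: inner_diff_left inner_add_left)
  qed (use m V in \<open>auto intro: subspace_add\<close>)
  show "closest_point V (c *\<^sub>R x) = c *\<^sub>R closest_point V x" for c x
  proof (rule closest_point_subspace_unique[OF V])
    fix z assume "z \<in> V"
    then show "(c *\<^sub>R x - c *\<^sub>R closest_point V x) \<bullet> z = 0"
      using o[of z x] by (simp add: inner_diff_left)
  qed (use m V in \<open>auto intro: subspace_scale\<close>)
qed

lemma bounded_linear_gap:
  fixes V W :: "'v::euclidean_space set"
  assumes "subspace V" "subspace W"
  shows "bounded_linear (\<lambda>x. closest_point V x - closest_point W x)"
  using linear_compose_sub[OF linear_closest_point[OF assms(1)] linear_closest_point[OF assms(2)]]
  by (simp add: linear_conv_bounded_linear)

lemma norm_closest_point_le: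
  fixes V :: "'v::euclidean_space set"
  assumes V: "subspace V"
  shows "norm (x - closest_point V x) \<le> norm x"
  using closest_point_le[OF closed_subspace[OF V] subspace_0[OF V], of x] by (simp add: dist_norm)

lemma norm_diff_closest_point_le:
  fixes V :: "'v::euclidean_space set"
  assumes V: "subspace V" and y: "y \<in> V"
  shows "norm (x - closest_point V x) \<le> norm (x - y)"
  using closest_point_le[OF closed_subspace[OF V] y, of x] by (simp add: dist_norm)

lemma gap_nonneg: "subspace V \<Longrightarrow> subspace W \<Longrightarrow> 0 \<le> gap V W"
  unfolding gap_def by (intro onorm_pos_le bounded_linear_gap)

lemma gap_commute: "gap V W = gap W V"
proof -
  have "(\<lambda>x. closest_point V x - closest_point W x) = (\<lambda>x. - (closest_point W x - closest_point V x))"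
    by auto
  then show ?thesis unfolding gap_def by (simp only: onorm_neg)
qed

lemma gap_triangle:
  assumes "subspace U" "subspace V" "subspace W"
  shows "gap U W \<le> gap U V + gap V W"
proof -
  have eq: "(\<lambda>x. closest_point U x - closest_point W x) =
    (\<lambda>x. (closest_point U x - closest_point V x) + (closest_point V x - closest_point W x))" by auto
  show ?thesis unfolding gap_def eq
    by (intro onorm_triangle bounded_linear_gap assms)
qed

lemma norm_diff_closest_point_gap:
  assumes V: "subspace V" and W: "subspace W" and x: "x \<in> V"
  shows "norm (x - closest_point W x) \<le> gap V W * norm x"
proof -
  have "closest_point V x = x" by (rule closest_point_self[OF x])
  then show ?thesis
    using onorm[OF bounded_linear_gap[OF V W], of x] by (simp add: gap_def)
qed

lemma gap_zero_subset:
  assumes "subspace V" "subspace W" "gap V W \<le> 0"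
  shows "V \<subseteq> W"
proof
  fix x assume x: "x \<in> V"
  have "norm (x - closest_point W x) \<le> gap V W * norm x"
    by (rule norm_diff_closest_point_gap[OF assms(1,2) x])
  also have "\<dots> \<le> 0" using assms(3) by (simp add: mult_le_0_iff)
  finally have "x = closest_point W x" by simp
  then show "x \<in> W" using closest_point_subspace_mem[OF assms(2), of x] by simp
qed

lemma gap_zero_eq:
  assumes "subspace V" "subspace W" "gap V W \<le> 0"
  shows "V = W"
  using gap_zero_subset[OF assms] gap_zero_subset[OF assms(2,1)] assms(3)
  by (simp add: gap_commute[of W V] subset_antisym)

text \<open>With P and Q the projections, P - Q = (P - QP) - Q(1 - P). The first bound controls P -
  QP. For y = Q(x - Px), orthogonality of x - Px to \<open>V\<close> gives |y|^2 = <y - Py, x - Px>,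
  which brings in the second bound; the factor 2 is the sum of both.\<close>

lemma gap_le:
  assumes V: "subspace V" and W: "subspace W"
    and a: "\<And>x. x \<in> V \<Longrightarrow> norm (x - closest_point W x) \<le> d * norm x"
    and b: "\<And>y. y \<in> W \<Longrightarrow> norm (y - closest_point V y) \<le> d * norm y"
    and d: "d \<ge> 0"
  shows "gap V W \<le> 2 * d"
  unfolding gap_def
proof (rule onorm_le)
  fix x
  let ?P = "closest_point V" and ?Q = "closest_point W"
  let ?u = "x - ?P x"
  let ?y = "?Q ?u"
  have PV: "?P z \<in> V" for z by (rule closest_point_subspace_mem[OF V])
  have QW: "?Q z \<in> W" for z by (rule closest_point_subspace_mem[OF W])
  have nP: "norm (?P x) \<le> norm x"
  proof -
    have "(norm (?P x))\<^sup>2 = ?P x \<bullet> x"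
      using closest_point_subspace_orth[OF V PV, of x x]
      by (simp add: power2_norm_eq_inner inner_diff_left inner_diff_right inner_commute)
    also have "\<dots> \<le> norm (?P x) * norm x" by (rule norm_cauchy_schwarz)
    finally show ?thesis by (cases "?P x = 0") (auto simp: power2_eq_square)
  qed
  have "norm (?P x - ?Q (?P x)) \<le> d * norm (?P x)" by (rule a[OF PV])
  also have "\<dots> \<le> d * norm x" using nP d by (rule mult_left_mono)
  finally have 1: "norm (?P x - ?Q (?P x)) \<le> d * norm x" .
  have "(norm ?y)\<^sup>2 = ?y \<bullet> ?u"
    using closest_point_subspace_orth[OF W QW, of ?u ?u]
    by (simp add: power2_norm_eq_inner inner_diff_left inner_diff_right inner_commute)
  also have "\<dots> = (?y - ?P ?y) \<bullet> ?u"
    using closest_point_subspace_orth[OF V PV, of x ?y]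
    by (simp add: inner_diff_left inner_commute inner_diff_right)
  also have "\<dots> \<le> norm (?y - ?P ?y) * norm ?u" by (rule norm_cauchy_schwarz)
  also have "\<dots> \<le> (d * norm ?y) * norm x"
    using b[OF QW, of ?u] norm_closest_point_le[OF V, of x] d by (intro mult_mono) auto
  finally have 2: "norm ?y \<le> d * norm x"
    by (cases "?y = 0") (auto simp: power2_eq_square d)
  have "?P x - ?Q x = (?P x - ?Q (?P x)) - ?y"
    by (simp add: linear_diff[OF linear_closest_point[OF W]])
  then have "norm (?P x - ?Q x) \<le> norm (?P x - ?Q (?P x)) + norm ?y"
    by (metis norm_triangle_ineq4)
  with 1 2 show "norm (?P x - ?Q x) \<le> 2 * d * norm x" by linarith
qed

lemma gap_le_graph:
  fixes f :: "'v::euclidean_space \<Rightarrow> 'v"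
  assumes V: "subspace V" and W: "subspace W"
    and f: "\<And>x. x \<in> V \<Longrightarrow> f x \<in> W" "\<And>y. y \<in> W \<Longrightarrow> \<exists>x\<in>V. f x = y"
    and d: "\<And>x. x \<in> V \<Longrightarrow> norm (x - f x) \<le> d * norm x"
      "\<And>x. x \<in> V \<Longrightarrow> norm (x - f x) \<le> d * norm (f x)" "d \<ge> 0"
  shows "gap V W \<le> 2 * d"
proof (rule gap_le[OF V W _ _ d(3)])
  show "norm (x - closest_point W x) \<le> d * norm x" if "x \<in> V" for x
    using norm_diff_closest_point_le[OF W f(1)[OF that], of x] d(1)[OF that] by simp
  show "norm (y - closest_point V y) \<le> d * norm y" if yW: "y \<in> W" for y
  proof -
    obtain x where x: "x \<in> V" "f x = y" using f(2)[OF yW] by blast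
    then show ?thesis
      using norm_diff_closest_point_le[OF V x(1), of y] d(2)[OF x(1)] by (simp add: norm_minus_commute)
  qed
qed

text \<open>For a projection \<open>p\<close>, the number \<open>c\<close> bounds the slope of
  \<open>x\<close> over the range of \<open>p\<close>. A subspace inside the cone is the graph of a
  map of norm at most \<open>c\<close> over its image, so cones act as charts of the Grassmannian
  around the range.\<close>

definition cone_set :: "('v::euclidean_space \<Rightarrow> 'v) \<Rightarrow> real \<Rightarrow> 'v set" where
  "cone_set p c = {x. norm (x - p x) \<le> c * norm (p x)}"

text \<open>Inside a cone \<open>p x = 0\<close> forces \<open>x = 0\<close>, so equality of
  dimensions makes \<open>V\<close> a graph over all of \<open>W\<close>. The constant is chosen
  before \<open>V\<close> and \<open>d\<close>, so the gap tends to 0 with the slope.\<close>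

lemma gap_cone:
  fixes p :: "'v::euclidean_space \<Rightarrow> 'v"
  assumes p: "linear p" "range p \<subseteq> W" and W: "subspace W"
  shows "\<exists>K>0. \<forall>V d. subspace V \<longrightarrow> dim V = dim W \<longrightarrow> V \<subseteq> cone_set p d \<longrightarrow> 0 \<le> d \<longrightarrow> gap V W \<le> K * d"
proof -
  obtain K where K: "K > 0" "\<And>x. norm (p x) \<le> K * norm x" using linear_bounded_pos[OF p(1)] by blast
  have "gap V W \<le> 2 * (K + 1) * d"
    if V: "subspace V" "dim V = dim W" "V \<subseteq> cone_set p d" "0 \<le> d" for V d
  proof -
    have c: "norm (x - p x) \<le> d * norm (p x)" if "x \<in> V" for x
      using that V(3) by (auto simp: cone_set_def)
    have inj: "inj_on p V"
    proof (rule inj_onI)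
      fix x y assume xy: "x \<in> V" "y \<in> V" "p x = p y"
      then have "p (x - y) = 0" by (simp add: linear_diff[OF p(1)])
      then show "x = y" using c[of "x - y"] xy V(1) subspace_diff by fastforce
    qed
    have "p ` V = W"
    proof (rule subspace_dim_equal)
      show "subspace (p ` V)" using p(1) V(1) by (simp add: linear_subspace_image)
      show "dim (p ` V) \<ge> dim W"
        using dim_image_eq[OF p(1), of V] inj V(1,2) by (simp add: span_eq_iff[THEN iffD2])
    qed (use W p(2) in auto)
    have "gap V W \<le> 2 * ((K + 1) * d)"
    proof (rule gap_le_graph[OF V(1) W])
      show "norm (x - p x) \<le> (K + 1) * d * norm x" if "x \<in> V" for x
      proof -
        have "norm (x - p x) \<le> d * (K * norm x)"
          using c[OF that] mult_left_mono[OF K(2)[of x] V(4)] by linarith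
        also have "\<dots> \<le> (K + 1) * d * norm x" using V(4) by (simp add: algebra_simps)
        finally show ?thesis .
      qed
      show "norm (x - p x) \<le> (K + 1) * d * norm (p x)" if "x \<in> V" for x
      proof -
        have "d * norm (p x) \<le> (K + 1) * d * norm (p x)"
          using V(4) K(1) by (intro mult_right_mono) (auto simp: algebra_simps)
        then show ?thesis using c[OF that] by linarith
      qed
    qed (use p \<open>p ` V = W\<close> K(1) V(4) in auto)
    then show ?thesis by (simp only: mult.assoc)
  qed
  then show ?thesis using K(1) by (intro exI[of _ "2 * (K + 1)"]) auto
qed

text \<open>An injective linear map on a finite-dimensional subspace is bounded below; this turns
  transversality into a finite slope.\<close>

lemma subset_cone_of_transverse:
  fixes p :: "'v::euclidean_space \<Rightarrow> 'v"
  assumes p: "linear p" and V: "subspace V" and t: "\<And>x. x \<in> V \<Longrightarrow> p x = 0 \<Longrightarrow> x = 0"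
  shows "\<exists>c>0. V \<subseteq> cone_set p c"
proof -
  have "\<exists>e>0. \<forall>x\<in>V. e * norm x \<le> norm (p x)"
    using injective_imp_isometric[OF closed_subspace[OF V] V, of p] p t
    by (auto simp: linear_conv_bounded_linear)
  then obtain e where e: "e > 0" "\<And>x. x \<in> V \<Longrightarrow> e * norm x \<le> norm (p x)" by blast
  have "norm (x - p x) \<le> (1 / e + 1) * norm (p x)" if "x \<in> V" for x
  proof -
    have "norm x \<le> norm (p x) / e" using e(1) e(2)[OF that] by (simp add: field_simps)
    then show ?thesis using norm_triangle_ineq4[of x "p x"] by (simp add: algebra_simps)
  qed
  then show ?thesis using e(1) by (intro exI[of _ "1 / e + 1"]) (auto simp: cone_set_def add_pos_pos)
qed

lemma cone_stable_gap:
  fixes p :: "'v::euclidean_space \<Rightarrow> 'v"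
  assumes p: "linear p" and W: "subspace W" "W \<subseteq> cone_set p c" and c: "c \<ge> 0"
  shows "\<exists>e>0. \<forall>V. subspace V \<longrightarrow> gap V W < e \<longrightarrow> V \<subseteq> cone_set p (c + 1)"
proof -
  obtain K where K: "K > 0" "\<And>x. norm (p x) \<le> K * norm x" using linear_bounded_pos[OF p(1)] by blast
  \<comment> \<open>Replacing \<open>x\<close> by its projection to \<open>W\<close> costs
    \<open>D\<close> times the distance. The choice of \<open>e\<close> makes
    \<open>D * e = 1 / (2 + c)\<close>, small enough to absorb the term in \<open>norm x\<close>
    while the slope rises only from \<open>c\<close> to \<open>c + 1\<close>.\<close>
  define D where "D = (1 + K) + c * K"
  have D: "D > 0" using K c by (simp add: D_def add_pos_nonneg)
  define e where "e = 1 / (D * (2 + c))"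
  have e: "e > 0" using D c by (simp add: e_def)
  have "V \<subseteq> cone_set p (c + 1)" if V: "subspace V" "gap V W < e" for V
  proof
    fix x assume x: "x \<in> V"
    let ?y = "closest_point W x"
    have y: "norm (?y - p ?y) \<le> c * norm (p ?y)"
      using closest_point_subspace_mem[OF W(1), of x] W(2) by (auto simp: cone_set_def)
    have "norm (x - ?y) \<le> gap V W * norm x" by (rule norm_diff_closest_point_gap[OF V(1) W(1) x])
    also have "\<dots> \<le> e * norm x" using V(2) by (intro mult_right_mono) auto
    finally have xy: "norm (x - ?y) \<le> e * norm x" .
    have q: "norm (p (x - ?y)) \<le> K * (e * norm x)"
      using K(2)[of "x - ?y"] mult_left_mono[OF xy, of K] K(1) by linarith
    have p1: "p ?y = p x - p (x - ?y)" by (simp add: linear_diff[OF p])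
    have "norm (x - p x) \<le> norm (?y - p ?y) + norm (x - ?y) + norm (p (x - ?y))"
    proof -
      have "x - p x = (?y - p ?y) + (x - ?y) - p (x - ?y)" by (simp add: p1)
      then show ?thesis by (metis norm_triangle_le add_right_mono norm_triangle_ineq norm_triangle_ineq4 order.trans)
    qed
    also have "\<dots> \<le> c * (norm (p x) + K * (e * norm x)) + e * norm x + K * (e * norm x)"
    proof -
      have "norm (p ?y) \<le> norm (p x) + K * (e * norm x)"
        using q arg_cong[OF p1, of norm] norm_triangle_ineq4[of "p x" "p (x - ?y)"] by linarith
      from mult_left_mono[OF this c] y xy q show ?thesis by linarith
    qed
    also have "\<dots> = c * norm (p x) + (D * e) * norm x" by (simp add: D_def algebra_simps)
    also have "D * e = 1 / (2 + c)" using D by (simp add: e_def)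
    finally have 1: "norm (x - p x) \<le> c * norm (p x) + norm x / (2 + c)" by simp
    have "norm x \<le> norm (p x) + norm (x - p x)"
      by (metis norm_triangle_sub)
    then have "norm x / (2 + c) \<le> (norm (p x) + norm (x - p x)) / (2 + c)"
      using c by (simp add: divide_right_mono)
    with 1 have "norm (x - p x) \<le> c * norm (p x) + (norm (p x) + norm (x - p x)) / (2 + c)" by linarith
    then have "(2 + c) * norm (x - p x) \<le> (2 + c) * c * norm (p x) + norm (p x) + norm (x - p x)"
      using c by (simp add: field_simps)
    then have "(1 + c) * norm (x - p x) \<le> (1 + c) * ((c + 1) * norm (p x))"
      by (simp add: algebra_simps)
    then have "norm (x - p x) \<le> (c + 1) * norm (p x)"
      using c by (subst (asm) mult_le_cancel_left_pos) auto
    then show "x \<in> cone_set p (c + 1)" by (simp add: cone_set_def)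
  qed
  then show ?thesis using e by blast
qed

section \<open>Isotropic subspaces and transversality\<close>

lemma sum_UNIV_Plus:
  fixes h :: "'n::finite + 'n \<Rightarrow> 'b::comm_monoid_add"
  shows "(\<Sum>k\<in>UNIV. h k) = (\<Sum>i\<in>UNIV. h (Inl i)) + (\<Sum>i\<in>UNIV. h (Inr i))"
  by (simp add: UNIV_Plus_UNIV[symmetric] sum.Plus del: UNIV_Plus_UNIV)

lemma I_nn_mult: "(I_nn *v w) $ k = (case k of Inl i \<Rightarrow> w $ k | Inr i \<Rightarrow> - w $ k)"
proof -
  have "(I_nn *v w) $ k = (\<Sum>j\<in>UNIV. if j = k then (case k of Inl i \<Rightarrow> w $ k | Inr i \<Rightarrow> - w $ k) else 0)"
    unfolding matrix_vector_mult_def I_nn_def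
    by (cases k) (auto intro!: sum.cong simp del: sum.delta sum.delta')
  then show ?thesis by simp
qed

lemma form_eq:
  "form v w = (\<Sum>i\<in>UNIV. v $ Inl i * w $ Inl i) - (\<Sum>i\<in>UNIV. v $ Inr i * w $ Inr i)"
  by (simp add: form_def inner_vec_def sum_UNIV_Plus I_nn_mult sum_negf)

lemma form_commute: "form v w = form w v"
  by (simp add: form_eq mult.commute)

lemma form_add_left: "form (u + v) w = form u w + form v w"
  by (simp add: form_def inner_add_left)

lemma form_scaleR_left: "form (c *\<^sub>R u) w = c * form u w"
  by (simp add: form_def)

lemma form_add_right: "form u (v + w) = form u v + form u w"
  by (metis form_commute form_add_left)

lemma form_scaleR_right: "form u (c *\<^sub>R w) = c * form u w"
  by (metis form_commute form_scaleR_left)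

lemma form_zero [simp]: "form 0 w = 0" "form w 0 = 0"
  using form_scaleR_left[of 0 0 w] form_scaleR_right[of w 0 0] by simp_all

lemma form_diff_left: "form (u - v) w = form u w - form v w"
  using form_add_left[of u "- v" w] form_scaleR_left[of "-1" v w] by simp

lemma form_diff_right: "form w (u - v) = form w u - form w v"
  by (metis form_commute form_diff_left)

lemma form_minus: "form (- u) w = - form u w" "form w (- u) = - form w u"
  using form_scaleR_left[of "-1" u w] form_scaleR_right[of w "-1" u] by simp_all

lemmas form_simps = form_add_left form_add_right form_scaleR_left form_scaleR_right
  form_diff_left form_diff_right form_minus

lemma I_nn_I_nn [simp]: "I_nn *v (I_nn *v w) = w"
  by (simp add: vec_eq_iff I_nn_mult split: sum.split)

lemma form_I_nn_left: "form (I_nn *v v) w = v \<bullet> w"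
  by (metis I_nn_I_nn form_commute form_def inner_commute)

lemma form_nondegenerate: "(\<And>w. form v w = 0) \<Longrightarrow> v = 0"
  by (metis form_I_nn_left form_commute inner_eq_zero_iff)

lemma tendsto_form:
  assumes "(f \<longlongrightarrow> a) F" "(g \<longlongrightarrow> b) F"
  shows "((\<lambda>x. form (f x) (g x)) \<longlongrightarrow> form a b) F"
  unfolding form_def
  by (intro tendsto_inner assms bounded_linear.tendsto[OF matrix_vector_mul_bounded_linear])

lemma subspace_perp: "subspace (perp W)"
  by (auto simp: subspace_def perp_def form_simps)

lemma perpD: "v \<in> perp W \<Longrightarrow> w \<in> W \<Longrightarrow> form v w = 0"
  by (simp add: perp_def)

lemma perpI: "(\<And>w. w \<in> W \<Longrightarrow> form v w = 0) \<Longrightarrow> v \<in> perp W"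
  by (simp add: perp_def)

lemma perp_span: "perp (span W) = perp W"
proof
  show "perp (span W) \<subseteq> perp W" by (auto simp: perp_def span_base)
  have "form v w = 0" if v: "v \<in> perp W" and w: "w \<in> span W" for v w
    using w
  proof (induction rule: span_induct)
    show "subspace {w. form v w = 0}" by (auto simp: subspace_def form_simps)
  qed (use v in \<open>auto simp: perp_def\<close>)
  then show "perp W \<subseteq> perp (span W)" by (auto simp: perp_def)
qed

lemma inj_I_nn: "inj ((*v) I_nn)"
  by (rule inj_on_inverseI[where g = "(*v) I_nn"]) simp

text \<open>\<open>perp W\<close> is the Euclidean orthogonal complement of the image of
  \<open>W\<close> under the involution \<open>I_nn\<close>.\<close>

lemma dim_perp:
  fixes W :: "'n::finite vec_nn set"
  assumes "subspace W"
  shows "dim (perp W) + dim W = 2 * CARD('n)"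
proof -
  let ?A = "(*v) I_nn ` W"
  have A: "subspace ?A" using assms by (simp add: linear_subspace_image)
  have "dim ?A = dim W"
    by (rule dim_image_eq) (auto intro: inj_on_subset[OF inj_I_nn])
  moreover have "{y \<in> UNIV. \<forall>x\<in>?A. orthogonal x y} = perp W"
    by (auto simp: perp_def form_def orthogonal_def inner_commute)
  ultimately show ?thesis
    using dim_subspace_orthogonal_to_vectors[OF A subspace_UNIV subset_UNIV] by simp
qed

lemma perp_perp:
  fixes W :: "'n::finite vec_nn set"
  assumes "subspace W"
  shows "perp (perp W) = W"
proof -
  have "W = perp (perp W)"
  proof (rule subspace_dim_equal[OF assms subspace_perp])
    show "W \<subseteq> perp (perp W)"
    proof
      fix x assume "x \<in> W"
      then have "form w x = 0" if "w \<in> perp W" for w using that by (simp add: perp_def)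
      then have "form x w = 0" if "w \<in> perp W" for w using that by (metis form_commute)
      then show "x \<in> perp (perp W)" unfolding perp_def[of "perp W"] by simp
    qed
    show "dim W \<ge> dim (perp (perp W))"
      using dim_perp[OF assms] dim_perp[OF subspace_perp[of W]] by simp
  qed
  then show ?thesis by simp
qed

lemma isotropic_spacesD:
  fixes W :: "'n::finite vec_nn set"
  assumes "W \<in> isotropic_spaces"
  shows "subspace W" "dim W = CARD('n) - 1" "W \<subseteq> perp W"
    "\<And>v w. v \<in> W \<Longrightarrow> w \<in> W \<Longrightarrow> form v w = 0"
  using assms by (auto simp: isotropic_spaces_def perp_def)

lemma dim_isotropic_le:
  fixes E :: "'n::finite vec_nn set"
  assumes "subspace E" "E \<subseteq> perp E"
  shows "dim E \<le> CARD('n)"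
  using dim_perp[OF assms(1)] dim_subset[OF assms(2)] by simp

text \<open>A subspace of dimension above n meets each of the two definite coordinate n-spaces, by
  counting dimensions in R^{2n}. The vectors found are positive and negative for the form.\<close>

lemma definite_subspaces:
  fixes Q :: "'n::finite vec_nn set"
  assumes Q: "subspace Q" "dim Q > CARD('n)"
  shows "\<exists>e\<in>Q. (\<forall>i. e $ Inr i = 0) \<and> e \<noteq> 0" "\<exists>e\<in>Q. (\<forall>i. e $ Inl i = 0) \<and> e \<noteq> 0"
proof -
  have *: "\<exists>e\<in>Q. e \<in> range f \<and> e \<noteq> 0" if f: "linear f" "inj f" for f :: "real^'n \<Rightarrow> 'n vec_nn"
  proof (rule ccontr)
    assume "\<not> ?thesis"
    then have "Q \<inter> range f \<subseteq> {0}" by auto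
    then have z: "dim (Q \<inter> range f) = 0" by (simp add: dim_eq_0)
    have R: "subspace (range f)" using f by (simp add: linear_subspace_image)
    have "dim (range f) = CARD('n)"
      using dim_image_eq[OF f(1), of UNIV] f(2) by simp
    moreover have "dim {x + y |x y. x \<in> Q \<and> y \<in> range f} \<le> 2 * CARD('n)"
      using dim_subset_UNIV[of "{x + y |x y. x \<in> Q \<and> y \<in> range f}"] by simp
    ultimately show False using dim_sums_Int[OF Q(1) R] z Q(2) by simp
  qed
  let ?f = "\<lambda>x::real^'n. (\<chi> k. case k of Inl i \<Rightarrow> x $ i | Inr i \<Rightarrow> 0) :: 'n vec_nn"
  let ?g = "\<lambda>x::real^'n. (\<chi> k. case k of Inr i \<Rightarrow> x $ i | Inl i \<Rightarrow> 0) :: 'n vec_nn"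
  have "linear ?f" "linear ?g"
    by (auto intro!: linearI simp: vec_eq_iff split: sum.split)
  moreover have "inj ?f"
    by (rule inj_on_inverseI[where g = "\<lambda>y. \<chi> i. y $ Inl i"]) (simp add: vec_eq_iff)
  moreover have "inj ?g"
    by (rule inj_on_inverseI[where g = "\<lambda>y. \<chi> i. y $ Inr i"]) (simp add: vec_eq_iff)
  ultimately have "\<exists>e\<in>Q. e \<in> range ?f \<and> e \<noteq> 0" "\<exists>e\<in>Q. e \<in> range ?g \<and> e \<noteq> 0"
    using *[of ?f] *[of ?g] by blast+
  moreover have "x \<in> range ?f \<Longrightarrow> \<forall>i. x $ Inr i = 0" "x \<in> range ?g \<Longrightarrow> \<forall>i. x $ Inl i = 0" for x
    by auto
  ultimately show "\<exists>e\<in>Q. (\<forall>i. e $ Inr i = 0) \<and> e \<noteq> 0" "\<exists>e\<in>Q. (\<forall>i. e $ Inl i = 0) \<and> e \<noteq> 0"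
    by blast+
qed

lemma perp_eq_span_pair:
  fixes W :: "'n::finite vec_nn set"
  assumes W: "W \<in> isotropic_spaces" and pq: "form p p = 0" "form q q = 0" "form p q \<noteq> 0" "p \<in> perp W" "q \<in> perp W"
  shows "span (insert p (insert q W)) = perp W"
proof (rule subspace_dim_equal[OF subspace_span subspace_perp])
  note Wd = isotropic_spacesD[OF W]
  have c: "CARD('n) > 0" by simp
  have dp: "dim (perp W) = CARD('n) + 1" using dim_perp[OF Wd(1)] Wd(2) c by linarith
  have qp: "form q p \<noteq> 0" using pq(3) form_commute[of q p] by simp
  show "span (insert p (insert q W)) \<subseteq> perp W"
    using pq(4,5) Wd(3) by (intro span_minimal subspace_perp) auto
  have "p \<notin> span (insert q W)"
  proof
    assume "p \<in> span (insert q W)"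
    moreover have "q \<in> perp (insert q W)" using pq(2,5) by (auto simp: perp_def)
    ultimately have "form q p = 0" unfolding perp_span[of "insert q W", symmetric] by (simp add: perp_def)
    then show False using qp by simp
  qed
  moreover have "q \<notin> span W"
  proof
    assume "q \<in> span W"
    moreover have "p \<in> perp (span W)" using pq(4) by (simp add: perp_span)
    ultimately have "form p q = 0" by (simp add: perp_def)
    then show False using pq(3) by simp
  qed
  ultimately have "dim (insert p (insert q W)) = dim W + 2"
    by (simp add: dim_insert)
  then show "dim (span (insert p (insert q W))) \<ge> dim (perp W)"
    using dp Wd(2) c by simp
qed

text \<open>As \<open>perp W\<close> has dimension n + 1, it contains a positive and a negative
  vector, orthogonal because their supports are disjoint. The sum and the difference of their
  normalizations are the null vectors.\<close>

lemma isotropic_hyperbolic_pair: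
  fixes W :: "'n::finite vec_nn set"
  assumes W: "W \<in> isotropic_spaces"
  shows "\<exists>p q. form p p = 0 \<and> form q q = 0 \<and> form p q = 2 \<and> p \<in> perp W \<and> q \<in> perp W \<and>
    span (insert p (insert q W)) = perp W"
proof -
  note Wd = isotropic_spacesD[OF W]
  have c: "CARD('n) > 0" by simp
  have dp: "dim (perp W) = CARD('n) + 1" using dim_perp[OF Wd(1)] Wd(2) c by linarith
  obtain e f where e: "e \<in> perp W" "\<And>i. e $ Inr i = 0" "e \<noteq> 0"
    and f: "f \<in> perp W" "\<And>i. f $ Inl i = 0" "f \<noteq> 0"
    using definite_subspaces[OF subspace_perp, of W] dp by auto
  have fe: "form e e = e \<bullet> e" "form f f = - (f \<bullet> f)" "form e f = 0" "form f e = 0"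
    using e(2) f(2) by (simp_all add: form_eq inner_vec_def sum_UNIV_Plus)
  define a b where "a = e /\<^sub>R norm e" and "b = f /\<^sub>R norm f"
  have "e \<bullet> e = norm e * norm e" "f \<bullet> f = norm f * norm f"
    by (metis power2_norm_eq_inner power2_eq_square)+
  then have ab: "form a a = 1" "form b b = -1" "form a b = 0" "form b a = 0"
  proof -
    have *: "inverse (norm x) * (inverse (norm x) * (norm x * norm x)) = 1" if "x \<noteq> 0" for x :: "'n vec_nn"
      using that by (simp add: mult.assoc[symmetric])
    show "form a a = 1" "form b b = -1" "form a b = 0" "form b a = 0"
      using *[OF e(3)] *[OF f(3)] \<open>e \<bullet> e = norm e * norm e\<close> \<open>f \<bullet> f = norm f * norm f\<close>
      by (simp_all only: a_def b_def form_scaleR_left form_scaleR_right fe mult_minus_right mult_zero_right)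
  qed
  have abp: "a \<in> perp W" "b \<in> perp W"
    using e(1) f(1) by (auto simp: a_def b_def intro: subspace_scale[OF subspace_perp])
  define p q where "p = a + b" and "q = a - b"
  have pq: "form p p = 0" "form q q = 0" "form p q = 2" "p \<in> perp W" "q \<in> perp W"
    using abp by (auto simp: p_def q_def form_simps ab intro: subspace_add subspace_diff subspace_perp)
  have "span (insert p (insert q W)) = perp W"
    using pq by (intro perp_eq_span_pair[OF W]) auto
  with pq show ?thesis by blast
qed

section \<open>Moving isotropic subspaces into general position\<close>

lemma gap_perturbation:
  fixes L :: "'v::euclidean_space \<Rightarrow> 'v"
  assumes W: "subspace W" and L: "linear L" and e: "e > 0"
  shows "\<exists>t>0. gap ((\<lambda>w. w + t *\<^sub>R L w) ` W) W < e"
proof -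
  obtain K where K: "K > 0" "\<And>x. norm (L x) \<le> K * norm x" using linear_bounded_pos[OF L] by blast
  \<comment> \<open>The bound 1/2 keeps \<open>norm w \<le> 2 * norm (?f w)\<close>, which gives the
    graph estimate with \<open>2 * d\<close>; the gap is then at most
    \<open>4 * d \<le> e / 2\<close>.\<close>
  define d where "d = min (e / 8) (1 / 2)"
  define t where "t = d / K"
  have d: "0 < d" "d \<le> 1 / 2" "d \<le> e / 8" using e by (auto simp: d_def)
  have t: "t > 0" using d K by (simp add: t_def)
  let ?f = "\<lambda>w. w + t *\<^sub>R L w"
  have lf: "linear ?f" using L by (intro linear_compose_add linear_compose_scale_right linear_ident)
  have b: "norm (w - ?f w) \<le> d * norm w" for w
  proof -
    have "norm (w - ?f w) = t * norm (L w)" using t by simp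
    also have "\<dots> \<le> t * (K * norm w)" using K(2) t by (intro mult_left_mono) auto
    also have "\<dots> = d * norm w" using K by (simp add: t_def)
    finally show ?thesis .
  qed
  have b2: "norm (w - ?f w) \<le> (2 * d) * norm (?f w)" for w
  proof -
    have "norm w \<le> norm (?f w) + norm (w - ?f w)" by (metis norm_triangle_sub)
    also have "norm (w - ?f w) \<le> 1 / 2 * norm w"
      using b[of w] d(2) by (meson mult_right_mono norm_ge_zero order_trans)
    finally have "norm w \<le> 2 * norm (?f w)" by simp
    then have "d * norm w \<le> d * (2 * norm (?f w))" using d by (intro mult_left_mono) auto
    then show ?thesis using b[of w] by simp
  qed
  have "gap W (?f ` W) \<le> 2 * (2 * d)"
  proof (rule gap_le_graph[OF W linear_subspace_image[OF lf W], where f = ?f])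
    show "norm (x - ?f x) \<le> 2 * d * norm x" for x
    proof -
      have "d * norm x \<le> 2 * d * norm x" using d by (intro mult_right_mono) auto
      then show ?thesis using b[of x] by linarith
    qed
  qed (use d b2 in auto)
  then have "gap (?f ` W) W < e" using d e by (simp add: gap_commute)
  then show ?thesis using t by blast
qed

text \<open>Shearing along a null vector of \<open>perp W\<close> creates no new products, and it is
  injective on \<open>W\<close> because \<open>u\<close> lies outside \<open>W\<close>.\<close>

lemma isotropic_move:
  fixes W :: "'n::finite vec_nn set"
  assumes W: "W \<in> isotropic_spaces" and u: "u \<in> perp W" "form u u = 0" "u \<notin> W" and F: "linear F"
  shows "(\<lambda>w. w + F w *\<^sub>R u) ` W \<in> isotropic_spaces"
proof -
  note Wd = isotropic_spacesD[OF W]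
  let ?f = "\<lambda>w. w + F w *\<^sub>R u"
  have lf: "linear ?f"
    using F by (auto intro!: linearI simp: linear_add linear_cmul algebra_simps)
  have "inj_on ?f W"
  proof (rule inj_onI)
    fix x y assume xy: "x \<in> W" "y \<in> W" "?f x = ?f y"
    then have eq: "x - y = (F y - F x) *\<^sub>R u" by (simp add: algebra_simps)
    have "x - y \<in> W" using Wd(1) xy by (auto intro: subspace_diff)
    then have "F y - F x = 0"
      using eq u(3) subspace_scale[OF Wd(1), of "x - y" "1 / (F y - F x)"] by (auto split: if_splits)
    then show "x = y" using eq by simp
  qed
  then have "dim (?f ` W) = dim W"
    by (intro dim_image_eq[OF lf]) (simp add: span_eq_iff[THEN iffD2, OF Wd(1)])
  moreover have "form (?f v) (?f w) = 0" if "v \<in> W" "w \<in> W" for v w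
  proof -
    have "form u v = 0" "form u w = 0" "form v w = 0" using u(1) that Wd(4) by (auto simp: perp_def)
    then show ?thesis using u(2) form_commute[of v u] by (simp add: form_simps)
  qed
  ultimately show ?thesis
    using linear_subspace_image[OF lf Wd(1)] Wd(2) by (auto simp: isotropic_spaces_def)
qed

lemma isotropic_perturbation:
  fixes W :: "'n::finite vec_nn set"
  assumes W: "W \<in> isotropic_spaces" and u: "u \<in> perp W" "form u u = 0" "u \<notin> W" and F: "linear F"
    and e: "e > 0"
  shows "\<exists>t>0. (\<lambda>w. w + (t * F w) *\<^sub>R u) ` W \<in> isotropic_spaces \<and>
    gap ((\<lambda>w. w + (t * F w) *\<^sub>R u) ` W) W < e"
proof -
  have L: "linear (\<lambda>w. F w *\<^sub>R u)"
    using F by (auto intro!: linearI simp: linear_add linear_cmul algebra_simps)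
  obtain t where t: "t > 0" "gap ((\<lambda>w. w + t *\<^sub>R (F w *\<^sub>R u)) ` W) W < e"
    using gap_perturbation[OF isotropic_spacesD(1)[OF W] L e] by blast
  have "linear (\<lambda>w. t * F w)"
    using F by (auto intro!: linearI simp: linear_add linear_cmul algebra_simps)
  from isotropic_move[OF W u this] t show ?thesis by auto
qed

lemma dim_less_if_missing:
  assumes "subspace A" "subspace B" "A \<subseteq> B" "x \<in> B" "x \<notin> (A :: 'v::euclidean_space set)"
  shows "dim A < dim B"
  using assms by (intro dim_psubset) (auto simp: span_eq_iff[THEN iffD2])

text \<open>Some null vector \<open>u\<close> of \<open>perp W\<close> pairs non-trivially with
  \<open>r\<close>. After the shear \<open>w + t (w \<bullet> x) u\<close>, orthogonality to
  \<open>r\<close> forces \<open>w \<bullet> x = 0\<close>; what remains of the intersection thus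
  lies in the old one and misses \<open>x\<close>.\<close>

lemma isotropic_reduce_outside:
  fixes W R :: "'n::finite vec_nn set"
  assumes W: "W \<in> isotropic_spaces"
    and r: "r \<in> R" "r \<in> perp W" "r \<notin> W" and x: "x \<in> W" "x \<in> perp R" "x \<noteq> 0" and e: "e > 0"
  shows "\<exists>W'\<in>isotropic_spaces. gap W' W < e \<and> dim (W' \<inter> perp R) < dim (W \<inter> perp R)"
proof -
  note Wd = isotropic_spacesD[OF W]
  obtain p q where pq: "form p p = 0" "form q q = 0" "p \<in> perp W" "q \<in> perp W"
    "span (insert p (insert q W)) = perp W"
    using isotropic_hyperbolic_pair[OF W] by blast
  have "\<exists>u\<in>{p, q}. form u r \<noteq> 0"
  proof (rule ccontr)
    assume "\<not> ?thesis"
    then have "r \<in> perp (insert p (insert q W))"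
      using r(2) form_commute[of r p] form_commute[of r q] by (auto simp: perp_def)
    then have "r \<in> perp (perp W)" unfolding pq(5)[symmetric] by (simp add: perp_span)
    then show False using r(3) perp_perp[OF Wd(1)] by simp
  qed
  then obtain u where u: "u \<in> perp W" "form u u = 0" "form u r \<noteq> 0" using pq by auto
  have uW: "u \<notin> W" using u(3) r(2) form_commute[of r u] by (auto simp: perp_def)
  have F: "linear (\<lambda>w. w \<bullet> x)" by (auto intro!: linearI simp: inner_add_left)
  obtain t where t: "t > 0" and W': "(\<lambda>w. w + (t * (w \<bullet> x)) *\<^sub>R u) ` W \<in> isotropic_spaces"
    "gap ((\<lambda>w. w + (t * (w \<bullet> x)) *\<^sub>R u) ` W) W < e"
    using isotropic_perturbation[OF W u(1,2) uW F e] by blast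
  let ?W' = "(\<lambda>w. w + (t * (w \<bullet> x)) *\<^sub>R u) ` W"
  let ?A = "{w \<in> W \<inter> perp R. w \<bullet> x = 0}"
  have "?W' \<inter> perp R \<subseteq> ?A"
  proof
    fix z assume "z \<in> ?W' \<inter> perp R"
    then obtain w where w: "w \<in> W" "z = w + (t * (w \<bullet> x)) *\<^sub>R u" "z \<in> perp R" by auto
    have "0 = form z r" using w(3) r(1) by (auto simp: perp_def)
    also have "\<dots> = t * (w \<bullet> x) * form u r"
      using r(2) w(1) form_commute[of w r] by (simp add: w(2) form_simps perp_def)
    finally have "w \<bullet> x = 0" using t u(3) by simp
    then show "z \<in> ?A" using w by simp
  qed
  then have "dim (?W' \<inter> perp R) \<le> dim ?A" by (rule dim_subset)
  also have "dim ?A < dim (W \<inter> perp R)"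
  proof (rule dim_less_if_missing)
    show "subspace (W \<inter> perp R)" by (intro subspace_inter Wd subspace_perp)
    then show "subspace ?A" by (auto simp: subspace_def inner_add_left)
    show "x \<in> W \<inter> perp R" "x \<notin> ?A" using x by auto
  qed auto
  finally show ?thesis using W' by blast
qed

text \<open>The single shear requires a vector of \<open>R\<close> in \<open>perp W\<close> outside
  \<open>W\<close>. If there is none, \<open>W\<close> and \<open>R\<close> share a non-zero vector;
  \<open>W\<close> is first moved off it without enlarging the intersection, and the single shear is
  applied to the result unless that is already transverse.\<close>

lemma isotropic_reduce:
  fixes W R :: "'n::finite vec_nn set"
  assumes W: "W \<in> isotropic_spaces" and R: "R \<in> isotropic_spaces"
    and x: "x \<in> W" "x \<in> perp R" "x \<noteq> 0" and e: "e > 0"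
  shows "\<exists>W'\<in>isotropic_spaces. gap W' W < e \<and> dim (W' \<inter> perp R) < dim (W \<inter> perp R)"
proof (cases "R \<inter> perp W \<subseteq> W")
  case False
  then obtain r where "r \<in> R" "r \<in> perp W" "r \<notin> W" by auto
  from isotropic_reduce_outside[OF W this x e] show ?thesis .
next
  case True
  note Wd = isotropic_spacesD[OF W] and Rd = isotropic_spacesD[OF R]
  have sWR: "subspace (W \<inter> perp R)" by (intro subspace_inter Wd subspace_perp)
  \<comment> \<open>The dimensions of \<open>W\<close> and \<open>perp R\<close> add up to 2n, so a
    non-trivial intersection makes their sum a proper subspace; a non-zero vector orthogonal to the
    sum lies in both \<open>perp W\<close> and \<open>R\<close>.\<close>
  have "dim {a + b |a b. a \<in> W \<and> b \<in> perp R} < 2 * CARD('n)"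
  proof -
    have "\<not> W \<inter> perp R \<subseteq> {0}" using x by auto
    then have "dim (W \<inter> perp R) > 0" by (subst neq0_conv[symmetric]) (simp add: dim_eq_0)
    then show ?thesis
      using dim_sums_Int[OF Wd(1) subspace_perp, of R] dim_perp[OF Rd(1)] Wd(2) Rd(2) by simp
  qed
  then have "dim (perp {a + b |a b. a \<in> W \<and> b \<in> perp R}) > 0"
    using dim_perp[OF subspace_sums[OF Wd(1) subspace_perp, of R]] by simp
  then have "\<not> perp {a + b |a b. a \<in> W \<and> b \<in> perp R} \<subseteq> {0}"
    by (subst (asm) neq0_conv[symmetric]) (simp add: dim_eq_0)
  then obtain r where r: "r \<in> perp {a + b |a b. a \<in> W \<and> b \<in> perp R}" "r \<noteq> 0" by auto
  have r0: "form r z = 0" if "z \<in> {a + b |a b. a \<in> W \<and> b \<in> perp R}" for z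
    by (rule perpD[OF r(1) that])
  have r1: "form r (a + b) = 0" if "a \<in> W" "b \<in> perp R" for a b
    by (rule r0) (use that in blast)
  have "form r a = 0" if "a \<in> W" for a
    using r1[OF that subspace_0[OF subspace_perp]] by simp
  moreover have "form r b = 0" if "b \<in> perp R" for b
    using r1[OF subspace_0[OF Wd(1)] that] by simp
  ultimately have rW: "r \<in> perp W" and "r \<in> perp (perp R)" unfolding perp_def[of W] perp_def[of "perp R"] by auto
  then have rR: "r \<in> R" by (simp add: perp_perp[OF Rd(1)])
  with True rW have rW': "r \<in> W" by auto
  obtain p q where pq: "form p p = 0" "form p q = 2" "p \<in> perp W" "q \<in> perp W"
    using isotropic_hyperbolic_pair[OF W] by blast
  have pW: "p \<notin> W" using pq form_commute[of q p] by (auto simp: perp_def)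
  have F: "linear (\<lambda>w. w \<bullet> r)" by (auto intro!: linearI simp: inner_add_left)
  obtain t where t: "t > 0" and W': "(\<lambda>w. w + (t * (w \<bullet> r)) *\<^sub>R p) ` W \<in> isotropic_spaces"
    "gap ((\<lambda>w. w + (t * (w \<bullet> r)) *\<^sub>R p) ` W) W < e / 2"
    using isotropic_perturbation[OF W pq(3,1) pW F, of "e / 2"] e by auto
  let ?f = "\<lambda>w. w + (t * (w \<bullet> r)) *\<^sub>R p"
  define W1 where "W1 = ?f ` W"
  have W1: "W1 \<in> isotropic_spaces" "gap W1 W < e / 2" using W' by (auto simp: W1_def)
  let ?A = "{w \<in> W \<inter> perp R. w \<bullet> r = 0}"
  have A: "dim ?A < dim (W \<inter> perp R)"
  proof (rule dim_less_if_missing[OF _ sWR, of _ r])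
    show "subspace ?A" using sWR by (auto simp: subspace_def inner_add_left)
    show "r \<in> W \<inter> perp R" "r \<notin> ?A" using rW' rR Rd(3) r(2) by auto
  qed auto
  \<comment> \<open>Cutting by \<open>w \<bullet> r = 0\<close> loses a dimension, since
    \<open>r\<close> itself is in the intersection, and the shear can restore at most one.\<close>
  have dW1: "dim (W1 \<inter> perp R) \<le> dim (W \<inter> perp R)"
  proof (cases "W1 \<inter> perp R \<subseteq> ?A")
    case True
    then show ?thesis using dim_subset[OF True] A by simp
  next
    case False
    then obtain w0 where w0: "w0 \<in> W" "?f w0 \<in> perp R" "\<not> ?f w0 \<in> ?A" by (auto simp: W1_def)
    have F0: "w0 \<bullet> r \<noteq> 0" using w0 by auto
    have "W1 \<inter> perp R \<subseteq> span (insert (?f w0) ?A)"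
    proof
      fix z assume "z \<in> W1 \<inter> perp R"
      then obtain w where w: "w \<in> W" "z = ?f w" "z \<in> perp R" by (auto simp: W1_def)
      define c where "c = (w \<bullet> r) / (w0 \<bullet> r)"
      have "z - c *\<^sub>R ?f w0 = w - c *\<^sub>R w0"
        using F0 by (simp add: w(2) c_def algebra_simps)
      moreover have "z - c *\<^sub>R ?f w0 \<in> perp R"
        using w w0 by (intro subspace_diff subspace_scale subspace_perp)
      moreover have "w - c *\<^sub>R w0 \<in> W" using w w0 Wd(1) by (intro subspace_diff subspace_scale)
      moreover have "(w - c *\<^sub>R w0) \<bullet> r = 0" using F0 by (simp add: c_def inner_diff_left)
      ultimately have "z - c *\<^sub>R ?f w0 \<in> ?A" by simp
      then show "z \<in> span (insert (?f w0) ?A)"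
        unfolding span_breakdown_eq by (blast intro: span_base)
    qed
    from dim_subset[OF this] have "dim (W1 \<inter> perp R) \<le> dim (insert (?f w0) ?A)"
      by (simp only: dim_span)
    also have "\<dots> \<le> dim ?A + 1" by (simp add: dim_insert)
    finally show ?thesis using A by simp
  qed
  have rW1p: "r \<in> perp W1"
    using rW' Wd(4) pq(3) form_commute[of r p] by (auto simp: W1_def perp_def form_simps)
  have rW1: "r \<notin> W1"
  proof
    assume "r \<in> W1"
    then obtain w where w: "w \<in> W" "r = ?f w" by (auto simp: W1_def)
    have "w \<bullet> r \<noteq> 0" using w(2) r(2) by (metis add.right_neutral inner_eq_zero_iff mult_zero_right scaleR_zero_left)
    moreover have "(t * (w \<bullet> r)) *\<^sub>R p \<in> W"
      using subspace_diff[OF Wd(1) rW' w(1)] w(2) by (metis add_diff_cancel_left')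
    ultimately show False
      using pW t subspace_scale[OF Wd(1), of "(t * (w \<bullet> r)) *\<^sub>R p" "1 / (t * (w \<bullet> r))"] by auto
  qed
  show ?thesis
  proof (cases "W1 \<inter> perp R \<subseteq> {0}")
    case True
    then have z: "dim (W1 \<inter> perp R) = 0" by (simp add: dim_eq_0)
    have "dim (W1 \<inter> perp R) < dim (W \<inter> perp R)" unfolding z using A by linarith
    moreover have "gap W1 W < e" using W1(2) e by simp
    ultimately show ?thesis using W1(1) by blast
  next
    case False
    then obtain y where "y \<in> W1" "y \<in> perp R" "y \<noteq> 0" by auto
    from isotropic_reduce_outside[OF W1(1) rR rW1p rW1 this, of "e / 2"] e
    obtain W2 where W2: "W2 \<in> isotropic_spaces" "gap W2 W1 < e / 2" "dim (W2 \<inter> perp R) < dim (W1 \<inter> perp R)"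
      by auto
    have "gap W2 W < e"
      using gap_triangle[OF isotropic_spacesD(1)[OF W2(1)] isotropic_spacesD(1)[OF W1(1)] Wd(1)] W1(2) W2(2)
      by linarith
    then show ?thesis using W2 dW1 by (intro bexI[of _ W2]) auto
  qed
qed

text \<open>Each reduction lowers the dimension of the intersection and spends half of the allowed
  distance. This supplies test subspaces for attracting fixed points, whose definition quantifies
  over isotropic subspaces only.\<close>

lemma isotropic_transverse_dense:
  fixes W R :: "'n::finite vec_nn set"
  assumes W: "W \<in> isotropic_spaces" and R: "R \<in> isotropic_spaces" and e: "e > 0"
  shows "\<exists>W'\<in>isotropic_spaces. gap W' W < e \<and> W' \<inter> perp R \<subseteq> {0}"
  using W e
proof (induction "dim (W \<inter> perp R)" arbitrary: W e rule: less_induct)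
  case less
  show ?case
  proof (cases "W \<inter> perp R \<subseteq> {0}")
    case True
    have "gap W W = 0" by (simp add: gap_def onorm_zero)
    with True less.prems show ?thesis by (intro bexI[of _ W]) auto
  next
    case False
    then obtain x where "x \<in> W" "x \<in> perp R" "x \<noteq> 0" by auto
    from isotropic_reduce[OF less.prems(1) R this, of "e / 2"] less.prems(2)
    obtain W1 where W1: "W1 \<in> isotropic_spaces" "gap W1 W < e / 2"
      "dim (W1 \<inter> perp R) < dim (W \<inter> perp R)" by auto
    from less.hyps[OF W1(3,1), of "e / 2"] less.prems(2)
    obtain W' where W': "W' \<in> isotropic_spaces" "gap W' W1 < e / 2" "W' \<inter> perp R \<subseteq> {0}" by auto
    have "gap W' W < e"
      using gap_triangle[of W' W1 W] isotropic_spacesD(1) W'(1,2) W1(1,2) less.prems(1) by fastforce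
    then show ?thesis using W' by blast
  qed
qed

section \<open>Dominated linear maps\<close>

lemma funpow_image:
  fixes f :: "'c \<Rightarrow> 'c"
  shows "((\<lambda>V. f ` V) ^^ m) V = (f ^^ m) ` V"
  by (induction m) (auto simp: image_image)

lemma linear_funpow: "linear (f :: 'v::real_vector \<Rightarrow> 'v) \<Longrightarrow> linear (f ^^ m)"
proof (induction m)
  case 0
  then show ?case by (simp add: linear_id[unfolded id_def] id_def)
next
  case (Suc m)
  then show ?case using linear_compose[of "f ^^ m" f] by (simp add: o_def)
qed

lemma funpow_image_invariant:
  fixes f :: "'c \<Rightarrow> 'c"
  assumes "f ` W = W" shows "(f ^^ m) ` W = W"
proof (induction m)
  case (Suc m)
  have "(f ^^ Suc m) ` W = f ` (f ^^ m) ` W" by (simp only: funpow.simps image_comp)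
  then show ?case using Suc assms by simp
qed simp

lemma funpow_eigen:
  fixes f :: "'c::real_vector \<Rightarrow> 'c"
  assumes "linear f" "f p = a *\<^sub>R p" shows "(f ^^ m) p = a ^ m *\<^sub>R p"
  by (induction m) (simp_all add: assms linear_scale)

text \<open>The \<open>m\<close>-th iterate multiplies slopes over the range of \<open>p\<close> by
  a factor \<open>e m\<close> that tends to 0 and is the same for all openings \<open>c\<close>. No
  single step has to contract.\<close>

definition dominated :: "('v::euclidean_space \<Rightarrow> 'v) \<Rightarrow> ('v \<Rightarrow> 'v) \<Rightarrow> bool" where
  "dominated f p \<longleftrightarrow> linear f \<and> inj f \<and> linear p \<and>
     (\<exists>e. e \<longlonglongrightarrow> 0 \<and> (\<forall>m. 0 \<le> e m) \<and>
       (\<forall>m c x. 0 \<le> c \<longrightarrow> x \<in> cone_set p c \<longrightarrow> (f ^^ m) x \<in> cone_set p (c * e m)))"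

text \<open>The bound is uniform over all \<open>V\<close> near \<open>V0\<close>. In the ping-pong
  the \<open>k\<close>-th iterate acts on subspaces that themselves change with \<open>k\<close>, so
  convergence for each single subspace would not do.\<close>

lemma dominated_uniform_attraction:
  fixes f :: "'v::euclidean_space \<Rightarrow> 'v"
  assumes f: "dominated f p" and V0: "subspace V0" "\<And>x. x \<in> V0 \<Longrightarrow> p x = 0 \<Longrightarrow> x = 0"
  shows "\<exists>d e. d > 0 \<and> e \<longlonglongrightarrow> 0 \<and>
    (\<forall>m V. subspace V \<longrightarrow> dim V = dim (range p) \<longrightarrow> gap V V0 < d \<longrightarrow> gap ((f ^^ m) ` V) (range p) \<le> e m)"
proof -
  obtain e where e: "e \<longlonglongrightarrow> 0" "\<And>m. 0 \<le> e m"
    "\<And>m c x. 0 \<le> c \<Longrightarrow> x \<in> cone_set p c \<Longrightarrow> (f ^^ m) x \<in> cone_set p (c * e m)"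
    and lf: "linear f" "inj f" "linear p"
    using f unfolding dominated_def by blast
  have sp: "subspace (range p)" using lf(3) by (simp add: linear_subspace_image)
  obtain K where K: "K > 0" "\<And>V d. subspace V \<Longrightarrow> dim V = dim (range p) \<Longrightarrow> V \<subseteq> cone_set p d \<Longrightarrow> 0 \<le> d
    \<Longrightarrow> gap V (range p) \<le> K * d"
    using gap_cone[OF lf(3) order_refl sp] by blast
  obtain c where c: "c > 0" "V0 \<subseteq> cone_set p c"
    using subset_cone_of_transverse[OF lf(3) V0] by blast
  obtain d where d: "d > 0" "\<And>V. subspace V \<Longrightarrow> gap V V0 < d \<Longrightarrow> V \<subseteq> cone_set p (c + 1)"
    using cone_stable_gap[OF lf(3) V0(1) c(2)] c(1) by auto
  have "gap ((f ^^ m) ` V) (range p) \<le> K * ((c + 1) * e m)"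
    if V: "subspace V" "dim V = dim (range p)" "gap V V0 < d" for m V
  proof (rule K(2))
    show "subspace ((f ^^ m) ` V)" using V(1) lf(1) by (simp add: linear_subspace_image linear_funpow)
    show "dim ((f ^^ m) ` V) = dim (range p)"
      using dim_image_eq[OF linear_funpow[OF lf(1)], of m V] inj_fn[OF lf(2), of m] V(2)
      by (simp add: inj_on_subset)
    show "(f ^^ m) ` V \<subseteq> cone_set p ((c + 1) * e m)"
      using d(2)[OF V(1,3)] e(3)[of "c + 1" _ m] c(1) by auto
  qed (use c e(2) in simp)
  moreover have "(\<lambda>m. K * ((c + 1) * e m)) \<longlonglongrightarrow> 0"
    by (intro tendsto_mult_right_zero e(1))
  ultimately show ?thesis
    by (intro exI[of _ d] exI[of _ "\<lambda>m. K * ((c + 1) * e m)"]) (simp add: d(1))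
qed

lemma gap_self [simp]: "gap V V = 0"
  by (simp add: gap_def onorm_zero)

lemma dominated_attraction:
  fixes f :: "'v::euclidean_space \<Rightarrow> 'v"
  assumes f: "dominated f p" and V: "subspace V" "\<And>x. x \<in> V \<Longrightarrow> p x = 0 \<Longrightarrow> x = 0" "dim V = dim (range p)"
  shows "(\<lambda>m. gap ((f ^^ m) ` V) (range p)) \<longlonglongrightarrow> 0"
proof -
  obtain d e where de: "d > 0" "e \<longlonglongrightarrow> 0"
    "\<And>m V'. subspace V' \<Longrightarrow> dim V' = dim (range p) \<Longrightarrow> gap V' V < d \<Longrightarrow> gap ((f ^^ m) ` V') (range p) \<le> e m"
    using dominated_uniform_attraction[OF f V(1,2)] by auto
  have lf: "linear f" "linear p" using f by (auto simp: dominated_def)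
  show ?thesis
  proof (rule tendsto_sandwich[OF _ _ tendsto_const de(2)])
    show "\<forall>\<^sub>F m in sequentially. 0 \<le> gap ((f ^^ m) ` V) (range p)"
      using V(1) lf by (intro always_eventually allI gap_nonneg linear_subspace_image linear_funpow subspace_UNIV)
    show "\<forall>\<^sub>F m in sequentially. gap ((f ^^ m) ` V) (range p) \<le> e m"
      using de V by auto
  qed
qed

text \<open>The range lies in the cone of opening 0, hence nearby subspaces lie in that of opening
  1, where \<open>p x = 0\<close> forces \<open>x = 0\<close>.\<close>

lemma transverse_near_range:
  fixes f :: "'v::euclidean_space \<Rightarrow> 'v"
  assumes p: "linear p" "\<And>x. p (p x) = p x"
  shows "\<exists>e>0. \<forall>V. subspace V \<longrightarrow> gap V (range p) < e \<longrightarrow> (\<forall>x\<in>V. p x = 0 \<longrightarrow> x = 0)"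
proof -
  have "range p \<subseteq> cone_set p 0" using p by (auto simp: cone_set_def)
  from cone_stable_gap[OF p(1) _ this] p(1) obtain e where
    "e > 0" "\<And>V. subspace V \<Longrightarrow> gap V (range p) < e \<Longrightarrow> V \<subseteq> cone_set p (0 + 1)"
    by (auto simp: linear_subspace_image)
  then show ?thesis by (intro exI[of _ e]) (force simp: cone_set_def)
qed

text \<open>
  An open set of subspaces around the attractor of A is mapped into itself by \<open>A\<^sup>k B\<^sup>k\<close>, so it
  contains the limit of every orbit that starts in it.
\<close>

lemma ping_pong:
  fixes A B :: "'v::euclidean_space \<Rightarrow> 'v"
  assumes A: "dominated A pA" and B: "dominated B pB"
    and dims: "dim (range pA) = dim (range pB)"
    and tA: "\<And>x. x \<in> range pA \<Longrightarrow> pB x = 0 \<Longrightarrow> x = 0"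
    and tB: "\<And>x. x \<in> range pB \<Longrightarrow> pA x = 0 \<Longrightarrow> x = 0"
  shows "\<exists>d e. d > 0 \<and> e \<longlonglongrightarrow> 0 \<and> (\<forall>\<^sub>F k in sequentially. \<forall>V U. subspace V \<longrightarrow> subspace U \<longrightarrow>
    dim V = dim (range pA) \<longrightarrow> gap V (range pA) < d \<longrightarrow>
    (\<lambda>m. gap ((((A ^^ k) \<circ> (B ^^ k)) ^^ m) ` V) U) \<longlonglongrightarrow> 0 \<longrightarrow> gap U (range pA) \<le> e k)"
proof -
  have l: "linear A" "inj A" "linear B" "inj B" "linear pA" "linear pB" using A B by (auto simp: dominated_def)
  have s: "subspace (range pA)" "subspace (range pB)" using l by (auto simp: linear_subspace_image)
  obtain d1 e1 where 1: "d1 > 0" "e1 \<longlonglongrightarrow> 0"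
    "\<And>m V. subspace V \<Longrightarrow> dim V = dim (range pB) \<Longrightarrow> gap V (range pA) < d1 \<Longrightarrow> gap ((B ^^ m) ` V) (range pB) \<le> e1 m"
    using dominated_uniform_attraction[OF B s(1) tA] by blast
  obtain d2 e2 where 2: "d2 > 0" "e2 \<longlonglongrightarrow> 0"
    "\<And>m V. subspace V \<Longrightarrow> dim V = dim (range pA) \<Longrightarrow> gap V (range pB) < d2 \<Longrightarrow> gap ((A ^^ m) ` V) (range pA) \<le> e2 m"
    using dominated_uniform_attraction[OF A s(2) tB] by blast
  have dimim: "dim ((A ^^ k) ` V) = dim V" "dim ((B ^^ k) ` V) = dim V" for k V
    using dim_image_eq[OF linear_funpow[OF l(1)], of k V] inj_fn[OF l(2), of k]
      dim_image_eq[OF linear_funpow[OF l(3)], of k V] inj_fn[OF l(4), of k]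
    by (auto simp: inj_on_subset)
  have "\<forall>\<^sub>F k in sequentially. e1 k < d2" "\<forall>\<^sub>F k in sequentially. e2 k < d1"
    using order_tendstoD(2)[OF 1(2) 2(1)] order_tendstoD(2)[OF 2(2) 1(1)] by auto
  then have "\<forall>\<^sub>F k in sequentially. \<forall>V U. subspace V \<longrightarrow> subspace U \<longrightarrow>
    dim V = dim (range pA) \<longrightarrow> gap V (range pA) < d1 \<longrightarrow>
    (\<lambda>m. gap ((((A ^^ k) \<circ> (B ^^ k)) ^^ m) ` V) U) \<longlonglongrightarrow> 0 \<longrightarrow> gap U (range pA) \<le> e2 k"
  proof eventually_elim
    case (elim k)
    let ?C = "(A ^^ k) \<circ> (B ^^ k)"
    \<comment> \<open>For the \<open>k\<close> at hand, \<open>B ^^ k\<close> sends the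
      \<open>d1\<close>-ball around the range of \<open>pA\<close> into the \<open>d2\<close>-ball
      around the range of \<open>pB\<close>, and \<open>A ^^ k\<close> sends that ball to within
      \<open>e2 k\<close> of the range of \<open>pA\<close>.\<close>
    have step: "subspace (?C ` V) \<and> dim (?C ` V) = dim (range pA) \<and> gap (?C ` V) (range pA) \<le> e2 k"
      if V: "subspace V" "dim V = dim (range pA)" "gap V (range pA) < d1" for V
    proof -
      have "gap ((B ^^ k) ` V) (range pB) < d2"
        using 1(3)[of V k] V dims elim by simp
      moreover have "subspace ((B ^^ k) ` V)" using V l by (simp add: linear_subspace_image linear_funpow)
      ultimately have "gap ((A ^^ k) ` (B ^^ k) ` V) (range pA) \<le> e2 k"
        using 2(3)[of "(B ^^ k) ` V" k] dimim V by simp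
      moreover have "?C ` V = (A ^^ k) ` (B ^^ k) ` V" by (simp only: image_comp)
      ultimately show ?thesis
        using V l by (simp only:) (simp add: linear_subspace_image linear_funpow dimim)
    qed
    show ?case
    proof (intro allI impI)
      fix V U
      assume V: "subspace V" and U: "subspace U" and dV: "dim V = dim (range pA)" "gap V (range pA) < d1"
        and lim: "(\<lambda>m. gap ((?C ^^ m) ` V) U) \<longlonglongrightarrow> 0"
      \<comment> \<open>Stated from the first iterate on, since \<open>V\<close> itself is only
        \<open>d1\<close>-close and may violate the bound \<open>e2 k\<close>.\<close>
      have it: "subspace ((?C ^^ Suc m) ` V) \<and> dim ((?C ^^ Suc m) ` V) = dim (range pA) \<and>
          gap ((?C ^^ Suc m) ` V) (range pA) \<le> e2 k" for m
      proof (induction m)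
        case 0
        then show ?case using step[OF V dV] by simp
      next
        case (Suc m)
        have eq: "?C ` (?C ^^ Suc m) ` V = (?C ^^ Suc (Suc m)) ` V" by (simp only: funpow.simps image_comp)
        have "gap ((?C ^^ Suc m) ` V) (range pA) < d1" using Suc elim by linarith
        from step[OF conjunct1[OF Suc] conjunct1[OF conjunct2[OF Suc]] this] show ?case unfolding eq .
      qed
      show "gap U (range pA) \<le> e2 k"
      proof (rule tendsto_lowerbound)
        show "(\<lambda>m. gap ((?C ^^ Suc m) ` V) U + e2 k) \<longlonglongrightarrow> e2 k"
          using tendsto_add[OF LIMSEQ_Suc[OF lim] tendsto_const[of "e2 k"]] by (simp only: add_0_left)
        have "gap U (range pA) \<le> gap ((?C ^^ Suc m) ` V) U + e2 k" for m
          using gap_triangle[OF U, of "(?C ^^ Suc m) ` V" "range pA"] it[of m] s(1)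
          by (simp add: gap_commute[of U])
        then show "\<forall>\<^sub>F m in sequentially. gap U (range pA) \<le> gap ((?C ^^ Suc m) ` V) U + e2 k"
          by simp
      qed simp
    qed
  qed
  with 1(1) 2(2) show ?thesis by blast
qed

text \<open>The orthonormal basis is chosen before \<open>T\<close>, so finitely many values bound
  every \<open>T\<close>. This upgrades pointwise growth of iterates to estimates uniform on
  \<open>S\<close>.\<close>

lemma linear_bound_on_subspace:
  fixes S :: "'v::euclidean_space set"
  assumes S: "subspace S"
  shows "\<exists>B. finite B \<and> B \<subseteq> S \<and> span B = S \<and> independent B \<and>
    (\<forall>T::'v \<Rightarrow> 'w::real_normed_vector. linear T \<longrightarrow> (\<forall>x\<in>S. norm (T x) \<le> (\<Sum>b\<in>B. norm (T b)) * norm x))"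
proof -
  obtain B where B: "B \<subseteq> S" "pairwise orthogonal B" "\<And>x. x \<in> B \<Longrightarrow> norm x = 1"
    "independent B" "card B = dim S" "span B = S"
    using orthonormal_basis_subspace[OF S] by blast
  have fin: "finite B" using B(4) by (rule independent_imp_finite)
  have "norm (T x) \<le> (\<Sum>b\<in>B. norm (T b)) * norm x" if T: "linear T" and x: "x \<in> S" for T :: "'v \<Rightarrow> 'w" and x
  proof -
    have "x = (\<Sum>b\<in>B. (b \<bullet> x) *\<^sub>R b)"
    proof -
      have "x \<in> span B" using x B by simp
      from orthonormal_basis_expand[OF B(2,3) this fin] show ?thesis by (simp add: inner_commute)
    qed
    then have "T x = (\<Sum>b\<in>B. (b \<bullet> x) *\<^sub>R T b)"
      by (metis (no_types, lifting) T linear_sum linear_scale sum.cong)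
    then have "norm (T x) \<le> (\<Sum>b\<in>B. \<bar>b \<bullet> x\<bar> * norm (T b))"
      by (metis (no_types, lifting) norm_scaleR norm_sum sum.cong)
    also have "\<dots> \<le> (\<Sum>b\<in>B. norm x * norm (T b))"
      using Cauchy_Schwarz_ineq2[of _ x] B(3) by (intro sum_mono mult_right_mono) (auto, metis mult_1)
    finally show ?thesis by (simp add: sum_distrib_left sum_distrib_right mult.commute)
  qed
  then show ?thesis using B fin by blast
qed

section \<open>Loxodromic isometries\<close>

lemma projection_along:
  fixes W H :: "'v::euclidean_space set"
  assumes W: "subspace W" and H: "subspace H" and i: "W \<inter> H \<subseteq> {0}"
    and d: "dim W + dim H = DIM('v)"
  shows "\<exists>p. linear p \<and> range p = W \<and> (\<forall>x. p x = 0 \<longleftrightarrow> x \<in> H) \<and> (\<forall>x\<in>W. p x = x) \<and> (\<forall>x. x - p x \<in> H)"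
proof -
  have "dim (W \<inter> H) = 0" using i by (simp add: dim_eq_0)
  then have "dim {x + y |x y. x \<in> W \<and> y \<in> H} = DIM('v)"
    using dim_sums_Int[OF W H] d by linarith
  then have u: "{x + y |x y. x \<in> W \<and> y \<in> H} = UNIV"
    using dim_eq_full[of "{x + y |x y. x \<in> W \<and> y \<in> H}"] subspace_sums[OF W H] by (simp add: span_eq_iff[THEN iffD2])
  have "\<exists>a. a \<in> W \<and> x - a \<in> H" for x
  proof -
    have "x \<in> {x + y |x y. x \<in> W \<and> y \<in> H}" by (simp only: u UNIV_I)
    then obtain a b where "a \<in> W" "b \<in> H" "x = a + b" by blast
    then show ?thesis by (intro exI[of _ a]) simp
  qed
  then obtain p where p: "\<And>x. p x \<in> W" "\<And>x. x - p x \<in> H" by metis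
  have uniq: "a = p x" if "a \<in> W" "x - a \<in> H" for a x
  proof -
    have "a - p x \<in> W" using that p W by (auto intro: subspace_diff)
    moreover have "a - p x \<in> H" using subspace_diff[OF H p(2)[of x] that(2)] by simp
    ultimately have "a - p x \<in> W \<inter> H" by simp
    then show ?thesis using i by auto
  qed
  have "linear p"
  proof (rule linearI)
    show "p (x + y) = p x + p y" for x y
    proof (rule uniq[symmetric])
      show "p x + p y \<in> W" using p W by (auto intro: subspace_add)
      have "(x - p x) + (y - p y) \<in> H" using p H by (intro subspace_add)
      then show "x + y - (p x + p y) \<in> H" by (simp add: algebra_simps)
    qed
    show "p (c *\<^sub>R x) = c *\<^sub>R p x" for c x
    proof (rule uniq[symmetric])
      show "c *\<^sub>R p x \<in> W" using p W by (auto intro: subspace_scale)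
      have "c *\<^sub>R (x - p x) \<in> H" using p H by (intro subspace_scale)
      then show "c *\<^sub>R x - c *\<^sub>R p x \<in> H" by (simp add: algebra_simps)
    qed
  qed
  moreover have fx: "\<forall>x\<in>W. p x = x" using uniq subspace_0[OF H] by force
  moreover have "range p = W"
  proof
    show "range p \<subseteq> W" using p by auto
    show "W \<subseteq> range p" using fx by (metis rangeI subsetI)
  qed
  moreover have "p x = 0 \<longleftrightarrow> x \<in> H" for x
    using p(2)[of x] uniq[of 0 x] subspace_0[OF W] by auto
  ultimately show ?thesis using p by blast
qed

text \<open>
  On the repelling space \<open>W'\<close> the iterates of g decay faster than the inverse of their growth on
  the plane spanned by p and q.
\<close>

definition loxodromic ::
    "'n::finite mat_nn \<Rightarrow> 'n vec_nn set \<Rightarrow> 'n vec_nn set \<Rightarrow> 'n vec_nn \<Rightarrow> 'n vec_nn \<Rightarrow> real \<Rightarrow> bool" where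
  "loxodromic g W W' p q a \<longleftrightarrow>
     (\<forall>v w. form (g *v v) (g *v w) = form v w) \<and>
     W \<in> isotropic_spaces \<and> W' \<in> isotropic_spaces \<and> W \<inter> perp W' \<subseteq> {0} \<and>
     (*v) g ` W = W \<and> (*v) g ` W' = W' \<and>
     p \<in> perp W \<inter> perp W' \<and> q \<in> perp W \<inter> perp W' \<and>
     form p p = 0 \<and> form q q = 0 \<and> form p q \<noteq> 0 \<and> a \<noteq> 0 \<and>
     g *v p = a *\<^sub>R p \<and> g *v q = (1 / a) *\<^sub>R q \<and>
     (\<forall>x\<in>W'. (\<lambda>m. a ^ m *\<^sub>R ((*v) g ^^ m) x) \<longlonglongrightarrow> 0 \<and>
             (\<lambda>m. (1 / a) ^ m *\<^sub>R ((*v) g ^^ m) x) \<longlonglongrightarrow> 0)"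

lemma form_preserving_funpow:
  fixes g :: "'n::finite mat_nn"
  assumes "\<And>v w. form (g *v v) (g *v w) = form v w"
  shows "form (((*v) g ^^ m) v) (((*v) g ^^ m) w) = form v w"
  by (induction m) (simp_all add: assms)

lemma form_preserving_inj:
  fixes g :: "'n::finite mat_nn"
  assumes "\<And>v w. form (g *v v) (g *v w) = form v w"
  shows "inj ((*v) g)"
proof (rule injI)
  fix x y assume "g *v x = g *v y"
  then have "form (g *v (x - y)) (g *v w) = 0" for w by (simp add: matrix_vector_mult_diff_distrib)
  then have "form (x - y) w = 0" for w using assms by simp
  then show "x = y" using form_nondegenerate[of "x - y"] by simp
qed

lemma perp_image:
  fixes g :: "'n::finite mat_nn"
  assumes g: "\<And>v w. form (g *v v) (g *v w) = form v w"
  shows "(*v) g ` perp W \<subseteq> perp ((*v) g ` W)"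
  using g by (auto simp: perp_def)

lemma funpow_perp:
  fixes g :: "'n::finite mat_nn"
  assumes g: "\<And>v w. form (g *v v) (g *v w) = form v w" and W: "(*v) g ` W = W"
    and x: "x \<in> perp W"
  shows "((*v) g ^^ m) x \<in> perp W"
  using x
proof (induction m)
  case (Suc m)
  then show ?case using perp_image[OF g, where W = W] W by auto
qed simp

lemma form_bounded: "\<exists>K>0. \<forall>v w. \<bar>form v w\<bar> \<le> K * norm v * norm (w :: 'n::finite vec_nn)"
proof -
  obtain K where K: "K > 0" "\<And>x::'n vec_nn. norm (I_nn *v x) \<le> K * norm x"
    using linear_bounded_pos[of "(*v) (I_nn :: 'n mat_nn)"] by auto
  have "\<bar>form v w\<bar> \<le> K * norm v * norm w" for v w :: "'n vec_nn"
  proof -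
    have "\<bar>form v w\<bar> \<le> norm v * norm (I_nn *v w)" unfolding form_def by (rule Cauchy_Schwarz_ineq2)
    also have "\<dots> \<le> norm v * (K * norm w)" by (intro mult_left_mono K) simp
    finally show ?thesis by (simp add: mult_ac)
  qed
  then show ?thesis using K(1) by blast
qed

text \<open>The whole space is the sum of \<open>W\<close> and \<open>perp W'\<close>, so a vector
  of \<open>W'\<close> orthogonal to \<open>W\<close> is orthogonal to everything.\<close>

lemma transverse_commute:
  fixes W W' :: "'n::finite vec_nn set"
  assumes W: "W \<in> isotropic_spaces" and W': "W' \<in> isotropic_spaces" and t: "W \<inter> perp W' \<subseteq> {0}"
  shows "W' \<inter> perp W \<subseteq> {0}"
proof
  fix x assume x: "x \<in> W' \<inter> perp W"
  have d: "dim W + dim (perp W') = DIM('n vec_nn)"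
    using dim_perp[OF isotropic_spacesD(1)[OF W']] isotropic_spacesD(2)[OF W] isotropic_spacesD(2)[OF W'] by simp
  obtain \<pi> where \<pi>: "range \<pi> = W" "\<And>y. y - \<pi> y \<in> perp W'"
    using projection_along[OF isotropic_spacesD(1)[OF W] subspace_perp t d] by blast
  have "form x y = 0" for y
  proof -
    have "form x (\<pi> y) = 0" using x \<pi>(1) by (intro perpD[of x W]) auto
    moreover have "form (y - \<pi> y) x = 0" using x by (intro perpD[OF \<pi>(2)]) auto
    ultimately show ?thesis using form_commute[of x "y - \<pi> y"] by (simp add: form_simps)
  qed
  then show "x \<in> {0}" using form_nondegenerate[of x] by simp
qed

locale lox =
  fixes g :: "'n::finite mat_nn" and W W' p q a
  assumes lox: "loxodromic g W W' p q a"
begin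

text \<open>Bounds both eigenvalues on the plane at once, whichever of \<open>a\<close> and
  \<open>1 / a\<close> dominates.\<close>

definition growth :: "nat \<Rightarrow> real" where
  "growth m = \<bar>a\<bar> ^ m + \<bar>1 / a\<bar> ^ m"

lemma
  shows g: "form (g *v v) (g *v w) = form v w"
    and W: "W \<in> isotropic_spaces" and W': "W' \<in> isotropic_spaces" and transverse: "W \<inter> perp W' \<subseteq> {0}"
    and gW: "(*v) g ` W = W" and gW': "(*v) g ` W' = W'"
    and p: "p \<in> perp W" "p \<in> perp W'" "form p p = 0" and q: "q \<in> perp W" "q \<in> perp W'" "form q q = 0"
    and pq: "form p q \<noteq> 0" and a: "a \<noteq> 0"
    and gp: "g *v p = a *\<^sub>R p" and gq: "g *v q = (1 / a) *\<^sub>R q"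
    and decay: "x \<in> W' \<Longrightarrow> (\<lambda>m. a ^ m *\<^sub>R ((*v) g ^^ m) x) \<longlonglongrightarrow> 0"
      "x \<in> W' \<Longrightarrow> (\<lambda>m. (1 / a) ^ m *\<^sub>R ((*v) g ^^ m) x) \<longlonglongrightarrow> 0"
  using lox unfolding loxodromic_def by auto

lemma growth_pos: "growth m > 0"
  using a by (simp add: growth_def add_pos_pos)

lemma decay_growth:
  assumes "x \<in> W'"
  shows "(\<lambda>m. growth m * norm (((*v) g ^^ m) x)) \<longlonglongrightarrow> 0"
  using tendsto_add[OF tendsto_norm_zero[OF decay(1)[OF assms]] tendsto_norm_zero[OF decay(2)[OF assms]]]
  by (simp add: growth_def power_abs distrib_right abs_divide)

text \<open>The form pairs \<open>W\<close> with \<open>W'\<close> perfectly and is preserved by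
  \<open>g\<close>: \<open>form y x\<close> equals the pairing of the \<open>m\<close>-th iterates,
  hence is at most a constant times the product of their norms. As the iterates of
  \<open>x \<in> W'\<close> decay, those of \<open>y \<in> W\<close> must grow, and faster than
  \<open>growth\<close>.\<close>

lemma expansion_bound:
  "\<exists>b. (\<forall>m. 0 \<le> b m) \<and> (\<lambda>m. growth m * b m) \<longlonglongrightarrow> 0 \<and> (\<forall>m. \<forall>y\<in>W. norm y \<le> b m * norm (((*v) g ^^ m) y))"
proof -
  obtain B where B: "finite B" "B \<subseteq> W'" "span B = W'" "independent B"
    using linear_bound_on_subspace[OF isotropic_spacesD(1)[OF W']] by blast
  \<comment> \<open>Collects the pairings with a basis of \<open>W'\<close>. It is injective on
    \<open>W\<close>, because a vector with all pairings zero lies in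
    \<open>perp W'\<close>.\<close>
  define T where "T y = (\<Sum>x\<in>B. form y x *\<^sub>R x)" for y
  have T: "linear T"
    unfolding T_def by (auto intro!: linearI simp: form_simps scaleR_add_left sum.distrib scaleR_sum_right)
  have "y = 0" if y: "y \<in> W" "T y = 0" for y
  proof -
    have "form y x = 0" if "x \<in> B" for x
      using independentD[OF B(4,1) order_refl y(2)[unfolded T_def] that] .
    then have "y \<in> perp (span B)" unfolding perp_span by (rule perpI)
    then show ?thesis using transverse y(1) B(3) by auto
  qed
  then obtain e where e: "e > 0" "\<And>y. y \<in> W \<Longrightarrow> e * norm y \<le> norm (T y)"
    using injective_imp_isometric[OF closed_subspace[OF isotropic_spacesD(1)[OF W]] isotropic_spacesD(1)[OF W], of T] T
    by (auto simp: linear_conv_bounded_linear)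
  obtain K where K: "K > 0" "\<And>v w :: 'n vec_nn. \<bar>form v w\<bar> \<le> K * norm v * norm w" using form_bounded by blast
  define b where "b m = (K / e) * (\<Sum>x\<in>B. norm x * norm (((*v) g ^^ m) x))" for m
  have "norm y \<le> b m * norm (((*v) g ^^ m) y)" if y: "y \<in> W" for y m
  proof -
    have "norm (T y) \<le> (\<Sum>x\<in>B. \<bar>form y x\<bar> * norm x)"
      unfolding T_def by (rule order_trans[OF norm_sum]) simp
    also have "\<dots> \<le> (\<Sum>x\<in>B. (K * norm (((*v) g ^^ m) y) * norm (((*v) g ^^ m) x)) * norm x)"
    proof (intro sum_mono mult_right_mono)
      fix x assume "x \<in> B"
      show "\<bar>form y x\<bar> \<le> K * norm (((*v) g ^^ m) y) * norm (((*v) g ^^ m) x)"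
        using K(2)[of "((*v) g ^^ m) y" "((*v) g ^^ m) x"] form_preserving_funpow[OF g, of m y x] by simp
    qed simp
    also have "\<dots> = e * (b m * norm (((*v) g ^^ m) y))"
      using e(1) by (simp add: b_def sum_distrib_left sum_distrib_right mult_ac)
    finally have "e * norm y \<le> e * (b m * norm (((*v) g ^^ m) y))" using e(2)[OF y] by linarith
    then show ?thesis using e(1) by simp
  qed
  moreover have "0 \<le> b m" for m using K(1) e(1) by (simp add: b_def sum_nonneg)
  moreover have "(\<lambda>m. growth m * b m) \<longlonglongrightarrow> 0"
  proof -
    have "(\<lambda>m. (K / e) * (\<Sum>x\<in>B. norm x * (growth m * norm (((*v) g ^^ m) x)))) \<longlonglongrightarrow> 0"
      using decay_growth B(2) by (intro tendsto_mult_right_zero tendsto_null_sum) auto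
    then show ?thesis by (simp add: b_def sum_distrib_left mult_ac)
  qed
  ultimately show ?thesis by blast
qed

lemma growth_bound:
  "\<exists>K>0. \<forall>m. \<forall>h\<in>perp W'. norm (((*v) g ^^ m) h) \<le> K * growth m * norm h"
proof -
  have sp: "span (insert p (insert q W')) = perp W'"
    by (rule perp_eq_span_pair[OF W' p(3) q(3) pq p(2) q(2)])
  \<comment> \<open>The vectors with orbits of order \<open>growth\<close> form a subspace, so it
    suffices to test the generators \<open>p\<close>, \<open>q\<close> and \<open>W'\<close> of
    \<open>perp W'\<close>; a basis then makes the constant uniform.\<close>
  let ?S = "{h. \<exists>K. \<forall>m. norm (((*v) g ^^ m) h) \<le> K * growth m}"
  have lf: "linear ((*v) g ^^ m)" for m by (intro linear_funpow) simp
  have S: "subspace ?S"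
  proof (unfold subspace_def, intro conjI ballI allI)
    show "0 \<in> ?S" using lf by (auto simp: linear_0 intro: exI[of _ 0])
    show "x + y \<in> ?S" if xy: "x \<in> ?S" "y \<in> ?S" for x y
    proof -
      obtain K L where "\<And>m. norm (((*v) g ^^ m) x) \<le> K * growth m" "\<And>m. norm (((*v) g ^^ m) y) \<le> L * growth m"
        using xy by auto
      then have "norm (((*v) g ^^ m) (x + y)) \<le> (K + L) * growth m" for m
        using norm_triangle_mono[of "((*v) g ^^ m) x" "K * growth m" "((*v) g ^^ m) y" "L * growth m"]
        by (simp add: linear_add[OF lf] distrib_right)
      then show ?thesis by blast
    qed
    show "c *\<^sub>R x \<in> ?S" if x: "x \<in> ?S" for c x
    proof -
      obtain K where "\<And>m. norm (((*v) g ^^ m) x) \<le> K * growth m" using x by auto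
      then have "norm (((*v) g ^^ m) (c *\<^sub>R x)) \<le> (\<bar>c\<bar> * K) * growth m" for m
        by (simp add: linear_scale[OF lf] mult.assoc mult_left_mono)
      then show ?thesis by blast
    qed
  qed
  have "insert p (insert q W') \<subseteq> ?S"
  proof -
    have "norm (((*v) g ^^ m) p) \<le> norm p * growth m" for m
      using a by (simp add: funpow_eigen[where f = "(*v) g", OF _ gp] growth_def algebra_simps power_abs)
    then have 1: "p \<in> ?S" by blast
    have "norm (((*v) g ^^ m) q) \<le> norm q * growth m" for m
      using a by (simp add: funpow_eigen[where f = "(*v) g", OF _ gq] growth_def algebra_simps power_abs abs_divide power_divide)
    then have 2: "q \<in> ?S" by blast
    have 3: "x \<in> ?S" if "x \<in> W'" for x
    proof -
      have "Bseq (\<lambda>m. a ^ m *\<^sub>R ((*v) g ^^ m) x)"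
        using decay(1)[OF that] convergent_imp_Bseq convergentI by blast
      then obtain K where K: "K > 0" "\<And>m. norm (a ^ m *\<^sub>R ((*v) g ^^ m) x) \<le> K" by (auto simp: Bseq_def)
      have "norm (((*v) g ^^ m) x) \<le> K * growth m" for m
      proof -
        have am: "\<bar>a\<bar> ^ m > 0" using a by simp
        have "\<bar>a\<bar> ^ m * norm (((*v) g ^^ m) x) \<le> K" using K(2)[of m] by (simp add: power_abs)
        then have "norm (((*v) g ^^ m) x) \<le> K / \<bar>a\<bar> ^ m" using am by (simp add: field_simps)
        also have "\<dots> = K * \<bar>1 / a\<bar> ^ m" by (simp add: abs_divide power_divide)
        also have "\<dots> \<le> K * growth m" using K(1) by (simp add: growth_def)
        finally show ?thesis .
      qed
      then show ?thesis by blast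
    qed
    show ?thesis using 1 2 3 by blast
  qed
  then have all: "perp W' \<subseteq> ?S" unfolding sp[symmetric] by (intro span_minimal S)
  obtain B where B: "finite B" "B \<subseteq> perp W'"
    "\<And>T :: 'n vec_nn \<Rightarrow> 'n vec_nn. \<And>x. linear T \<Longrightarrow> x \<in> perp W' \<Longrightarrow> norm (T x) \<le> (\<Sum>b\<in>B. norm (T b)) * norm x"
    using linear_bound_on_subspace[OF subspace_perp[of W'], where 'w = "'n vec_nn"] by blast
  have "\<forall>b\<in>B. \<exists>K. \<forall>m. norm (((*v) g ^^ m) b) \<le> K * growth m" using all B(2) by blast
  then obtain K where K: "\<And>b m. b \<in> B \<Longrightarrow> norm (((*v) g ^^ m) b) \<le> K b * growth m" by metis
  define L where "L = (\<Sum>b\<in>B. \<bar>K b\<bar>) + 1"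
  have "norm (((*v) g ^^ m) h) \<le> L * growth m * norm h" if h: "h \<in> perp W'" for m h
  proof -
    have "(\<Sum>b\<in>B. norm (((*v) g ^^ m) b)) \<le> (\<Sum>b\<in>B. \<bar>K b\<bar> * growth m)"
    proof (rule sum_mono)
      fix b assume "b \<in> B"
      have "K b * growth m \<le> \<bar>K b\<bar> * growth m"
        by (rule mult_right_mono) (use growth_pos[of m] in auto)
      with K[OF \<open>b \<in> B\<close>, of m] show "norm (((*v) g ^^ m) b) \<le> \<bar>K b\<bar> * growth m" by linarith
    qed
    also have "\<dots> \<le> L * growth m"
      using growth_pos[of m] by (simp add: L_def sum_distrib_right[symmetric])
    finally have "(\<Sum>b\<in>B. norm (((*v) g ^^ m) b)) * norm h \<le> L * growth m * norm h"
      by (rule mult_right_mono) simp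
    with B(3)[OF lf h] show ?thesis by (rule order_trans)
  qed
  moreover have "L > 0" by (simp add: L_def add_nonneg_pos sum_nonneg)
  ultimately show ?thesis by blast
qed

text \<open>The projection onto \<open>W\<close> along \<open>perp W'\<close> commutes with
  \<open>g\<close>. Slopes are multiplied by the growth on its kernel, at most
  \<open>K * growth m\<close>, times the inverse expansion \<open>b m\<close> on \<open>W\<close>,
  and this product tends to 0.\<close>

lemma dominated_projection:
  "\<exists>\<pi>. dominated ((*v) g) \<pi> \<and> range \<pi> = W \<and> (\<forall>x. \<pi> x = 0 \<longleftrightarrow> x \<in> perp W') \<and> (\<forall>x. \<pi> (\<pi> x) = \<pi> x)"
proof -
  have d: "dim W + dim (perp W') = DIM('n vec_nn)"
    using dim_perp[OF isotropic_spacesD(1)[OF W']] isotropic_spacesD(2)[OF W] isotropic_spacesD(2)[OF W'] by simp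
  obtain \<pi> where \<pi>: "linear \<pi>" "range \<pi> = W" "\<And>x. \<pi> x = 0 \<longleftrightarrow> x \<in> perp W'"
    "\<And>x. x \<in> W \<Longrightarrow> \<pi> x = x" "\<And>x. x - \<pi> x \<in> perp W'"
    using projection_along[OF isotropic_spacesD(1)[OF W] subspace_perp transverse d] by blast
  have \<pi>W: "\<pi> x \<in> W" for x using \<pi>(2) by auto
  have gm: "linear ((*v) g ^^ m)" for m by (intro linear_funpow) simp
  have com: "\<pi> (((*v) g ^^ m) x) = ((*v) g ^^ m) (\<pi> x)" for m x
  proof -
    have "((*v) g ^^ m) (x - \<pi> x) \<in> perp W'" by (rule funpow_perp[OF g gW' \<pi>(5)])
    then have "\<pi> (((*v) g ^^ m) x - ((*v) g ^^ m) (\<pi> x)) = 0" by (simp add: \<pi>(3) linear_diff[OF gm])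
    moreover have "((*v) g ^^ m) (\<pi> x) \<in> W" using funpow_image_invariant[OF gW, of m] \<pi>W by blast
    ultimately show ?thesis by (simp add: linear_diff[OF \<pi>(1)] \<pi>(4))
  qed
  obtain b where b: "\<And>m. 0 \<le> b m" "(\<lambda>m. growth m * b m) \<longlonglongrightarrow> 0"
    "\<And>m y. y \<in> W \<Longrightarrow> norm y \<le> b m * norm (((*v) g ^^ m) y)"
    using expansion_bound by blast
  obtain K where K: "K > 0" "\<And>m h. h \<in> perp W' \<Longrightarrow> norm (((*v) g ^^ m) h) \<le> K * growth m * norm h"
    using growth_bound by blast
  have "((*v) g ^^ m) x \<in> cone_set \<pi> (c * (K * (growth m * b m)))"
    if c: "0 \<le> c" "x \<in> cone_set \<pi> c" for m c x
  proof -
    have Kg: "0 \<le> K * growth m" using K(1) growth_pos[of m] by simp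
    have "norm (((*v) g ^^ m) x - \<pi> (((*v) g ^^ m) x)) = norm (((*v) g ^^ m) (x - \<pi> x))"
      by (simp add: com linear_diff[OF gm])
    also have "\<dots> \<le> K * growth m * norm (x - \<pi> x)" by (rule K(2)[OF \<pi>(5)])
    also have "\<dots> \<le> K * growth m * (c * norm (\<pi> x))"
      using c Kg by (intro mult_left_mono) (auto simp: cone_set_def)
    also have "\<dots> \<le> K * growth m * (c * (b m * norm (((*v) g ^^ m) (\<pi> x))))"
      by (intro mult_left_mono b(3)[OF \<pi>W] Kg c(1))
    finally show ?thesis by (simp add: cone_set_def com mult_ac)
  qed
  moreover have "(\<lambda>m. K * (growth m * b m)) \<longlonglongrightarrow> 0" by (intro tendsto_mult_right_zero b(2))
  moreover have "0 \<le> K * (growth m * b m)" for m using K(1) growth_pos[of m] b(1)[of m] by simp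
  ultimately have "dominated ((*v) g) \<pi>"
    unfolding dominated_def using \<pi>(1) form_preserving_inj[OF g] by (intro conjI exI[of _ "\<lambda>m. K * (growth m * b m)"]) auto
  with \<pi> \<pi>W show ?thesis by (intro exI[of _ \<pi>]) auto
qed

lemma attraction:
  assumes V: "subspace V" "dim V = CARD('n) - 1" "V \<inter> perp W' \<subseteq> {0}"
  shows "(\<lambda>m. gap (((*v) g ^^ m) ` V) W) \<longlonglongrightarrow> 0"
proof -
  obtain \<pi> where \<pi>: "dominated ((*v) g) \<pi>" "range \<pi> = W" "\<And>x. \<pi> x = 0 \<longleftrightarrow> x \<in> perp W'"
    using dominated_projection by blast
  show ?thesis
    using dominated_attraction[OF \<pi>(1) V(1)] V \<pi> isotropic_spacesD(2)[OF W] by auto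
qed

lemma attracting: "attracting_fixed_point g W"
proof -
  obtain \<pi> where \<pi>: "dominated ((*v) g) \<pi>" "range \<pi> = W" "\<And>x. \<pi> x = 0 \<longleftrightarrow> x \<in> perp W'" "\<And>x. \<pi> (\<pi> x) = \<pi> x"
    using dominated_projection by blast
  have "linear \<pi>" using \<pi>(1) by (simp add: dominated_def)
  from transverse_near_range[OF this \<pi>(4)]
  obtain e where e: "e > 0" "\<And>V x. subspace V \<Longrightarrow> gap V W < e \<Longrightarrow> x \<in> V \<Longrightarrow> \<pi> x = 0 \<Longrightarrow> x = 0"
    unfolding \<pi>(2) by blast
  show ?thesis
    unfolding attracting_fixed_point_def
  proof (intro conjI exI[of _ e] ballI impI)
    fix V assume V: "V \<in> isotropic_spaces" "gap V W < e"
    note Vd = isotropic_spacesD[OF V(1)]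
    have "V \<inter> perp W' \<subseteq> {0}" using e(2)[OF Vd(1) V(2)] \<pi>(3) by auto
    from attraction[OF Vd(1,2) this]
    show "(\<lambda>m. gap (((\<lambda>V. (*v) g ` V) ^^ m) V) W) \<longlonglongrightarrow> 0" by (simp add: funpow_image)
  qed (use W gW e in auto)
qed

text \<open>By density the basin of \<open>U\<close> contains an isotropic subspace transverse to
  \<open>W'\<close>. Its iterates converge to both \<open>U\<close> and \<open>W\<close>.\<close>

lemma attracting_unique:
  assumes U: "attracting_fixed_point g U"
  shows "U = W"
proof -
  obtain e where Ui: "U \<in> isotropic_spaces" and e: "e > 0"
    "\<And>V. V \<in> isotropic_spaces \<Longrightarrow> gap V U < e \<Longrightarrow> (\<lambda>m. gap (((\<lambda>V. (*v) g ` V) ^^ m) V) U) \<longlonglongrightarrow> 0"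
    using U unfolding attracting_fixed_point_def by blast
  obtain V where V: "V \<in> isotropic_spaces" "gap V U < e" "V \<inter> perp W' \<subseteq> {0}"
    using isotropic_transverse_dense[OF Ui W' e(1)] by blast
  note Vd = isotropic_spacesD[OF V(1)]
  have 1: "(\<lambda>m. gap (((*v) g ^^ m) ` V) U) \<longlonglongrightarrow> 0" using e(2)[OF V(1,2)] by (simp add: funpow_image)
  have 2: "(\<lambda>m. gap (((*v) g ^^ m) ` V) W) \<longlonglongrightarrow> 0" by (rule attraction[OF Vd(1,2) V(3)])
  have "gap U W \<le> 0"
  proof (rule tendsto_lowerbound)
    show "(\<lambda>m. gap (((*v) g ^^ m) ` V) U + gap (((*v) g ^^ m) ` V) W) \<longlonglongrightarrow> 0"
      using tendsto_add[OF 1 2] by simp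
    have "subspace (((*v) g ^^ m) ` V)" for m
      by (intro linear_subspace_image linear_funpow Vd(1)) simp
    then show "\<forall>\<^sub>F m in sequentially. gap U W \<le> gap (((*v) g ^^ m) ` V) U + gap (((*v) g ^^ m) ` V) W"
      using gap_triangle[OF isotropic_spacesD(1)[OF Ui] _ isotropic_spacesD(1)[OF W]]
      by (auto simp: gap_commute[of U] intro!: always_eventually)
  qed simp
  then show ?thesis by (intro gap_zero_eq isotropic_spacesD(1) Ui W)
qed

text \<open>The null vectors stay in place while the two subspaces trade roles, so the eigenvalue on
  \<open>p\<close> becomes \<open>1 / a\<close>. Decay of the inverse on \<open>W\<close> is the
  expansion bound for \<open>g\<close>, read at the preimages.\<close>

lemma inverse:
  assumes h: "h ** g = mat 1" "g ** h = mat 1"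
  shows "loxodromic h W' W p q (1 / a)"
proof -
  have hg: "h *v (g *v x) = x" "g *v (h *v x) = x" for x
    using h by (simp_all add: matrix_vector_mul_assoc)
  have fh: "form (h *v v) (h *v w) = form v w" for v w
    using g[of "h *v v" "h *v w"] by (simp add: hg)
  have im: "(*v) h ` U = U" if "(*v) g ` U = U" for U
  proof -
    have "(*v) h ` ((*v) g ` U) = U" by (simp add: image_image hg)
    then show ?thesis using that by simp
  qed
  have hm: "((*v) g ^^ m) (((*v) h ^^ m) x) = x" for m x
    by (induction m arbitrary: x) (simp_all add: funpow_swap1 hg)
  obtain b where b: "\<And>m. 0 \<le> b m" "(\<lambda>m. growth m * b m) \<longlonglongrightarrow> 0"
    "\<And>m y. y \<in> W \<Longrightarrow> norm y \<le> b m * norm (((*v) g ^^ m) y)"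
    using expansion_bound by blast
  have lim: "(\<lambda>m. c ^ m *\<^sub>R ((*v) h ^^ m) x) \<longlonglongrightarrow> 0" if x: "x \<in> W" and c: "\<And>m. \<bar>c\<bar> ^ m \<le> growth m" for c x
  proof (rule Lim_null_comparison)
    show "(\<lambda>m. (growth m * b m) * norm x) \<longlonglongrightarrow> 0" by (intro tendsto_mult_left_zero b(2))
    have "norm (c ^ m *\<^sub>R ((*v) h ^^ m) x) \<le> growth m * b m * norm x" for m
    proof -
      have "((*v) h ^^ m) x \<in> W" using funpow_image_invariant[OF im[OF gW], of m] x by blast
      from b(3)[OF this, of m] have 1: "norm (((*v) h ^^ m) x) \<le> b m * norm x" by (simp add: hm)
      have "norm (c ^ m *\<^sub>R ((*v) h ^^ m) x) = \<bar>c\<bar> ^ m * norm (((*v) h ^^ m) x)" by (simp add: power_abs)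
      also have "\<dots> \<le> growth m * (b m * norm x)"
        using c 1 growth_pos[of m] by (intro mult_mono) auto
      finally show ?thesis by (simp add: mult.assoc)
    qed
    then show "\<forall>\<^sub>F m in sequentially. norm (c ^ m *\<^sub>R ((*v) h ^^ m) x) \<le> growth m * b m * norm x" by simp
  qed
  have ca: "\<bar>1 / a\<bar> ^ m \<le> growth m" "\<bar>1 / (1 / a)\<bar> ^ m \<le> growth m" for m by (simp_all add: growth_def)
  have "h *v p = (1 / a) *\<^sub>R p"
  proof -
    have "h *v (a *\<^sub>R p) = p" using hg(1)[of p] by (simp only: gp)
    then have "a *\<^sub>R (h *v p) = p" by (simp add: linear_scale)
    then show ?thesis using a by (metis scaleR_scaleR nonzero_divide_eq_eq scaleR_one)
  qed
  moreover have "h *v q = a *\<^sub>R q"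
  proof -
    have "h *v ((1 / a) *\<^sub>R q) = q" using hg(1)[of q] by (simp only: gq)
    then have "(1 / a) *\<^sub>R (h *v q) = q" by (simp only: linear_scale[OF matrix_vector_mul_linear])
    then have "a *\<^sub>R ((1 / a) *\<^sub>R (h *v q)) = a *\<^sub>R q" by simp
    then show ?thesis using a by simp
  qed
  ultimately show ?thesis
    unfolding loxodromic_def
    using fh W W' transverse_commute[OF W W' transverse] im[OF gW] im[OF gW'] p q pq a lim[OF _ ca(1)] lim[OF _ ca(2)]
    by (simp add: abs_divide)
qed

end

section \<open>The two rulings by isotropic n-planes\<close>

lemma SO0_subset: "g \<in> SO0 \<Longrightarrow> g \<in> SO_nn"
  unfolding SO0_def using connected_component_subset by auto

lemma SO0_form: "g \<in> SO0 \<Longrightarrow> form (g *v v) (g *v w) = form v w"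
  using SO0_subset by (auto simp: SO_nn_def)

lemma SO_nn_one: "mat 1 \<in> SO_nn"
  by (simp add: SO_nn_def)

lemma SO0_one: "mat 1 \<in> SO0"
  unfolding SO0_def using SO_nn_one by simp

lemma SO_nn_mult: "g \<in> SO_nn \<Longrightarrow> h \<in> SO_nn \<Longrightarrow> g ** h \<in> SO_nn"
  by (auto simp: SO_nn_def matrix_vector_mul_assoc[symmetric] det_mul)

lemma connected_SO0: "connected SO0"
  unfolding SO0_def by simp

lemma SO0_I:
  assumes "connected T" "T \<subseteq> SO_nn" "h \<in> T" "h \<in> SO0" "x \<in> T"
  shows "x \<in> SO0"
proof -
  have "connected_component_set SO_nn h = SO0"
    using assms(4) unfolding SO0_def by (metis connected_component_eq)
  moreover have "T \<subseteq> connected_component_set SO_nn h"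
    by (rule connected_component_maximal[OF assms(3,1,2)])
  ultimately show ?thesis using assms(5) by auto
qed

lemma continuous_on_matrix_mult_right: "continuous_on S (\<lambda>x::real^'n^'m. (f :: real^'m^'k) ** x)"
  unfolding matrix_matrix_mult_def
  by (intro continuous_intros)

lemma SO0_mult:
  assumes "g \<in> SO0" "h \<in> SO0"
  shows "g ** h \<in> SO0"
proof (rule SO0_I)
  show "connected ((\<lambda>x. g ** x) ` SO0)"
    by (intro connected_continuous_image continuous_on_matrix_mult_right connected_SO0)
  show "(\<lambda>x. g ** x) ` SO0 \<subseteq> SO_nn" using assms(1) by (auto intro: SO_nn_mult dest: SO0_subset)
  show "g \<in> (\<lambda>x. g ** x) ` SO0" using SO0_one by (auto intro!: image_eqI[of _ _ "mat 1"])
qed (use assms in auto)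

lemma SO0_curve:
  fixes c :: "real \<Rightarrow> 'n::finite mat_nn"
  assumes "continuous_on UNIV c" "\<And>t. c t \<in> SO_nn" "c 0 = mat 1"
  shows "c t \<in> SO0"
proof (rule SO0_I)
  show "connected (range c)" by (rule connected_continuous_image[OF assms(1)]) simp
  show "range c \<subseteq> SO_nn" using assms(2) by auto
  show "c 0 \<in> range c" by simp
  show "c 0 \<in> SO0" using SO0_one assms(3) by simp
qed simp

section \<open>The determinant sign that separates the families of isotropic n-planes\<close>

definition top_block :: "real^'n^('n + 'n) \<Rightarrow> real^'n^'n" where
  "top_block L = (\<chi> i. L $ Inl i)"

definition bot_block :: "real^'n^('n + 'n) \<Rightarrow> real^'n^'n" where
  "bot_block L = (\<chi> i. L $ Inr i)"

text \<open>A change of basis \<open>M\<close> multiplies this by the square of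
  \<open>det M\<close>, so its sign depends only on the column space. When the upper block is
  invertible, it is the square of the upper determinant times the determinant of the map whose graph
  is the column space.\<close>

definition block_det :: "real^'n^('n + 'n) \<Rightarrow> real" where
  "block_det L = det (top_block L) * det (bot_block L)"

text \<open>
  Isotropic n-planes are the graphs of isometries between the two definite coordinate subspaces;
  the sign s of the determinant of this isometry distinguishes the two families of such planes.
\<close>

definition ruling :: "real \<Rightarrow> 'n::finite vec_nn set \<Rightarrow> bool" where
  "ruling s E \<longleftrightarrow> (\<exists>L. range ((*v) L) = E \<and> s * block_det L > 0)"

lemma top_block_nth: "(L *v x) $ Inl i = (top_block L *v x) $ i"
  and bot_block_nth: "(L *v x) $ Inr i = (bot_block L *v x) $ i"
  by (simp_all add: top_block_def bot_block_def matrix_vector_mult_def)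

lemma top_block_mult: "top_block (L ** M) = top_block L ** M"
  and bot_block_mult: "bot_block (L ** M) = bot_block L ** M"
  by (simp_all add: top_block_def bot_block_def matrix_matrix_mult_def vec_eq_iff)

lemma block_det_mult: "block_det (L ** M) = (det M)\<^sup>2 * block_det L"
  by (simp add: block_det_def top_block_mult bot_block_mult det_mul power2_eq_square)

lemma det_nonzero_inverse:
  fixes A :: "real^'n^'n"
  assumes "det A \<noteq> 0"
  obtains B where "B ** A = mat 1" "A ** B = mat 1"
  using assms invertible_det_nz[of A] unfolding invertible_def by auto

lemma range_subset_factor:
  fixes L L' :: "real^'n^('n + 'n)"
  assumes d: "det (top_block L) \<noteq> 0" and sub: "range ((*v) L') \<subseteq> range ((*v) L)"
  obtains M where "L' = L ** M"
proof -
  obtain B where B: "B ** top_block L = mat 1" using det_nonzero_inverse[OF d] by blast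
  have "L' *v x = (L ** (B ** top_block L')) *v x" for x
  proof -
    obtain y where y: "L' *v x = L *v y" using sub by blast
    have "top_block L' *v x = top_block L *v y"
      by (simp add: vec_eq_iff top_block_nth[symmetric] y)
    then have "(B ** top_block L') *v x = (B ** top_block L) *v y"
      by (simp add: matrix_vector_mul_assoc[symmetric])
    then show ?thesis by (simp add: y B matrix_vector_mul_assoc[symmetric])
  qed
  then have "L' = L ** (B ** top_block L')" by (simp add: matrix_eq)
  then show ?thesis by (rule that)
qed

text \<open>The columns of \<open>L'\<close> may be dependent, whence the weak sign. This form suits
  approximating matrices whose columns are only known to lie in the plane.\<close>

lemma ruling_range_subset:
  assumes "ruling s E" "range ((*v) L') \<subseteq> E"
  shows "s * block_det L' \<ge> 0"
proof -
  obtain L where L: "range ((*v) L) = E" "s * block_det L > 0" using assms(1) by (auto simp: ruling_def)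
  then have "det (top_block L) \<noteq> 0" by (auto simp: block_det_def)
  then obtain M where "L' = L ** M" using range_subset_factor assms(2) L(1) by metis
  then have eq: "s * block_det L' = (det M)\<^sup>2 * (s * block_det L)" by (simp add: block_det_mult)
  show ?thesis unfolding eq using mult_nonneg_nonneg[OF zero_le_power2 less_imp_le[OF L(2)]] .
qed

lemma ruling_range_eq:
  assumes "ruling s E" "range ((*v) L') = E"
  shows "s * block_det L' > 0"
proof -
  obtain L where L: "range ((*v) L) = E" "s * block_det L > 0" using assms(1) by (auto simp: ruling_def)
  then have d: "det (top_block L) \<noteq> 0" by (auto simp: block_det_def)
  then obtain M where M: "L' = L ** M" using range_subset_factor assms(2) L(1) by (metis order_refl)
  obtain B where B: "B ** top_block L = mat 1" using det_nonzero_inverse[OF d] by blast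
  have "surj ((*v) M)"
    unfolding surj_def
  proof
    fix x
    obtain z where "L *v x = L' *v z" using L(1) assms(2) by blast
    then have "top_block L *v x = top_block (L ** M) *v z"
      unfolding M[symmetric] by (simp add: vec_eq_iff top_block_nth[symmetric])
    then have "(B ** top_block L) *v x = (B ** top_block L) *v (M *v z)"
      by (simp add: matrix_vector_mul_assoc[symmetric] top_block_mult)
    then show "\<exists>y. x = M *v y" unfolding B by auto
  qed
  then obtain N where "M ** N = mat 1" using matrix_right_invertible_surjective[of M] by auto
  then have "det M * det N = 1" by (metis det_I det_mul)
  then have "det M \<noteq> 0" by auto
  moreover have eq: "s * block_det L' = (det M)\<^sup>2 * (s * block_det L)" by (simp add: block_det_mult M)
  ultimately show ?thesis unfolding eq using mult_pos_pos[OF _ L(2), of "(det M)\<^sup>2"] by simp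
qed

lemma ruling_exclusive: "ruling 1 E \<Longrightarrow> ruling (- 1) E \<Longrightarrow> False"
  using ruling_range_eq[of "-1" E] by (fastforce simp: ruling_def)

lemma continuous_on_block_det [continuous_intros]:
  assumes "continuous_on S f"
  shows "continuous_on S (\<lambda>x. block_det (f x))"
  unfolding block_det_def det_def top_block_def bot_block_def
  by (simp, intro continuous_intros assms)

lemma form_blocks: "form x x = (\<Sum>i\<in>UNIV. (x $ Inl i)\<^sup>2) - (\<Sum>i\<in>UNIV. (x $ Inr i)\<^sup>2)"
  by (simp add: form_eq power2_eq_square)

lemma null_half_zero:
  fixes x :: "'n::finite vec_nn"
  assumes "form x x = 0" and "(\<forall>i. x $ Inl i = 0) \<or> (\<forall>i. x $ Inr i = 0)"
  shows "x = 0"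
proof -
  have "(\<Sum>i\<in>UNIV. (x $ Inl i)\<^sup>2) = 0 \<and> (\<Sum>i\<in>UNIV. (x $ Inr i)\<^sup>2) = 0"
    using assms by (auto simp: form_blocks)
  then have "x $ Inl i = 0 \<and> x $ Inr i = 0" for i
    by (simp add: sum_nonneg_eq_0_iff)
  then have "x $ k = 0" for k by (cases k) auto
  then show ?thesis by (simp add: vec_eq_iff)
qed

lemma inj_det_nonzero:
  fixes A :: "real^'n^'n"
  assumes "\<And>x. A *v x = 0 \<Longrightarrow> x = 0"
  shows "det A \<noteq> 0"
proof -
  obtain B where "B ** A = mat 1" using matrix_left_invertible_ker[of A] assms by blast
  then have "det B * det A = 1" by (metis det_I det_mul)
  then show ?thesis by auto
qed

text \<open>A null vector whose upper or lower half vanishes is zero, so both coordinate projections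
  are injective on an isotropic plane.\<close>

lemma block_det_isotropic_nonzero:
  fixes L :: "real^'n^('n + 'n)"
  assumes i: "\<And>x. form (L *v x) (L *v x) = 0" and inj: "\<And>x. L *v x = 0 \<Longrightarrow> x = 0"
  shows "block_det L \<noteq> 0"
proof -
  have "det (top_block L) \<noteq> 0"
  proof (rule inj_det_nonzero)
    fix x assume "top_block L *v x = 0"
    then have "\<forall>j. (L *v x) $ Inl j = 0" by (simp add: top_block_nth)
    then show "x = 0" using null_half_zero[OF i] inj by blast
  qed
  moreover have "det (bot_block L) \<noteq> 0"
  proof (rule inj_det_nonzero)
    fix x assume "bot_block L *v x = 0"
    then have "\<forall>j. (L *v x) $ Inr j = 0" by (simp add: bot_block_nth)
    then show "x = 0" using null_half_zero[OF i] inj by blast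
  qed
  ultimately show ?thesis by (simp add: block_det_def)
qed

text \<open>Along the connected group the block determinant of the moved plane is continuous and
  never zero, so it keeps the sign it has at the identity.\<close>

lemma SO0_ruling:
  fixes g :: "'n::finite mat_nn"
  assumes E: "ruling s E" "\<And>x. x \<in> E \<Longrightarrow> form x x = 0" and g: "g \<in> SO0"
  shows "ruling s ((*v) g ` E)"
proof -
  obtain L where L: "range ((*v) L) = E" "s * block_det L > 0" using E(1) by (auto simp: ruling_def)
  have "det (top_block L) \<noteq> 0" using L(2) by (auto simp: block_det_def)
  then obtain B where B: "B ** top_block L = mat 1" using det_nonzero_inverse by blast
  have injL: "x = 0" if "L *v x = 0" for x
  proof -
    have "top_block L *v x = 0" by (simp add: vec_eq_iff top_block_nth[symmetric] that)
    then have "(B ** top_block L) *v x = 0" by (simp add: matrix_vector_mul_assoc[symmetric])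
    then show ?thesis by (simp add: B)
  qed
  let ?F = "\<lambda>h::'n mat_nn. s * block_det (h ** L)"
  have nz: "?F h \<noteq> 0" if h: "h \<in> SO0" for h
  proof -
    have "block_det (h ** L) \<noteq> 0"
    proof (rule block_det_isotropic_nonzero)
      show "form ((h ** L) *v x) ((h ** L) *v x) = 0" for x
        using E(2) L(1) by (auto simp: matrix_vector_mul_assoc[symmetric] SO0_form[OF h])
      show "x = 0" if "(h ** L) *v x = 0" for x
      proof (rule injL)
        have "h *v (L *v x) = h *v 0" using that by (simp add: matrix_vector_mul_assoc)
        then show "L *v x = 0" using form_preserving_inj[OF SO0_form[OF h]] by (metis injD)
      qed
    qed
    then show ?thesis using L(2) by auto
  qed
  have "continuous_on SO0 (\<lambda>h::'n mat_nn. h ** L)"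
    unfolding matrix_matrix_mult_def by (intro continuous_intros)
  then have "continuous_on SO0 ?F" by (intro continuous_intros)
  then have conn: "connected (?F ` SO0)" by (rule connected_continuous_image[OF _ connected_SO0])
  have "?F g > 0"
  proof (rule ccontr)
    assume "\<not> ?F g > 0"
    moreover have "?F (mat 1) > 0" using L(2) by simp
    ultimately have "0 \<in> ?F ` SO0"
      using connectedD_interval[OF conn imageI[OF g] imageI[OF SO0_one], of 0] by simp
    then show False using nz by auto
  qed
  moreover have "range ((*v) (g ** L)) = (*v) g ` E"
    by (simp add: L(1)[symmetric] image_image matrix_vector_mul_assoc)
  ultimately show ?thesis by (auto simp: ruling_def)
qed

section \<open>The model spaces W_+ and W_- as graphs\<close>

definition emb :: "real \<Rightarrow> real^'n \<Rightarrow> 'n::finite vec_nn" where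
  "emb s y = (\<chi> k. case k of Inl i \<Rightarrow> y $ i | Inr i \<Rightarrow> s * y $ i)"

lemma emb_nth [simp]: "emb s y $ Inl i = y $ i" "emb s y $ Inr i = s * y $ i"
  by (simp_all add: emb_def)

lemma vec_nn_eq_iff: "x = y \<longleftrightarrow> (\<forall>i. x $ Inl i = y $ Inl i) \<and> (\<forall>i. x $ Inr i = y $ Inr i)"
  unfolding vec_eq_iff by (metis sum.exhaust)

lemma linear_emb: "linear (emb s)"
  by (auto intro!: linearI simp: vec_nn_eq_iff algebra_simps)

lemma inj_emb: "inj (emb s)"
  by (rule injI) (auto simp: vec_nn_eq_iff vec_eq_iff)

lemma form_emb: "form (emb s x) (emb t y) = (1 - s * t) * (x \<bullet> y)"
  by (simp add: form_eq inner_vec_def sum_subtractf sum_distrib_left algebra_simps)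

lemma frame_emb: "frame s j = emb s (axis j 1)"
  by (auto simp: frame_def vec_nn_eq_iff axis_def)

lemma emb_expansion: "emb s y = (\<Sum>i\<in>UNIV. (y $ i) *\<^sub>R frame s i)"
  using basis_expansion[of y] linear_sum[OF linear_emb[of s], of "\<lambda>i. y $ i *s axis i 1" UNIV]
  by (simp add: frame_emb scalar_mult_eq_scaleR linear_scale[OF linear_emb])

text \<open>For \<open>s = 1\<close> and \<open>s = -1\<close> these are the model spaces W_+ and
  W_-.\<close>

definition base :: "real \<Rightarrow> 'n::{finite,linorder} vec_nn set" where
  "base s = emb s ` {y. y $ last_index = 0}"

lemma subspace_base: "subspace (base s)"
  unfolding base_def by (intro linear_subspace_image[OF linear_emb]) (simp add: subspace_def)

lemma base_isotropic:
  assumes "s * s = 1"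
  shows "base s \<in> (isotropic_spaces :: 'n::{finite,linorder} vec_nn set set)"
proof -
  let ?H = "{y::(real, 'n) vec. y $ last_index = 0}"
  have "?H = {y. axis last_index 1 \<bullet> y = 0}" by (simp add: inner_axis')
  then have "dim ?H = CARD('n) - 1"
    using dim_special_hyperplane[of "axis last_index 1 :: (real, 'n) vec"] by (simp add: axis_in_Basis_iff)
  moreover have "dim (base s :: 'n vec_nn set) = dim ?H"
    using dim_image_eq[OF linear_emb[of s] inj_on_subset[OF inj_emb[of s] subset_UNIV], of ?H] by (simp add: base_def)
  moreover have "\<forall>v\<in>base s. \<forall>w\<in>base s :: 'n vec_nn set. form v w = 0"
    using assms by (auto simp: base_def form_emb)
  ultimately show ?thesis using subspace_base by (auto simp: isotropic_spaces_def)
qed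

lemma base_frame_span: "span (insert (frame t last_index) (base s)) =
    {emb s y + c *\<^sub>R frame t last_index |y c. y $ last_index = 0}"
proof -
  have sp: "span (base s) = base s" using subspace_base by (simp add: span_eq_iff)
  have "x \<in> span (insert (frame t last_index) (base s)) \<longleftrightarrow>
    (\<exists>y c. x = emb s y + c *\<^sub>R frame t last_index \<and> y $ last_index = 0)" for x
    unfolding span_breakdown_eq sp by (auto simp: base_def algebra_simps image_iff; metis add_diff_cancel_right')
  then show ?thesis by blast
qed

lemma base_transverse: "base 1 \<inter> perp (base (-1)) \<subseteq> {0}"
proof
  fix x :: "'n::{finite,linorder} vec_nn" assume x: "x \<in> base 1 \<inter> perp (base (-1))"
  then obtain y where y: "x = emb 1 y" "y $ last_index = 0" by (auto simp: base_def)
  have "form x (emb (-1) y) = 0" using x y(2) by (intro perpD[of x "base (-1)"]) (auto simp: base_def)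
  then have "y = 0" by (simp add: y(1) form_emb)
  then show "x \<in> {0}" using linear_0[OF linear_emb] by (simp add: y(1))
qed

lemma frame_perp_base:
  assumes "t * t = 1" "s * s = 1"
  shows "frame t last_index \<in> perp (base s)"
  by (rule perpI) (auto simp: base_def frame_emb form_emb inner_axis')

lemma form_frame: "form (frame s i) (frame t i) = 1 - s * t"
  by (simp add: frame_emb form_emb inner_axis_axis)

text \<open>The plane is the graph of the diagonal isometry with last entry \<open>t\<close> and all
  other entries \<open>s\<close>; the sign in the statement is its determinant.\<close>

lemma ruling_base:
  assumes st: "s * s = 1" "t * t = 1"
  shows "ruling (t * s ^ (CARD('n) - 1)) (span (insert (frame t last_index) (base s)) :: 'n::{finite,linorder} vec_nn set)"
proof -
  define d where "d i = (if i = last_index then t else s)" for i :: 'n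
  define L :: "((real, 'n) vec, 'n + 'n) vec" where "L = (\<chi> k j. case k of Inl i \<Rightarrow> if i = j then 1 else 0 | Inr i \<Rightarrow> if i = j then d i else 0)"
  have top: "top_block L = mat 1" by (simp add: top_block_def L_def mat_def vec_eq_iff)
  have bot: "bot_block L $ i $ j = (if i = j then d i else 0)" for i j
    by (simp add: bot_block_def L_def)
  have "det (bot_block L) = (\<Prod>i\<in>UNIV. bot_block L $ i $ i)"
    by (rule det_diagonal) (simp add: bot)
  also have "\<dots> = (\<Prod>i\<in>UNIV. d i)" by (simp add: bot)
  also have "\<dots> = d last_index * (\<Prod>i\<in>UNIV - {last_index}. d i)" by (rule prod.remove) auto
  also have "(\<Prod>i\<in>UNIV - {last_index}. d i) = (\<Prod>i\<in>UNIV - {last_index::'n}. s)"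
    by (rule prod.cong) (auto simp: d_def)
  also have "\<dots> = s ^ (CARD('n) - 1)" by simp
  finally have det: "block_det L = t * s ^ (CARD('n) - 1)" by (simp add: block_det_def top d_def)
  have Lx: "(L *v x) $ Inl i = x $ i" "(L *v x) $ Inr i = d i * x $ i" for x i
  proof -
    show "(L *v x) $ Inl i = x $ i" by (simp add: top_block_nth top)
    have "(bot_block L *v x) $ i = (\<Sum>j\<in>UNIV. if i = j then d i * x $ j else 0)"
      unfolding matrix_vector_mult_def by (auto simp: bot intro!: sum.cong simp del: sum.delta sum.delta')
    then have "(L *v x) $ Inr i = (\<Sum>j\<in>UNIV. if i = j then d i * x $ j else 0)"
      unfolding bot_block_nth .
    then show "(L *v x) $ Inr i = d i * x $ i" by simp
  qed
  have "range ((*v) L) = span (insert (frame t last_index) (base s))"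
  proof
    show "range ((*v) L) \<subseteq> span (insert (frame t last_index) (base s))"
    proof
      fix z assume "z \<in> range ((*v) L)"
      then obtain x where z: "z = L *v x" by blast
      let ?y = "x - (x $ last_index) *\<^sub>R axis last_index 1"
      have "L *v x = emb s ?y + (x $ last_index) *\<^sub>R frame t last_index"
        by (auto simp: vec_nn_eq_iff Lx frame_emb axis_def d_def)
      moreover have "?y $ last_index = 0" by simp
      ultimately show "z \<in> span (insert (frame t last_index) (base s))"
        unfolding base_frame_span z by blast
    qed
    show "span (insert (frame t last_index) (base s)) \<subseteq> range ((*v) L)"
    proof
      fix z :: "'n vec_nn" assume "z \<in> span (insert (frame t last_index) (base s))"
      then obtain y c where z: "z = emb s y + c *\<^sub>R frame t last_index" and "y $ last_index = 0"
        unfolding base_frame_span by blast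
      then have "emb s y + c *\<^sub>R frame t last_index = L *v (y + c *\<^sub>R axis last_index 1)"
        by (auto simp: vec_nn_eq_iff Lx frame_emb axis_def d_def algebra_simps)
      then show "z \<in> range ((*v) L)" unfolding z by simp
    qed
  qed
  moreover have "(t * s ^ (CARD('n) - 1)) * block_det L > 0"
  proof -
    have "t \<noteq> 0" "s \<noteq> 0" using st by auto
    then have "t * s ^ (CARD('n) - 1) \<noteq> 0" by simp
    then show ?thesis unfolding det using not_real_square_gt_zero by blast
  qed
  ultimately show ?thesis unfolding ruling_def by blast
qed

lemma V_plus_eq: "V_plus = (span (insert (frame 1 last_index) (base 1)) :: 'n::{finite,linorder} vec_nn set)"
    (is "_ = ?R")
proof
  show "V_plus \<subseteq> ?R"
    unfolding V_plus_def
  proof (intro span_minimal subspace_span subsetI)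
    fix x :: "'n vec_nn" assume "x \<in> range (frame 1)"
    then obtain j where j: "x = frame 1 j" by blast
    show "x \<in> ?R"
    proof (cases "j = last_index")
      case False
      then have "x \<in> base 1" by (auto simp: j frame_emb base_def axis_def)
      then show ?thesis by (simp add: span_base)
    qed (simp add: j span_base)
  qed
  have "base 1 \<subseteq> (V_plus :: 'n vec_nn set)"
  proof
    fix v :: "'n vec_nn" assume "v \<in> base 1"
    then obtain y where v: "v = emb 1 y" by (auto simp: base_def)
    show "v \<in> V_plus" unfolding V_plus_def v emb_expansion
      by (intro span_sum span_scale span_base rangeI)
  qed
  then show "?R \<subseteq> V_plus"
    unfolding V_plus_def by (intro span_minimal subspace_span) (auto intro: span_base)
qed

lemma J_mat_mult: "(J_mat *v x) $ k = (if k = Inr last_index then - x $ k else x $ k)"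
proof -
  have "(J_mat *v x) $ k = (\<Sum>j\<in>UNIV. if j = k then (if k = Inr last_index then - x $ k else x $ k) else 0)"
    unfolding matrix_vector_mult_def J_mat_def by (auto intro!: sum.cong simp del: sum.delta sum.delta')
  then show ?thesis by simp
qed

lemma V_prime_eq: "V_prime = (span (insert (frame (-1) last_index) (base 1)) :: 'n::{finite,linorder} vec_nn set)"
proof -
  have 1: "J_mat *v frame 1 last_index = (frame (-1) last_index :: 'n vec_nn)"
    by (auto simp: vec_nn_eq_iff J_mat_mult frame_emb axis_def)
  have "J_mat *v emb 1 y = emb 1 y" if "y $ last_index = 0" for y :: "(real, 'n) vec"
    using that by (auto simp: vec_nn_eq_iff J_mat_mult)
  then have 2: "(*v) J_mat ` base 1 = (base 1 :: 'n vec_nn set)" by (force simp: base_def image_iff)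
  show ?thesis
    unfolding V_prime_def V_plus_eq
    by (simp add: linear_span_image[symmetric] 1 2)
qed

section \<open>Null directions\<close>

lemma orbit_SO0: "G_orbit V = {(*v) g ` V |g. g \<in> SO0}"
  by (simp add: G_orbit_def orbit_def SO0_group_def)

lemma SO0_isotropic:
  fixes W :: "'n::finite vec_nn set"
  assumes f: "f \<in> SO0" and W: "W \<in> isotropic_spaces"
  shows "(*v) f ` W \<in> isotropic_spaces"
proof -
  note Wd = isotropic_spacesD[OF W]
  have "dim ((*v) f ` W) = dim W"
    by (rule dim_image_eq) (use inj_on_subset[OF form_preserving_inj[OF SO0_form[OF f]]] in auto)
  then show ?thesis
    using Wd by (auto simp: isotropic_spaces_def SO0_form[OF f] linear_subspace_image)
qed

text \<open>Orbits of \<open>V_plus\<close> and \<open>V_prime\<close> are replaced by rulings,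
  which a sign detects. The family of each line changes with the subspace, so exchanging the
  subspaces together with the vectors gives a null pair again; this encodes that v^+_{i,j} and
  v^-_{j,i} are proportional.\<close>

definition null_pair :: "'n::finite vec_nn set \<Rightarrow> 'n vec_nn set \<Rightarrow> 'n vec_nn \<Rightarrow> 'n vec_nn \<Rightarrow> bool" where
  "null_pair W W' p q \<longleftrightarrow> W \<in> isotropic_spaces \<and> W' \<in> isotropic_spaces \<and> W \<inter> perp W' \<subseteq> {0} \<and>
     p \<in> perp W \<inter> perp W' \<and> q \<in> perp W \<inter> perp W' \<and> form p p = 0 \<and> form q q = 0 \<and> form p q \<noteq> 0 \<and>
     ruling 1 (span (insert p W)) \<and> ruling (-1) (span (insert q W)) \<and>
     ruling (-1) (span (insert p W')) \<and> ruling 1 (span (insert q W'))"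

lemma null_pairD:
  assumes "null_pair W W' p q"
  shows "W \<in> isotropic_spaces" "W' \<in> isotropic_spaces" "W \<inter> perp W' \<subseteq> {0}"
    "p \<in> perp W" "p \<in> perp W'" "q \<in> perp W" "q \<in> perp W'"
    "form p p = 0" "form q q = 0" "form p q \<noteq> 0" "p \<noteq> 0" "q \<noteq> 0"
    "ruling 1 (span (insert p W))" "ruling (-1) (span (insert q W))"
    "ruling (-1) (span (insert p W'))" "ruling 1 (span (insert q W'))"
  using assms by (auto simp: null_pair_def)

lemma null_pair_commute:
  assumes "null_pair W W' p q" shows "null_pair W' W q p"
  using null_pairD[OF assms] transverse_commute[OF null_pairD(1-3)[OF assms]] form_commute[of q p]
  unfolding null_pair_def by auto

lemma span_insert_scaleR:
  assumes "c \<noteq> (0::real)"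
  shows "span (insert (c *\<^sub>R x) W) = span (insert x W)"
proof (rule span_eq[THEN iffD2], intro conjI subsetI)
  show "y \<in> span (insert x W)" if "y \<in> insert (c *\<^sub>R x) W" for y
    using that by (auto intro: span_base span_scale)
  have "(1 / c) *\<^sub>R (c *\<^sub>R x) \<in> span (insert (c *\<^sub>R x) W)" by (intro span_scale span_base) simp
  then have "x \<in> span (insert (c *\<^sub>R x) W)" using assms by simp
  then show "y \<in> span (insert (c *\<^sub>R x) W)" if "y \<in> insert x W" for y
    using that by (auto intro: span_base)
qed

lemma null_pair_scaleR:
  assumes n: "null_pair W W' p q" and c: "c \<noteq> 0" "d \<noteq> 0"
  shows "null_pair W W' (c *\<^sub>R p) (d *\<^sub>R q)"
  using n c by (auto simp: null_pair_def span_insert_scaleR form_simps intro: subspace_scale[OF subspace_perp])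

text \<open>Since \<open>W\<close> meets \<open>perp W'\<close> trivially, \<open>x\<close> is a
  combination of \<open>p\<close> and \<open>q\<close>. Its square
  \<open>2 * \<alpha> * \<beta> * form p q\<close> vanishes only if one coefficient does.\<close>

lemma null_pair_unique:
  assumes n: "null_pair W W' p q"
    and x: "x \<in> perp W" "x \<in> perp W'" "form x x = 0" "x \<noteq> 0"
  shows "\<exists>c. c \<noteq> 0 \<and> (x = c *\<^sub>R p \<or> x = c *\<^sub>R q)"
proof -
  note d = null_pairD[OF n]
  have sW: "span W = W" using isotropic_spacesD(1)[OF d(1)] by (simp add: span_eq_iff)
  have "x \<in> span (insert p (insert q W))"
    using x(1) perp_eq_span_pair[OF d(1,8,9,10,4,6)] by simp
  then obtain \<alpha> \<beta> where w: "x - \<alpha> *\<^sub>R p - \<beta> *\<^sub>R q \<in> W"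
    unfolding span_breakdown_eq sW by blast
  moreover have "x - \<alpha> *\<^sub>R p - \<beta> *\<^sub>R q \<in> perp W'"
    using x(2) d(5,7) by (intro subspace_diff subspace_scale subspace_perp)
  ultimately have "x - \<alpha> *\<^sub>R p - \<beta> *\<^sub>R q = 0" using d(3) by auto
  then have eq: "x = \<alpha> *\<^sub>R p + \<beta> *\<^sub>R q" by (simp add: algebra_simps)
  have "form x x = 2 * \<alpha> * \<beta> * form p q"
    using d(8,9) form_commute[of q p] by (simp add: eq form_simps)
  then have "\<alpha> = 0 \<or> \<beta> = 0" using x(3) d(10) by simp
  then show ?thesis using eq x(4) by auto
qed

lemma null_pair_ruling:
  assumes n: "null_pair W W' p q"
    and x: "x \<in> perp W" "x \<in> perp W'" "form x x = 0" "x \<noteq> 0"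
  shows "ruling 1 (span (insert x W)) \<Longrightarrow> \<exists>c. c \<noteq> 0 \<and> x = c *\<^sub>R p"
    and "ruling (-1) (span (insert x W)) \<Longrightarrow> \<exists>c. c \<noteq> 0 \<and> x = c *\<^sub>R q"
  using null_pair_unique[OF assms] null_pairD(13,14)[OF n] ruling_exclusive
  by (metis span_insert_scaleR)+

text \<open>Everything is checked for the model pair and carried over by \<open>f\<close>, which
  preserves form and ruling. For even n the exponent \<open>CARD('n) - 1\<close> is odd, so the
  rulings over \<open>base (-1)\<close> are opposite to those over \<open>base 1\<close>.\<close>

lemma frame_null_pair:
  fixes f :: "'n::{finite,linorder} mat_nn"
  assumes f: "f \<in> SO0" and ev: "even CARD('n)"
  shows "null_pair ((*v) f ` base 1) ((*v) f ` base (-1)) (f *v frame 1 last_index) (f *v frame (-1) last_index)"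
    and "span (insert (f *v frame 1 last_index) ((*v) f ` base 1)) \<in> G_orbit V_plus"
    and "span (insert (f *v frame (-1) last_index) ((*v) f ` base 1)) \<in> G_orbit V_prime"
proof -
  have sp: "span (insert (f *v x) ((*v) f ` W)) = (*v) f ` span (insert x W)" for x W
    by (simp add: linear_span_image[symmetric])
  show "span (insert (f *v frame 1 last_index) ((*v) f ` base 1)) \<in> G_orbit V_plus"
    and "span (insert (f *v frame (-1) last_index) ((*v) f ` base 1)) \<in> G_orbit V_prime"
    unfolding sp orbit_SO0 V_plus_eq V_prime_eq using f by blast+
  have iso: "form x x = 0" if "x \<in> span (insert (frame t last_index) (base s))" "s * s = 1" "t * t = 1"
    for x :: "'n vec_nn" and s t
  proof -
    let ?T = "insert (frame t last_index) (base s) :: 'n vec_nn set"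
    have "frame t last_index \<in> perp ?T"
      using frame_perp_base[OF that(3,2)] that(3) by (auto simp: perp_def form_frame)
    moreover have "base s \<subseteq> perp ?T"
    proof
      fix w :: "'n vec_nn" assume w: "w \<in> base s"
      have "form (frame t last_index) w = 0" by (rule perpD[OF frame_perp_base[OF that(3,2)] w])
      then show "w \<in> perp ?T"
        using isotropic_spacesD(4)[OF base_isotropic[OF that(2)] w] form_commute[of w "frame t last_index"]
        by (auto simp: perp_def)
    qed
    ultimately have "span ?T \<subseteq> perp ?T" by (intro span_minimal subspace_perp) auto
    then have "x \<in> perp (span ?T)" using that(1) by (auto simp: perp_span)
    then show ?thesis by (rule perpD) (rule that(1))
  qed
  have rul: "ruling (t * s ^ (CARD('n) - 1)) (span (insert (f *v frame t last_index) ((*v) f ` base s)))"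
    if "s * s = 1" "t * t = 1" for s t
    unfolding sp by (rule SO0_ruling[OF ruling_base[OF that] iso[OF _ that] f])
  have odd: "(-1::real) ^ (CARD('n) - 1) = -1" using ev by simp
  have pf: "f *v frame t last_index \<in> perp ((*v) f ` base s)" if "t * t = 1" "s * s = 1" for s t
    using perp_image[OF SO0_form[OF f], where W = "base s"] frame_perp_base[OF that] by blast
  have "(*v) f ` base 1 \<inter> perp ((*v) f ` base (-1)) \<subseteq> {0}"
  proof
    fix x assume x: "x \<in> (*v) f ` base 1 \<inter> perp ((*v) f ` base (-1))"
    then obtain y where y: "x = f *v y" "y \<in> base 1" by auto
    have "y \<in> perp (base (-1))"
    proof (rule perpI)
      fix w :: "'n vec_nn" assume "w \<in> base (-1)"
      then have "form x (f *v w) = 0" using x by (intro perpD[of x "(*v) f ` base (-1)"]) auto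
      then show "form y w = 0" by (simp add: y(1) SO0_form[OF f])
    qed
    then have "y = 0" using base_transverse y(2) by auto
    then show "x \<in> {0}" by (simp add: y(1))
  qed
  then show "null_pair ((*v) f ` base 1) ((*v) f ` base (-1)) (f *v frame 1 last_index) (f *v frame (-1) last_index)"
    unfolding null_pair_def
    using rul[of 1 1] rul[of 1 "-1"] rul[of "-1" 1] rul[of "-1" "-1"] odd
      SO0_isotropic[OF f base_isotropic, of 1] SO0_isotropic[OF f base_isotropic, of "-1"]
      pf[of 1 1] pf[of 1 "-1"] pf[of "-1" 1] pf[of "-1" "-1"]
    by (simp add: SO0_form[OF f] form_frame)
qed

text \<open>These are the pairs of subspaces underlying the points of
  \<open>X_space\<close>.\<close>

definition opposite :: "'n::{finite,linorder} vec_nn set \<Rightarrow> 'n vec_nn set \<Rightarrow> bool" where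
  "opposite W W' \<longleftrightarrow> (\<exists>f\<in>SO0. W = (*v) f ` base 1 \<and> W' = (*v) f ` base (-1))"

lemma V_plus_ruling:
  fixes E :: "'n::{finite,linorder} vec_nn set"
  assumes "E \<in> G_orbit V_plus" "even CARD('n)"
  shows "ruling 1 E"
proof -
  obtain f where f: "f \<in> SO0" "E = (*v) f ` V_plus" using assms by (auto simp: orbit_SO0)
  have "E = span (insert (f *v frame 1 last_index) ((*v) f ` base 1))"
    unfolding f(2) V_plus_eq by (simp add: linear_span_image[symmetric])
  then show ?thesis using frame_null_pair(1)[OF f(1) assms(2)] by (simp add: null_pair_def)
qed

lemma V_prime_ruling:
  fixes E :: "'n::{finite,linorder} vec_nn set"
  assumes "E \<in> G_orbit V_prime" "even CARD('n)"
  shows "ruling (-1) E"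
proof -
  obtain f where f: "f \<in> SO0" "E = (*v) f ` V_prime" using assms by (auto simp: orbit_SO0)
  have "E = span (insert (f *v frame (-1) last_index) ((*v) f ` base 1))"
    unfolding f(2) V_prime_eq by (simp add: linear_span_image[symmetric])
  then show ?thesis using frame_null_pair(1)[OF f(1) assms(2)] by (simp add: null_pair_def)
qed

text \<open>The moved frame vectors are candidates for the choices in \<open>v_plus\<close> and
  \<open>v_minus\<close>, and the ruling leaves only their multiples.\<close>

lemma v_plus_minus_null_pair:
  fixes W W' :: "'n::{finite,linorder} vec_nn set"
  assumes "opposite W W'" and ev: "even CARD('n)"
  shows "null_pair W W' (v_plus W W') (v_minus W W')"
proof -
  obtain f where f: "f \<in> SO0" and W: "W = (*v) f ` base 1" "W' = (*v) f ` base (-1)"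
    using assms(1) by (auto simp: opposite_def)
  let ?p = "f *v frame 1 last_index" and ?q = "f *v frame (-1) last_index"
  have n: "null_pair W W' ?p ?q" unfolding W by (rule frame_null_pair(1)[OF f ev])
  note d = null_pairD[OF n]
  let ?P = "\<lambda>v. v \<noteq> 0 \<and> v \<in> perp W \<inter> perp W' \<and> form v v = 0 \<and> span (insert v W) \<in> G_orbit V_plus"
  let ?Q = "\<lambda>v. v \<noteq> 0 \<and> v \<in> perp W \<inter> perp W' \<and> form v v = 0 \<and> span (insert v W) \<in> G_orbit V_prime"
  have "?P ?p" using d frame_null_pair(2)[OF f ev] by (simp add: W)
  then have P: "?P (v_plus W W')" unfolding v_plus_def by (rule someI)
  have "?Q ?q" using d frame_null_pair(3)[OF f ev] by (simp add: W)
  then have Q: "?Q (v_minus W W')" unfolding v_minus_def by (rule someI)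
  have "ruling 1 (span (insert (v_plus W W') W))" using P V_plus_ruling ev by blast
  then obtain c where c: "c \<noteq> 0" "v_plus W W' = c *\<^sub>R ?p"
    using null_pair_ruling(1)[OF n, of "v_plus W W'"] P by auto
  have "ruling (-1) (span (insert (v_minus W W') W))" using Q V_prime_ruling ev by blast
  then obtain d where d: "d \<noteq> 0" "v_minus W W' = d *\<^sub>R ?q"
    using null_pair_ruling(2)[OF n, of "v_minus W W'"] Q by auto
  show ?thesis unfolding c(2) d(2) by (rule null_pair_scaleR[OF n c(1) d(1)])
qed

lemma span_isotropic:
  assumes "T \<subseteq> perp T"
  shows "span T \<subseteq> perp (span T)"
  unfolding perp_span by (rule span_minimal[OF assms subspace_perp])

lemma span_insert_null:
  assumes W: "W \<in> isotropic_spaces" and p: "p \<in> perp W" "form p p = 0" and x: "x \<in> span (insert p W)"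
  shows "form x x = 0"
proof -
  have "insert p W \<subseteq> perp (insert p W)"
  proof (intro subsetI perpI)
    fix x y assume "x \<in> insert p W" "y \<in> insert p W"
    then show "form x y = 0"
      using perpD[OF p(1)] p(2) isotropic_spacesD(4)[OF W] form_commute[of x y] by auto
  qed
  then have "x \<in> perp (span (insert p W))" using span_isotropic x by blast
  then show ?thesis using x by (rule perpD)
qed

text \<open>If \<open>x\<close> and \<open>y\<close> were orthogonal, they and \<open>W\<close>
  would span an isotropic space, of dimension at most n; both n-planes would equal it, against their
  different rulings. This makes the denominator of the crossratio non-zero.\<close>

lemma form_nonzero_of_ruling:
  fixes W :: "'n::finite vec_nn set"
  assumes W: "W \<in> isotropic_spaces"
    and x: "x \<in> perp W" "form x x = 0" "x \<notin> W" "ruling 1 (span (insert x W))"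
    and y: "y \<in> perp W" "form y y = 0" "y \<notin> W" "ruling (-1) (span (insert y W))"
  shows "form x y \<noteq> 0"
proof
  assume xy: "form x y = 0"
  note Wd = isotropic_spacesD[OF W]
  have sW: "span W = W" using Wd(1) by (simp add: span_eq_iff)
  let ?S = "span (insert x (insert y W))"
  have c: "CARD('n) > 0" by simp
  have f: "form x w = 0 \<and> form w x = 0 \<and> form y w = 0 \<and> form w y = 0" if "w \<in> W" for w
    using perpD[OF x(1) that] perpD[OF y(1) that] form_commute[of w x] form_commute[of w y] by simp
  have "form y x = 0" using xy form_commute[of y x] by simp
  then have "insert x (insert y W) \<subseteq> perp (insert x (insert y W))"
    using f x(2) y(2) xy Wd(4) by (intro subsetI perpI) auto
  then have dS: "dim ?S \<le> CARD('n)" by (intro dim_isotropic_le span_isotropic subspace_span)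
  have "span (insert z W) = ?S" if "z \<in> {x, y}" "z \<notin> W" for z
  proof (rule subspace_dim_equal)
    show "span (insert z W) \<subseteq> ?S" using that(1) by (intro span_mono) auto
    have "dim (span (insert z W)) = CARD('n)" using that(2) Wd(2) c by (simp add: dim_insert sW)
    then show "dim (span (insert z W)) \<ge> dim ?S" using dS by simp
  qed auto
  from this[of x] this[of y] have "span (insert x W) = span (insert y W)" using x(3) y(3) by simp
  then show False using x(4) y(4) ruling_exclusive by metis
qed

lemma null_pair_notin:
  assumes "null_pair W W' p q" shows "p \<notin> W" "q \<notin> W"
  using null_pairD[OF assms] by auto

section \<open>Limits of null directions\<close>

lemma LIMSEQ_subsequences:
  fixes X :: "nat \<Rightarrow> 'b::metric_space"
  assumes "\<And>r. strict_mono r \<Longrightarrow> \<exists>s. strict_mono (s :: nat \<Rightarrow> nat) \<and> (\<lambda>i. X (r (s i))) \<longlonglongrightarrow> L"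
  shows "X \<longlonglongrightarrow> L"
proof (rule ccontr)
  assume "\<not> X \<longlonglongrightarrow> L"
  then obtain e where e: "e > 0" "\<not> (\<forall>\<^sub>F n in sequentially. dist (X n) L < e)"
    by (auto simp: tendsto_iff)
  define A where "A = {n. \<not> dist (X n) L < e}"
  have "infinite A"
    using e(2) by (auto simp: A_def frequently_def[symmetric] not_eventually cofinite_eq_sequentially[symmetric] frequently_cofinite)
  then have r: "strict_mono (enumerate A)" "\<And>n. enumerate A n \<in> A"
    by (auto simp: strict_mono_enumerate enumerate_in_set)
  obtain s where s: "strict_mono (s :: nat \<Rightarrow> nat)" "(\<lambda>i. X (enumerate A (s i))) \<longlonglongrightarrow> L"
    using assms[OF r(1)] by blast
  have "\<forall>\<^sub>F i in sequentially. dist (X (enumerate A (s i))) L < e" by (rule tendstoD[OF s(2) e(1)])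
  then obtain i where "dist (X (enumerate A (s i))) L < e"
    using eventually_happens'[OF sequentially_bot] by blast
  then show False using r(2) by (auto simp: A_def)
qed

text \<open>
  The limit lies on one of the two null lines of the limit plane; it is the line of the right
  ruling because the two rulings are separated by the sign of a continuous determinant.
\<close>

lemma null_direction_subseq:
  fixes W W' :: "'n::finite vec_nn set" and v :: "nat \<Rightarrow> 'n vec_nn"
  assumes n: "null_pair W W' p q"
    and U: "\<And>i. U i \<in> isotropic_spaces" "(\<lambda>i. gap (U i) W) \<longlonglongrightarrow> 0"
    and U': "\<And>i. U' i \<in> isotropic_spaces" "(\<lambda>i. gap (U' i) W') \<longlonglongrightarrow> 0"
    and v: "\<And>i. v i \<in> perp (U i)" "\<And>i. v i \<in> perp (U' i)" "\<And>i. form (v i) (v i) = 0" "\<And>i. v i \<noteq> 0"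
      "\<And>i. ruling (-1) (span (insert (v i) (U i)))"
  shows "\<exists>s c. strict_mono (s :: nat \<Rightarrow> nat) \<and> c \<noteq> 0 \<and> (\<lambda>i. v (s i) /\<^sub>R norm (v (s i))) \<longlonglongrightarrow> c *\<^sub>R q"
proof -
  note d = null_pairD[OF n]
  have "\<forall>i. v i /\<^sub>R norm (v i) \<in> sphere 0 1" using v(4) by simp
  then obtain u s where u: "u \<in> sphere 0 1" and s: "strict_mono (s :: nat \<Rightarrow> nat)"
    and lim: "((\<lambda>i. v i /\<^sub>R norm (v i)) \<circ> s) \<longlonglongrightarrow> u"
    by (rule seq_compactE[OF compact_imp_seq_compact[OF compact_sphere]])
  let ?u = "\<lambda>i. v (s i) /\<^sub>R norm (v (s i))"
  have lu: "?u \<longlonglongrightarrow> u" using lim by (simp add: o_def)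
  have cp: "(\<lambda>i. closest_point (Y (s i)) x) \<longlonglongrightarrow> x"
    if Y: "\<And>i. Y i \<in> isotropic_spaces" "(\<lambda>i. gap (Y i) Z) \<longlonglongrightarrow> 0" and x: "x \<in> Z" and Z: "subspace Z"
    for Y Z and x :: "'n vec_nn"
  proof (rule LIM_zero_cancel, rule Lim_null_comparison)
    show "\<forall>\<^sub>F i in sequentially. norm (closest_point (Y (s i)) x - x) \<le> gap (Y (s i)) Z * norm x"
      using norm_diff_closest_point_gap[OF Z isotropic_spacesD(1)[OF Y(1)] x]
      by (simp add: norm_minus_commute gap_commute)
    show "(\<lambda>i. gap (Y (s i)) Z * norm x) \<longlonglongrightarrow> 0"
      using LIMSEQ_subseq_LIMSEQ[OF Y(2) s] by (intro tendsto_mult_left_zero) (simp add: o_def)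
  qed
  have perp: "u \<in> perp Z"
    if Y: "\<And>i. Y i \<in> isotropic_spaces" "(\<lambda>i. gap (Y i) Z) \<longlonglongrightarrow> 0" and Z: "subspace Z"
      and vY: "\<And>i. v i \<in> perp (Y i)" for Y Z
  proof (rule perpI)
    fix w assume w: "w \<in> Z"
    have "(\<lambda>i. form (?u i) (closest_point (Y (s i)) w)) \<longlonglongrightarrow> form u w"
      by (intro tendsto_form lu cp[OF Y w Z])
    moreover have "form (?u i) (closest_point (Y (s i)) w) = 0" for i
      using perpD[OF vY closest_point_subspace_mem[OF isotropic_spacesD(1)[OF Y(1)]], of "s i" w]
      by (simp add: form_simps)
    ultimately show "form u w = 0" by (simp add: LIMSEQ_const_iff)
  qed
  have Ws: "subspace W" "subspace W'" using isotropic_spacesD(1) d(1,2) by auto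
  have uW: "u \<in> perp W" "u \<in> perp W'" using perp[OF U Ws(1) v(1)] perp[OF U' Ws(2) v(2)] by auto
  have "(\<lambda>i. form (?u i) (?u i)) \<longlonglongrightarrow> form u u" by (intro tendsto_form lu)
  moreover have "form (?u i) (?u i) = 0" for i using v(3) by (simp add: form_simps)
  ultimately have u0: "form u u = 0" by (simp add: LIMSEQ_const_iff)
  have "u \<noteq> 0" using u by auto
  from null_pair_unique[OF n uW u0 this] obtain c where c: "c \<noteq> 0" "u = c *\<^sub>R p \<or> u = c *\<^sub>R q" by blast
  have "u \<noteq> c *\<^sub>R p"
  proof
    assume "u = c *\<^sub>R p"
    then have "ruling 1 (span (insert u W))" using d(13) c(1) by (simp add: span_insert_scaleR)
    then obtain L where L: "range ((*v) L) = span (insert u W)" "block_det L > 0" by (auto simp: ruling_def)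
    have sW: "span W = W" using Ws(1) by (simp add: span_eq_iff)
    have "\<exists>k. L *v axis j 1 - k *\<^sub>R u \<in> W" for j
    proof -
      have "L *v axis j 1 \<in> span (insert u W)" using L(1) by blast
      then show ?thesis unfolding span_breakdown_eq sW .
    qed
    then obtain k where k: "\<And>j. L *v axis j 1 - k j *\<^sub>R u \<in> W" by metis
    \<comment> \<open>The columns of \<open>L\<close> are of the form \<open>w + k u\<close> with
      \<open>w \<in> W\<close>. Projecting \<open>w\<close> to \<open>U (s i)\<close> and replacing
      \<open>u\<close> by the normalized \<open>v (s i)\<close> gives matrices converging to
      \<open>L\<close> whose columns lie in planes of the opposite ruling. Their block determinants
      are at most 0, whereas that of \<open>L\<close> is positive.\<close>
    define col where "col i j = closest_point (U (s i)) (L *v axis j 1 - k j *\<^sub>R u) + k j *\<^sub>R ?u i" for i j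
    define M :: "nat \<Rightarrow> real^'n^('n + 'n)" where "M i = (\<chi> l j. col i j $ l)" for i
    have "(\<lambda>i. col i j) \<longlonglongrightarrow> (L *v axis j 1 - k j *\<^sub>R u) + k j *\<^sub>R u" for j
      unfolding col_def by (intro tendsto_add tendsto_scaleR tendsto_const lu cp[OF U k Ws(1)])
    then have "(\<lambda>i. col i j) \<longlonglongrightarrow> L *v axis j 1" for j by simp
    then have "(\<lambda>i. col i j $ l) \<longlonglongrightarrow> (L *v axis j 1) $ l" for j l by (rule tendsto_vec_nth)
    moreover have "(L *v axis j 1) $ l = L $ l $ j" for j l
      by (simp add: matrix_vector_mul_component inner_axis)
    ultimately have "M \<longlonglongrightarrow> L"
      unfolding M_def by (intro vec_tendstoI) simp
    then have "(\<lambda>i. block_det (M i)) \<longlonglongrightarrow> block_det L"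
      by (rule continuous_on_tendsto_compose[OF continuous_on_block_det[OF continuous_on_id, of UNIV]]) auto
    moreover have "block_det (M i) \<le> 0" for i
    proof -
      have "M i *v x \<in> span (insert (v (s i)) (U (s i)))" for x
      proof -
        have "column j (M i) \<in> span (insert (v (s i)) (U (s i)))" for j
        proof -
          have "column j (M i) = col i j" by (simp add: column_def M_def vec_eq_iff)
          moreover have "closest_point (U (s i)) y \<in> U (s i)" for y
            by (rule closest_point_subspace_mem[OF isotropic_spacesD(1)[OF U(1)]])
          ultimately show ?thesis
            unfolding col_def by (auto intro!: span_add span_scale intro: span_base)
        qed
        then show ?thesis
          unfolding matrix_mult_sum by (auto intro!: span_sum span_scale simp: scalar_mult_eq_scaleR)
      qed
      then show ?thesis using ruling_range_subset[OF v(5)[of "s i"], of "M i"] by auto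
    qed
    ultimately have "block_det L \<le> 0" by (intro LIMSEQ_le_const2) auto
    then show False using L(2) by simp
  qed
  then have "u = c *\<^sub>R q" using c(2) by blast
  then show ?thesis using s c(1) lu by blast
qed

text \<open>Directions converge only along subsequences, each with its own factor \<open>c\<close>.
  Quotients of pairings do not depend on \<open>c\<close>, so every subsequence has a further one
  with the same limit.\<close>

lemma null_direction_limit:
  fixes W W' :: "'n::finite vec_nn set" and v :: "nat \<Rightarrow> 'n vec_nn"
  assumes n: "null_pair W W' p q"
    and U: "\<And>i. U i \<in> isotropic_spaces" "(\<lambda>i. gap (U i) W) \<longlonglongrightarrow> 0"
    and U': "\<And>i. U' i \<in> isotropic_spaces" "(\<lambda>i. gap (U' i) W') \<longlonglongrightarrow> 0"
    and v: "\<And>i. v i \<in> perp (U i)" "\<And>i. v i \<in> perp (U' i)" "\<And>i. form (v i) (v i) = 0" "\<And>i. v i \<noteq> 0"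
      "\<And>i. ruling (-1) (span (insert (v i) (U i)))"
    and b: "form q b \<noteq> 0"
  shows "(\<lambda>i. form (v i) a / form (v i) b) \<longlonglongrightarrow> form q a / form q b"
    and "\<forall>\<^sub>F i in sequentially. form (v i) b \<noteq> 0"
proof -
  have sub: "\<exists>s c. strict_mono (s :: nat \<Rightarrow> nat) \<and> c \<noteq> 0 \<and> (\<lambda>i. v (r (s i)) /\<^sub>R norm (v (r (s i)))) \<longlonglongrightarrow> c *\<^sub>R q"
    if r: "strict_mono r" for r
    using null_direction_subseq[OF n, of "U \<circ> r" "U' \<circ> r" "v \<circ> r"] U U' v
      LIMSEQ_subseq_LIMSEQ[OF U(2) r] LIMSEQ_subseq_LIMSEQ[OF U'(2) r] by (simp add: o_def)
  show "(\<lambda>i. form (v i) a / form (v i) b) \<longlonglongrightarrow> form q a / form q b"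
  proof (rule LIMSEQ_subsequences)
    fix r :: "nat \<Rightarrow> nat" assume "strict_mono r"
    from sub[OF this] obtain s c where s: "strict_mono (s :: nat \<Rightarrow> nat)" "c \<noteq> 0"
      "(\<lambda>i. v (r (s i)) /\<^sub>R norm (v (r (s i)))) \<longlonglongrightarrow> c *\<^sub>R q" by blast
    have "(\<lambda>i. form (v (r (s i)) /\<^sub>R norm (v (r (s i)))) a / form (v (r (s i)) /\<^sub>R norm (v (r (s i)))) b)
      \<longlonglongrightarrow> form (c *\<^sub>R q) a / form (c *\<^sub>R q) b"
      by (intro tendsto_divide tendsto_form s(3) tendsto_const) (use s(2) b in \<open>simp add: form_simps\<close>)
    then have "(\<lambda>i. form (v (r (s i))) a / form (v (r (s i))) b) \<longlonglongrightarrow> form q a / form q b"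
      using v(4) s(2) by (simp add: form_simps)
    then show "\<exists>s. strict_mono (s :: nat \<Rightarrow> nat) \<and>
        (\<lambda>i. form (v (r (s i))) a / form (v (r (s i))) b) \<longlonglongrightarrow> form q a / form q b"
      using s(1) by blast
  qed
  \<comment> \<open>The indicator lets the subsequence criterion yield an eventual statement: a 0-1
    sequence converging to 0 is eventually 0.\<close>
  have "(\<lambda>i. if form (v i) b = 0 then 1 else 0) \<longlonglongrightarrow> (0::real)"
  proof (rule LIMSEQ_subsequences)
    fix r :: "nat \<Rightarrow> nat" assume "strict_mono r"
    from sub[OF this] obtain s c where s: "strict_mono (s :: nat \<Rightarrow> nat)" "c \<noteq> 0"
      "(\<lambda>i. v (r (s i)) /\<^sub>R norm (v (r (s i)))) \<longlonglongrightarrow> c *\<^sub>R q" by blast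
    have "(\<lambda>i. form (v (r (s i)) /\<^sub>R norm (v (r (s i)))) b) \<longlonglongrightarrow> form (c *\<^sub>R q) b"
      by (intro tendsto_form s(3) tendsto_const)
    moreover have "form (c *\<^sub>R q) b \<noteq> 0" using s(2) b by (simp add: form_simps)
    ultimately have "\<forall>\<^sub>F i in sequentially. form (v (r (s i)) /\<^sub>R norm (v (r (s i)))) b \<noteq> 0"
      by (rule tendsto_imp_eventually_ne)
    then have "\<forall>\<^sub>F i in sequentially. form (v (r (s i))) b \<noteq> 0"
      by eventually_elim (auto simp: form_simps)
    then have "(\<lambda>i. if form (v (r (s i))) b = 0 then 1 else 0) \<longlonglongrightarrow> (0::real)"
      by (intro tendsto_eventually) (auto elim: eventually_mono)
    then show "\<exists>s. strict_mono (s :: nat \<Rightarrow> nat) \<and> (\<lambda>i. if form (v (r (s i))) b = 0 then 1 else 0) \<longlonglongrightarrow> (0::real)"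
      using s(1) by blast
  qed
  from order_tendstoD(2)[OF this, of 1] show "\<forall>\<^sub>F i in sequentially. form (v i) b \<noteq> 0"
    by (auto elim: eventually_mono split: if_splits)
qed

section \<open>Products of powers of two loxodromic isometries\<close>

primrec mat_pow :: "real^'n^'n \<Rightarrow> nat \<Rightarrow> real^'n^'n" where
  "mat_pow A 0 = mat 1"
| "mat_pow A (Suc k) = A ** mat_pow A k"

lemma mat_pow_vec: "mat_pow A k *v x = ((*v) A ^^ k) x"
  by (induction k) (simp_all add: matrix_vector_mul_assoc[symmetric])

lemma mat_pow_inverse:
  assumes "A ** B = mat 1"
  shows "mat_pow A k ** mat_pow B k = mat 1"
proof -
  have "A *v (B *v x) = x" for x using assms by (simp add: matrix_vector_mul_assoc)
  then have "((*v) A ^^ k) (((*v) B ^^ k) x) = x" for x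
    by (induction k arbitrary: x) (simp_all add: funpow_swap1)
  then show ?thesis by (simp add: matrix_eq matrix_vector_mul_assoc[symmetric] mat_pow_vec)
qed

lemma mat_pow_SO0: "A \<in> SO0 \<Longrightarrow> mat_pow A k \<in> SO0"
  by (induction k) (auto intro: SO0_one SO0_mult)

lemma mat_pow_eigen: "A *v x = a *\<^sub>R x \<Longrightarrow> mat_pow A k *v x = a ^ k *\<^sub>R x"
  by (simp add: mat_pow_vec funpow_eigen[where f = "(*v) A"])

lemma mat_pow_mult_vec: "(*v) (mat_pow A k ** mat_pow B k) = ((*v) A ^^ k) \<circ> ((*v) B ^^ k)"
  by (simp add: fun_eq_iff matrix_vector_mul_assoc[symmetric] mat_pow_vec)

text \<open>Applied with \<open>h\<close> the power B^k, which conjugates A^k B^k to B^k A^k and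
  carries the null eigenvector v to u.\<close>

lemma loxodromic_conjugate:
  fixes h :: "'n::finite mat_nn"
  assumes g: "loxodromic g W W' p q a" and h: "h \<in> SO0" and h': "h ** h' = mat 1" "h' ** h = mat 1"
  shows "loxodromic (h ** g ** h') ((*v) h ` W) ((*v) h ` W') (h *v p) (h *v q) a"
proof -
  interpret lox g W W' p q a by unfold_locales (rule g)
  have hh: "h *v (h' *v x) = x" "h' *v (h *v x) = x" for x using h' by (simp_all add: matrix_vector_mul_assoc)
  note hf = SO0_form[OF h]
  have h'f: "form (h' *v v) (h' *v w) = form v w" for v w using hf[of "h' *v v" "h' *v w"] by (simp add: hh)
  have act: "(h ** g ** h') *v x = h *v (g *v (h' *v x))" for x by (simp add: matrix_vector_mul_assoc[symmetric])
  have pow: "((*v) (h ** g ** h') ^^ m) (h *v x) = h *v ((*v) g ^^ m) x" for m x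
    by (induction m) (simp_all add: act hh)
  have pe: "h *v x \<in> perp ((*v) h ` U)" if "x \<in> perp U" for x U
    using perp_image[OF hf] that by blast
  have tr: "(*v) h ` W \<inter> perp ((*v) h ` W') \<subseteq> {0}"
  proof
    fix x assume x: "x \<in> (*v) h ` W \<inter> perp ((*v) h ` W')"
    then obtain y where y: "x = h *v y" "y \<in> W" by auto
    have "form y w = 0" if "w \<in> W'" for w
      using perpD[of x "(*v) h ` W'" "h *v w"] x that by (simp add: y(1) hf)
    then have "y \<in> perp W'" by (rule perpI)
    then show "x \<in> {0}" using transverse y by auto
  qed
  have im: "(*v) (h ** g ** h') ` (*v) h ` U = (*v) h ` U" if "(*v) g ` U = U" for U
  proof -
    have "(*v) (h ** g ** h') ` (*v) h ` U = (*v) h ` (*v) g ` U" by (simp add: image_image act hh)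
    then show ?thesis using that by simp
  qed
  have lim: "(\<lambda>m. c ^ m *\<^sub>R ((*v) (h ** g ** h') ^^ m) (h *v x)) \<longlonglongrightarrow> 0"
    if "(\<lambda>m. c ^ m *\<^sub>R ((*v) g ^^ m) x) \<longlonglongrightarrow> 0" for c x
  proof -
    have "(\<lambda>m. h *v (c ^ m *\<^sub>R ((*v) g ^^ m) x)) \<longlonglongrightarrow> h *v 0"
      by (intro bounded_linear.tendsto[OF matrix_vector_mul_bounded_linear] that)
    then show ?thesis by (simp add: pow linear_scale)
  qed
  show ?thesis
    unfolding loxodromic_def
  proof (intro conjI allI ballI)
    fix x assume "x \<in> (*v) h ` W'"
    then show "(\<lambda>m. a ^ m *\<^sub>R ((*v) (h ** g ** h') ^^ m) x) \<longlonglongrightarrow> 0"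
      "(\<lambda>m. (1 / a) ^ m *\<^sub>R ((*v) (h ** g ** h') ^^ m) x) \<longlonglongrightarrow> 0"
      using lim decay by auto
  qed (use tr W W' gW gW' p q pq a gp gq SO0_isotropic[OF h] im pe in
      \<open>auto simp: act hf h'f g hh linear_scale\<close>)
qed

lemma loxodromic_ping_pong:
  fixes A B :: "'n::finite mat_nn"
  assumes A: "loxodromic A WA WA' pA qA a" and B: "loxodromic B WB WB' pB qB b"
    and tA: "WA \<inter> perp WB' \<subseteq> {0}" and tB: "WB \<inter> perp WA' \<subseteq> {0}"
    and k: "strict_mono k"
    and C: "\<And>i::nat. loxodromic (mat_pow A (k i) ** mat_pow B (k i)) (U i) (U' i) (p i) (q i) (c i)"
  shows "(\<lambda>i. gap (U i) WA) \<longlonglongrightarrow> 0"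
proof -
  interpret A: lox A WA WA' pA qA a by unfold_locales (rule A)
  interpret B: lox B WB WB' pB qB b by unfold_locales (rule B)
  obtain \<pi>A where \<pi>A: "dominated ((*v) A) \<pi>A" "range \<pi>A = WA" "\<And>x. \<pi>A x = 0 \<longleftrightarrow> x \<in> perp WA'"
    using A.dominated_projection by blast
  obtain \<pi>B where \<pi>B: "dominated ((*v) B) \<pi>B" "range \<pi>B = WB" "\<And>x. \<pi>B x = 0 \<longleftrightarrow> x \<in> perp WB'"
    using B.dominated_projection by blast
  have dims: "dim (range \<pi>A) = dim (range \<pi>B)" "dim (range \<pi>A) = CARD('n) - 1"
    unfolding \<pi>A(2) \<pi>B(2) using isotropic_spacesD(2)[OF A.W] isotropic_spacesD(2)[OF B.W] by simp_all
  obtain d e where d: "d > 0" and e: "e \<longlonglongrightarrow> 0" and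
    ev: "\<forall>\<^sub>F k in sequentially. \<forall>V U. subspace V \<longrightarrow> subspace U \<longrightarrow>
      dim V = dim (range \<pi>A) \<longrightarrow> gap V (range \<pi>A) < d \<longrightarrow>
      (\<lambda>m. gap (((((*v) A ^^ k) \<circ> ((*v) B ^^ k)) ^^ m) ` V) U) \<longlonglongrightarrow> 0 \<longrightarrow> gap U (range \<pi>A) \<le> e k"
  proof -
    have "x = 0" if "x \<in> range \<pi>A" "\<pi>B x = 0" for x
      using that tA unfolding \<pi>A(2) \<pi>B(3) by blast
    moreover have "x = 0" if "x \<in> range \<pi>B" "\<pi>A x = 0" for x
      using that tB unfolding \<pi>B(2) \<pi>A(3) by blast
    ultimately show ?thesis using ping_pong[OF \<pi>A(1) \<pi>B(1) dims(1)] that by fast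
  qed
  have le: "\<forall>\<^sub>F i in sequentially. gap (U i) WA \<le> e (k i)"
    using eventually_subseq[OF k ev]
  proof eventually_elim
    case (elim i)
    interpret C: lox "mat_pow A (k i) ** mat_pow B (k i)" "U i" "U' i" "p i" "q i" "c i"
      by unfold_locales (rule C)
    \<comment> \<open>Ping-pong takes a starting point near \<open>WA\<close> whose iterates
      converge to \<open>U i\<close>; being transverse to \<open>perp (U' i)\<close>, with
      \<open>U' i\<close> the repelling space of the product, \<open>V\<close> is one.\<close>
    obtain V where V: "V \<in> isotropic_spaces" "gap V WA < d" "V \<inter> perp (U' i) \<subseteq> {0}"
      using isotropic_transverse_dense[OF A.W C.W' d] by blast
    note Vd = isotropic_spacesD[OF V(1)]
    have lim: "(\<lambda>m. gap (((((*v) A ^^ k i) \<circ> ((*v) B ^^ k i)) ^^ m) ` V) (U i)) \<longlonglongrightarrow> 0"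
      using C.attraction[OF Vd(1,2) V(3)] unfolding mat_pow_mult_vec .
    show ?case
      using elim[rule_format, OF Vd(1) isotropic_spacesD(1)[OF C.W] _ _ lim] Vd(2) V(2)
      by (simp add: dims(2)[unfolded \<pi>A(2)] \<pi>A(2))
  qed
  have lim: "(\<lambda>i. e (k i)) \<longlonglongrightarrow> 0" using LIMSEQ_subseq_LIMSEQ[OF e k] by (simp add: o_def)
  have ge: "\<forall>i. 0 \<le> gap (U i) WA"
  proof (intro allI gap_nonneg)
    fix i
    show "subspace WA" by (rule isotropic_spacesD(1)[OF A.W])
    have "U i \<in> isotropic_spaces" using C[of i] unfolding loxodromic_def by blast
    then show "subspace (U i)" by (rule isotropic_spacesD(1))
  qed
  show ?thesis by (rule tendsto_sandwich[OF always_eventually[OF ge] le tendsto_const lim])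
qed

lemma eigenvalue_crossratio_limit:
  fixes A B A' B' :: "'n::finite mat_nn"
  assumes SO: "A \<in> SO0" "B \<in> SO0"
    and inv: "A ** A' = mat 1" "A' ** A = mat 1" "B ** B' = mat 1" "B' ** B = mat 1"
    and A: "loxodromic A W3 W2 m23 p23 a" and B: "loxodromic B W4 W1 m14 p14 b"
    and n13: "null_pair W1 W3 p13 m13" and n24: "null_pair W2 W4 p24 m24"
    and n23: "null_pair W2 W3 p23 m23" and n14: "null_pair W1 W4 p14 m14"
    and k: "strict_mono k"
    and C: "\<And>i::nat. loxodromic (mat_pow A (k i) ** mat_pow B (k i)) (U i) (U' i) (P i) (M i) (l i)"
    and nU: "\<And>i. null_pair (U i) (U' i) (P i) (M i)"
  shows "(\<lambda>i. l i / (a ^ k i * b ^ k i)) \<longlonglongrightarrow>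
    (form p13 m23 * form p24 m14) / (form p24 m23 * form p13 m14)"
proof -
  interpret A: lox A W3 W2 m23 p23 a by unfold_locales (rule A)
  interpret B: lox B W4 W1 m14 p14 b by unfold_locales (rule B)
  let ?A = "\<lambda>i. mat_pow A (k i)" and ?B = "\<lambda>i. mat_pow B (k i)"
  let ?A' = "\<lambda>i. mat_pow A' (k i)" and ?B' = "\<lambda>i. mat_pow B' (k i)"
  have AA: "?A i ** ?A' i = mat 1" "?A' i ** ?A i = mat 1" "?B i ** ?B' i = mat 1" "?B' i ** ?B i = mat 1" for i
    by (intro mat_pow_inverse inv)+
  have C': "loxodromic (?B' i ** ?A' i) (U' i) (U i) (P i) (M i) (1 / l i)" for i
  proof (rule lox.inverse[OF lox.intro[OF C]])
    show "?B' i ** ?A' i ** (?A i ** ?B i) = mat 1"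
      by (metis AA matrix_mul_assoc matrix_mul_lid)
    show "?A i ** ?B i ** (?B' i ** ?A' i) = mat 1"
      by (metis AA matrix_mul_assoc matrix_mul_lid)
  qed
  have D: "loxodromic (?B i ** ?A i) ((*v) (?B i) ` U i) ((*v) (?B i) ` U' i) (?B i *v P i) (?B i *v M i) (l i)" for i
  proof -
    have "?B i ** (?A i ** ?B i) ** ?B' i = ?B i ** ?A i"
      by (metis AA matrix_mul_assoc matrix_mul_rid)
    with loxodromic_conjugate[OF C[of i] mat_pow_SO0[OF SO(2)] AA(3)[of i] AA(4)[of i]]
    show ?thesis by (simp only:)
  qed
  have D': "loxodromic (?A' i ** ?B' i) ((*v) (?B i) ` U' i) ((*v) (?B i) ` U i) (?B i *v P i) (?B i *v M i) (1 / l i)" for i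
  proof (rule lox.inverse[OF lox.intro[OF D]])
    show "?A' i ** ?B' i ** (?B i ** ?A i) = mat 1"
      by (metis AA matrix_mul_assoc matrix_mul_lid)
    show "?B i ** ?A i ** (?A' i ** ?B' i) = mat 1"
      by (metis AA matrix_mul_assoc matrix_mul_lid)
  qed
  have A': "loxodromic A' W2 W3 m23 p23 (1 / a)" by (rule A.inverse[OF inv(2,1)])
  have B': "loxodromic B' W1 W4 m14 p14 (1 / b)" by (rule B.inverse[OF inv(4,3)])
  note n31 = null_pair_commute[OF n13] and n42 = null_pair_commute[OF n24]
  \<comment> \<open>\<open>U i\<close>, \<open>U' i\<close> and their images under
    \<open>?B i\<close> are the attracting spaces of the product, of its conjugate and of the
    inverses of both. Four ping-pongs locate them near \<open>W3\<close>, \<open>W1\<close>,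
    \<open>W4\<close> and \<open>W2\<close>; the transversality used is always that of
    \<open>W1\<close> with \<open>W3\<close> and of \<open>W2\<close> with
    \<open>W4\<close>.\<close>
  have g1: "(\<lambda>i. gap (U i) W3) \<longlonglongrightarrow> 0"
    by (rule loxodromic_ping_pong[OF A B _ _ k C]) (use null_pairD(3) n31 n42 in blast)+
  have g2: "(\<lambda>i. gap (U' i) W1) \<longlonglongrightarrow> 0"
    by (rule loxodromic_ping_pong[OF B' A' _ _ k C']) (use null_pairD(3) n13 n24 in blast)+
  have g3: "(\<lambda>i. gap ((*v) (?B i) ` U i) W4) \<longlonglongrightarrow> 0"
    by (rule loxodromic_ping_pong[OF B A _ _ k D]) (use null_pairD(3) n31 n42 in blast)+
  have g4: "(\<lambda>i. gap ((*v) (?B i) ` U' i) W2) \<longlonglongrightarrow> 0"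
    by (rule loxodromic_ping_pong[OF A' B' _ _ k D']) (use null_pairD(3) n13 n24 in blast)+
  \<comment> \<open>The vectors share a first subspace: \<open>p13\<close> and \<open>m14\<close>
    have opposite rulings over \<open>W1\<close>, and \<open>p24\<close> and \<open>m23\<close> over
    \<open>W2\<close>.\<close>
  have nz: "form p13 m14 \<noteq> 0" "form p24 m23 \<noteq> 0"
    using form_nonzero_of_ruling[OF null_pairD(1)[OF n13], of p13 m14] null_pair_notin[OF n13] null_pair_notin[OF n14]
      form_nonzero_of_ruling[OF null_pairD(1)[OF n24], of p24 m23] null_pair_notin[OF n24] null_pair_notin[OF n23]
      null_pairD[OF n13] null_pairD[OF n14] null_pairD[OF n24] null_pairD[OF n23] by blast+
  note nUd = null_pairD[OF nU]
  \<comment> \<open>\<open>M i\<close> is the second vector of its pair, and the limit pair is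
    \<open>(W3, W1)\<close> in this order. Exchanging the subspaces exchanges the vectors, so the
    direction tends to that of \<open>p13\<close>; likewise that of \<open>?u i\<close> below tends
    to that of \<open>p24\<close>.\<close>
  have v: "(\<lambda>i. form (M i) m23 / form (M i) m14) \<longlonglongrightarrow> form p13 m23 / form p13 m14"
    and v_nz: "\<forall>\<^sub>F i in sequentially. form (M i) m14 \<noteq> 0"
    using null_direction_limit[where v = M, OF n31 nUd(1) g1 nUd(2) g2 nUd(6,7,9,12,14) nz(1)] by blast+
  let ?u = "\<lambda>i. ?B i *v M i"
  have Bf: "form (?B i *v x) (?B i *v y) = form x y" for i x y
    by (rule SO0_form[OF mat_pow_SO0[OF SO(2)]])
  have Af: "form (?A i *v x) (?A i *v y) = form x y" for i x y
    by (rule SO0_form[OF mat_pow_SO0[OF SO(1)]])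
  have u_perp: "?u i \<in> perp ((*v) (?B i) ` U i)" "?u i \<in> perp ((*v) (?B i) ` U' i)" for i
    using perp_image[OF Bf] nUd(6,7) by blast+
  have u_iso: "(*v) (?B i) ` U i \<in> isotropic_spaces" "(*v) (?B i) ` U' i \<in> isotropic_spaces" for i
    by (intro SO0_isotropic mat_pow_SO0 SO nUd)+
  have u_null: "form (?u i) (?u i) = 0" "?u i \<noteq> 0" for i
  proof -
    show "form (?u i) (?u i) = 0" using Bf nUd(9) by simp
    show "?u i \<noteq> 0"
    proof
      assume "?u i = 0"
      then have "form (M i) (P i) = 0" using Bf[of i "M i" "P i"] by simp
      then show False using nUd(10)[of i] form_commute[of "M i" "P i"] by simp
    qed
  qed
  have u_ruling: "ruling (-1) (span (insert (?u i) ((*v) (?B i) ` U i)))" for i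
  proof -
    have "ruling (-1) ((*v) (?B i) ` span (insert (M i) (U i)))"
      by (rule SO0_ruling[OF nUd(14) span_insert_null[OF nUd(1,6,9)] mat_pow_SO0[OF SO(2)]])
    then show ?thesis by (simp add: linear_span_image[symmetric])
  qed
  have u: "(\<lambda>i. form (?u i) m14 / form (?u i) m23) \<longlonglongrightarrow> form p24 m14 / form p24 m23"
    and u_nz: "\<forall>\<^sub>F i in sequentially. form (?u i) m23 \<noteq> 0"
    using null_direction_limit[where v = ?u, OF n42 u_iso(1) g3 u_iso(2) g4 u_perp u_null u_ruling nz(2)] by blast+
  have "\<forall>\<^sub>F i in sequentially.
    (form (M i) m23 / form (M i) m14) * (form (?u i) m14 / form (?u i) m23) = l i / (a ^ k i * b ^ k i)"
    using v_nz u_nz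
  proof eventually_elim
    case (elim i)
    interpret C: lox "?A i ** ?B i" "U i" "U' i" "P i" "M i" "l i" by unfold_locales (rule C)
    have "form (M i) m14 = form (?u i) (?B i *v m14)" by (simp add: Bf)
    then have 1: "form (M i) m14 = b ^ k i * form (?u i) m14"
      by (simp add: mat_pow_eigen[OF B.gp] form_simps)
    have "form (?u i) m23 = form (?A i *v ?u i) (?A i *v m23)" by (simp add: Af)
    also have "?A i *v ?u i = (1 / l i) *\<^sub>R M i" using C.gq by (simp add: matrix_vector_mul_assoc)
    finally have 2: "l i * form (?u i) m23 = a ^ k i * form (M i) m23"
      using C.a by (simp add: mat_pow_eigen[OF A.gp] form_simps)
    have nz': "a ^ k i \<noteq> 0" "b ^ k i \<noteq> 0" "form (?u i) m14 \<noteq> 0" using A.a B.a elim(1) 1 by auto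
    have "form (M i) m23 = l i * form (?u i) m23 / a ^ k i" using 2 nz' by (simp add: field_simps)
    then show ?case using nz' elim(2) by (simp add: 1)
  qed
  from Lim_transform_eventually[OF tendsto_mult[OF v u] this]
  show ?thesis by (simp add: mult.commute)
qed

section \<open>Contraction of tangent vectors\<close>

lemma matrix_inv_SO_nn:
  assumes "g \<in> SO_nn"
  shows "g ** matrix_inv g = mat 1" "matrix_inv g ** g = mat 1"
proof -
  have "invertible g" using assms by (auto simp: SO_nn_def invertible_det_nz)
  then have "g ** matrix_inv g = mat 1 \<and> matrix_inv g ** g = mat 1"
    unfolding invertible_def matrix_inv_def by (rule someI_ex)
  then show "g ** matrix_inv g = mat 1" "matrix_inv g ** g = mat 1" by auto
qed

lemma form_preserving_det:
  fixes g :: "'n::finite mat_nn"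
  assumes "\<And>v w. form (g *v v) (g *v w) = form v w"
  shows "det g = 1 \<or> det g = -1"
proof -
  have "v \<bullet> ((transpose g ** (I_nn ** g)) *v w) = v \<bullet> (I_nn *v w)" for v w
  proof -
    have "v \<bullet> ((transpose g ** (I_nn ** g)) *v w) = (g *v v) \<bullet> (I_nn *v (g *v w))"
      by (simp add: matrix_vector_mul_assoc[symmetric] dot_lmul_matrix inner_commute[of v] inner_commute[of "g *v v"])
    then show ?thesis using assms[of v w] by (simp add: form_def)
  qed
  then have "(transpose g ** (I_nn ** g)) *v w = I_nn *v w" for w
    using vector_eq_ldot[of "(transpose g ** (I_nn ** g)) *v w" "I_nn *v w"] by blast
  then have "transpose g ** (I_nn ** g) = I_nn" by (simp only: matrix_eq) blast
  then have "det (transpose g ** (I_nn ** g)) = det (I_nn :: 'n mat_nn)" by simp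
  then have "det g * (det (I_nn :: 'n mat_nn) * det g) = det (I_nn :: 'n mat_nn)"
    by (simp only: det_mul det_transpose)
  moreover have "det (I_nn :: 'n mat_nn) \<noteq> 0" by (rule inj_det_nonzero) (metis I_nn_I_nn matrix_vector_mult_0_right)
  ultimately have "det g * det g = 1" by (simp add: mult.left_commute)
  then show ?thesis by (simp add: square_eq_1_iff)
qed

text \<open>The element u \<and> x of the Lie algebra so(n,n). When \<open>u\<close> and
  \<open>x\<close> span an isotropic subspace it generates a one-parameter group of Eichler (or
  Siegel) transvections.\<close>

definition eichler :: "'n::finite vec_nn \<Rightarrow> 'n vec_nn \<Rightarrow> 'n mat_nn" where
  "eichler u x = matrix (\<lambda>y. form x y *\<^sub>R u - form u y *\<^sub>R x)"

lemma eichler_vec [simp]: "eichler u x *v y = form x y *\<^sub>R u - form u y *\<^sub>R x"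
proof -
  have "linear (\<lambda>y. form x y *\<^sub>R u - form u y *\<^sub>R x)"
    by (auto intro!: linearI simp: form_simps algebra_simps)
  then show ?thesis unfolding eichler_def by (simp add: matrix_works)
qed

lemma eichler_scaleR: "eichler (c *\<^sub>R u) x = eichler u (c *\<^sub>R x)"
  by (simp add: matrix_eq form_simps algebra_simps)

lemma eichler_linear: "linear (eichler u)"
proof (rule linearI)
  show "eichler u (x + y) = eichler u x + eichler u y" for x y
    by (simp add: matrix_eq matrix_vector_mult_add_rdistrib form_simps algebra_simps)
  show "eichler u (c *\<^sub>R x) = c *\<^sub>R eichler u x" for c x
    by (simp add: matrix_eq scaleR_matrix_vector_assoc[symmetric] form_simps algebra_simps)
qed

lemma Ad_eichler:
  fixes g :: "'n::finite mat_nn"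
  assumes g: "g \<in> SO0"
  shows "Ad g (eichler u x) = eichler (g *v u) (g *v x)"
proof -
  let ?h = "matrix_inv g"
  have h: "g *v (?h *v y) = y" for y
    using matrix_inv_SO_nn(1)[OF SO0_subset[OF g]] by (simp add: matrix_vector_mul_assoc)
  have "form v (?h *v y) = form (g *v v) y" for v y
    using SO0_form[OF g, of v "?h *v y"] by (simp add: h)
  then show ?thesis
    by (simp add: Ad_def matrix_eq matrix_vector_mul_assoc[symmetric] linear_diff linear_scale)
qed

text \<open>Under these conditions \<open>eichler u x\<close> has square 0, so the affine curve
  \<open>1 + t Z\<close> already consists of isometries. Its determinant is continuous with values 1
  and -1, hence constantly 1.\<close>

lemma eichler_lie_algebra:
  fixes u x :: "'n::finite vec_nn"
  assumes "form u u = 0" "form x x = 0" "form u x = 0"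
  shows "eichler u x \<in> lie_algebra SO0"
proof -
  let ?Z = "eichler u x"
  let ?c = "\<lambda>t. mat 1 + t *\<^sub>R ?Z"
  have cv: "?c t *v y = y + t *\<^sub>R (?Z *v y)" for t y
    by (simp only: matrix_vector_mult_add_rdistrib matrix_vector_mul_lid scaleR_matrix_vector_assoc[symmetric])
  have xu: "form x u = 0" using assms(3) form_commute[of x u] by simp
  have pres: "form (?c t *v v) (?c t *v w) = form v w" for t v w
    unfolding cv using assms xu form_commute[of v u] form_commute[of v x]
    by (simp add: form_simps algebra_simps)
  have cont: "continuous_on UNIV ?c" by (intro continuous_intros)
  have "det (?c t) = 1" for t
  proof (rule ccontr)
    assume "det (?c t) \<noteq> 1"
    then have d: "det (?c t) = -1" using form_preserving_det[OF pres] by blast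
    have "connected ((\<lambda>t. det (?c t)) ` UNIV)"
      unfolding det_def by (intro connected_continuous_image continuous_intros) auto
    from connectedD_interval[OF this imageI[of t] imageI[of 0], of 0] d
    have "0 \<in> (\<lambda>t. det (?c t)) ` UNIV" by simp
    then obtain s where "det (?c s) = 0" by auto
    then show False using form_preserving_det[OF pres, of s] by simp
  qed
  then have "?c t \<in> SO_nn" for t using pres by (simp add: SO_nn_def)
  then have "?c t \<in> SO0" for t by (rule SO0_curve[OF cont]) simp
  moreover have "(?c has_vector_derivative ?Z) (at 0)"
    by (auto intro!: derivative_eq_intros)
  ultimately show ?thesis unfolding lie_algebra_def by (intro CollectI exI[of _ ?c]) simp
qed

section \<open>Stabilizers of the oriented model spaces and their Lie algebras\<close>

lemma base_eq_span: "base s = span (frame s ` (UNIV - {last_index}))"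
proof
  show "base s \<subseteq> span (frame s ` (UNIV - {last_index}))"
  proof
    fix v :: "'n::{finite,linorder} vec_nn" assume "v \<in> base s"
    then obtain y where v: "v = emb s y" and y: "y $ last_index = 0" by (auto simp: base_def)
    have "v = (\<Sum>i\<in>UNIV. (y $ i) *\<^sub>R frame s i)" unfolding v by (rule emb_expansion)
    also have "\<dots> = (\<Sum>i\<in>UNIV - {last_index}. (y $ i) *\<^sub>R frame s i)"
      by (rule sum.mono_neutral_right) (auto simp: y)
    also have "\<dots> \<in> span (frame s ` (UNIV - {last_index}))"
      by (intro span_sum span_scale span_base imageI)
    finally show "v \<in> span (frame s ` (UNIV - {last_index}))" .
  qed
  show "span (frame s ` (UNIV - {last_index})) \<subseteq> base s"
    by (intro span_minimal subspace_base) (auto simp: base_def frame_emb axis_def)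
qed

lemma oriented_stab_image:
  fixes h :: "'n::{finite,linorder} mat_nn"
  assumes "h \<in> oriented_stab s"
  shows "h \<in> SO0" "(*v) h ` base s = base s"
proof -
  show h: "h \<in> SO0" using assms by (simp add: oriented_stab_def)
  obtain A where A: "\<And>j. j \<in> UNIV - {last_index} \<Longrightarrow>
      h *v frame s j = (\<Sum>i\<in>UNIV - {last_index}. A i j *\<^sub>R frame s i)"
    using assms unfolding oriented_stab_def same_oriented_span_def by blast
  have "(*v) h ` frame s ` (UNIV - {last_index}) \<subseteq> base s"
  proof
    fix x assume "x \<in> (*v) h ` frame s ` (UNIV - {last_index})"
    then obtain j where j: "j \<in> UNIV - {last_index}" "x = h *v frame s j" by blast
    show "x \<in> base s"
      unfolding j(2) A[OF j(1)] base_eq_span by (intro span_sum span_scale span_base imageI)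
  qed
  then have "(*v) h ` base s \<subseteq> base s"
    unfolding base_eq_span[of s] by (metis base_eq_span linear_span_image matrix_vector_mul_linear span_minimal subspace_base)
  moreover have "dim ((*v) h ` base s) = dim (base s :: 'n vec_nn set)"
    by (rule dim_image_eq) (use inj_on_subset[OF form_preserving_inj[OF SO0_form[OF h]]] in auto)
  ultimately show "(*v) h ` base s = base s"
    by (intro subspace_dim_equal linear_subspace_image subspace_base) auto
qed

lemma det_on_one:
  assumes "finite I"
  shows "det_on I (\<lambda>i j. if i = j then 1 else 0) = 1"
proof -
  have z: "(\<Prod>i\<in>I. if i = p i then 1 else 0 :: real) = 0" if p: "p permutes I" "p \<noteq> id" for p
  proof -
    obtain i where "p i \<noteq> i" using p(2) by (auto simp: fun_eq_iff)
    moreover from this have "i \<in> I" using p(1) by (auto simp: permutes_def)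
    ultimately show ?thesis using assms by (intro prod_zero) force+
  qed
  have "det_on I (\<lambda>i j. if i = j then 1 else 0) =
    (\<Sum>p\<in>{id}. of_int (sign p) * (\<Prod>i\<in>I. if i = p i then 1 else 0))"
    unfolding det_on_def
    by (rule sum.mono_neutral_right) (auto simp: finite_permutations[OF assms] permutes_id z)
  then show ?thesis by (simp add: sign_id)
qed

lemma oriented_stab_one: "mat 1 \<in> oriented_stab s"
proof -
  have "same_oriented_span (UNIV - {last_index}) (frame s) (\<lambda>j. mat 1 *v frame s j :: 'n::{finite,linorder} vec_nn)"
    unfolding same_oriented_span_def
    by (rule exI[of _ "\<lambda>i j. if i = j then 1 else 0"]) (simp add: det_on_one if_distrib[of "\<lambda>c. c *\<^sub>R x" for x] cong: if_cong)
  then show ?thesis by (simp add: oriented_stab_def SO0_one)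
qed

lemma l_coset_SO0: "g <#\<^bsub>SO0_group\<^esub> H = (\<lambda>h. g ** h) ` H"
  by (auto simp: l_coset_def SO0_group_def)

lemma coset_fixed_image:
  fixes g f :: "'n::{finite,linorder} mat_nn"
  assumes "g <#\<^bsub>SO0_group\<^esub> (f <#\<^bsub>SO0_group\<^esub> oriented_stab s) = f' <#\<^bsub>SO0_group\<^esub> oriented_stab s"
  shows "(*v) g ` (*v) f ` base s = (*v) f' ` base s"
proof -
  have "g ** (f ** mat 1) \<in> g <#\<^bsub>SO0_group\<^esub> (f <#\<^bsub>SO0_group\<^esub> oriented_stab s)"
    unfolding l_coset_SO0 by (intro imageI oriented_stab_one)
  then have "g ** (f ** mat 1) \<in> f' <#\<^bsub>SO0_group\<^esub> oriented_stab s" unfolding assms .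
  then obtain h where h: "h \<in> oriented_stab s" "g ** f = f' ** h" by (auto simp: l_coset_SO0)
  have "(*v) g ` (*v) f ` base s = (*v) (g ** f) ` base s" by (simp add: image_image matrix_vector_mul_assoc)
  also have "\<dots> = (*v) f' ` (*v) h ` base s" by (simp add: h(2) image_image matrix_vector_mul_assoc)
  also have "\<dots> = (*v) f' ` base s" by (simp add: oriented_stab_image(2)[OF h(1)])
  finally show ?thesis .
qed

lemma subspace_has_vector_derivative:
  fixes c :: "real \<Rightarrow> 'v::euclidean_space"
  assumes W: "subspace W" and c: "\<And>t. c t \<in> W" "(c has_vector_derivative z) (at t0)"
  shows "z \<in> W"
proof -
  let ?L = "\<lambda>x. x - closest_point W x"
  have "bounded_linear ?L"
    using linear_compose_sub[OF linear_ident linear_closest_point[OF W]] by (simp add: linear_conv_bounded_linear)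
  from bounded_linear.has_vector_derivative[OF this c(2)]
  have "((\<lambda>t. 0) has_vector_derivative ?L z) (at t0)"
    by (simp add: closest_point_self[OF c(1)])
  then have "?L z = 0" by (rule vector_derivative_unique_at[OF _ has_vector_derivative_const])
  then show ?thesis using closest_point_subspace_mem[OF W, of z] by simp
qed

text \<open>A curve in the stabilizer moves \<open>w\<close> within the subspace, so its velocity
  lies there too. Consequently an algebra element that does not preserve the subspace represents a
  non-zero tangent vector of G/P.\<close>

lemma stab_algebra_image:
  fixes f :: "'n::{finite,linorder} mat_nn"
  assumes Z: "Z \<in> stab_algebra (f <#\<^bsub>SO0_group\<^esub> oriented_stab s)" and w: "w \<in> (*v) f ` base s"
  shows "Z *v w \<in> (*v) f ` base s"
proof -
  obtain c where c: "(c has_vector_derivative Z) (at 0)"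
    "\<And>t. c t <#\<^bsub>SO0_group\<^esub> (f <#\<^bsub>SO0_group\<^esub> oriented_stab s) = f <#\<^bsub>SO0_group\<^esub> oriented_stab s"
    using Z unfolding stab_algebra_def lie_algebra_def stabilizer_def by blast
  show ?thesis
  proof (rule subspace_has_vector_derivative)
    show "subspace ((*v) f ` base s)" by (intro linear_subspace_image subspace_base) simp
    show "c t *v w \<in> (*v) f ` base s" for t using coset_fixed_image[OF c(2)] w by blast
    have "bounded_linear (\<lambda>M. M *v w :: 'n vec_nn)"
      by (rule linear_conv_bounded_linear[THEN iffD1])
        (auto intro!: linearI simp: matrix_vector_mult_add_rdistrib scaleR_matrix_vector_assoc)
    from bounded_linear.has_vector_derivative[OF this c(1)]
    show "((\<lambda>t. c t *v w) has_vector_derivative Z *v w) (at 0)" .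
  qed
qed

lemma bilinear_coercive:
  fixes b :: "'v::euclidean_space \<Rightarrow> 'v \<Rightarrow> real"
  assumes b: "bilinear b" and S: "subspace S" and pos: "\<And>x. x \<in> S \<Longrightarrow> x \<noteq> 0 \<Longrightarrow> b x x > 0"
  shows "\<exists>c>0. \<forall>x\<in>S. c * (norm x)\<^sup>2 \<le> b x x"
proof (cases "S \<inter> sphere 0 1 = {}")
  case True
  have "x = 0" if "x \<in> S" for x
  proof (rule ccontr)
    assume "x \<noteq> 0"
    then have "x /\<^sub>R norm x \<in> S \<inter> sphere 0 1" using that S by (auto intro: subspace_scale)
    then show False using True by blast
  qed
  then have "\<forall>x\<in>S. 1 * (norm x)\<^sup>2 \<le> b x x" using bilinear_lzero[OF b] by fastforce
  then show ?thesis by (intro exI[of _ 1]) auto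
next
  case False
  interpret bounded_bilinear b using b by (simp add: bilinear_conv_bounded_bilinear)
  have K: "compact (S \<inter> sphere 0 1)" using S by (intro closed_Int_compact closed_subspace compact_sphere)
  have cont: "continuous_on (S \<inter> sphere 0 1) (\<lambda>x. b x x)" by (intro continuous_on continuous_on_id)
  obtain m where m: "m \<in> S \<inter> sphere 0 1" "\<And>x. x \<in> S \<inter> sphere 0 1 \<Longrightarrow> b m m \<le> b x x"
    using continuous_attains_inf[OF K False cont] by blast
  have "b m m * (norm x)\<^sup>2 \<le> b x x" if x: "x \<in> S" for x
  proof (cases "x = 0")
    case nz: False
    have "b m m \<le> b (x /\<^sub>R norm x) (x /\<^sub>R norm x)"
      using nz x S by (intro m(2)) (auto intro: subspace_scale)
    also have "\<dots> = b x x / (norm x)\<^sup>2" by (simp add: scaleR_left scaleR_right power2_eq_square field_simps)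
    finally show ?thesis using nz by (simp add: field_simps)
  qed (simp add: zero_left)
  moreover have "b m m > 0" using m(1) by (intro pos) auto
  ultimately show ?thesis by blast
qed

text \<open>
  The tangent vectors \<open>u \<and> x\<close> with u on one of the two null lines and x in the repelling space are
  contracted by the adjoint action, and \<open>g (u \<and> x) = u \<and> (a g x)\<close> when \<open>g u = a u\<close>.
\<close>

lemma eichler_contraction:
  fixes f g :: "'n::{finite,linorder} mat_nn" and N0 :: "'n mat_nn \<times> 'n mat_nn \<Rightarrow> real"
  assumes n: "null_pair ((*v) f ` base 1) W' p q" and u: "u = p \<or> u = q" and gu: "g *v u = a *\<^sub>R u"
    and gW': "(*v) g ` W' = W'"
    and N: "euclidean_norm_mod (lie_algebra SO0 \<times> lie_algebra SO0) (stab_algebra (f <#\<^bsub>SO0_group\<^esub> P_plus) \<times> T) N0"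
    and T: "0 \<in> lie_algebra (SO0 :: 'n mat_nn set)"
    and contr: "\<And>u x m. form u u = 0 \<Longrightarrow> form x x = 0 \<Longrightarrow> form u x = 0 \<Longrightarrow>
      N0 (eichler (((*v) g ^^ m) u) (((*v) g ^^ m) x), 0) \<le> K * r ^ m * N0 (eichler u x, 0)"
    and r: "0 \<le> r" "r < 1" and x: "x \<in> W'"
  shows "(\<lambda>m. a ^ m *\<^sub>R ((*v) g ^^ m) x) \<longlonglongrightarrow> 0"
proof -
  note d = null_pairD[OF n]
  let ?W = "(*v) f ` base 1"
  have u': "u \<in> perp ?W" "u \<in> perp W'" "form u u = 0" "u \<notin> ?W" using d u null_pair_notin[OF n] by auto
  obtain B where B: "bilinear B" and BN: "\<And>v. v \<in> lie_algebra SO0 \<times> lie_algebra SO0 \<Longrightarrow>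
      B v v \<ge> 0 \<and> (B v v = 0 \<longleftrightarrow> v \<in> stab_algebra (f <#\<^bsub>SO0_group\<^esub> P_plus) \<times> T) \<and> N0 v = sqrt (B v v)"
    using N unfolding euclidean_norm_mod_def by blast
  define b where "b x y = B (eichler u x, 0) (eichler u y, 0)" for x y
  have bil: "bilinear b"
  proof -
    have "linear (\<lambda>x. (eichler u x, 0 :: 'n mat_nn))"
      using eichler_linear[of u] by (auto intro!: linearI simp: linear_add linear_scale)
    from linear_compose[OF this] show ?thesis
      using B unfolding bilinear_def b_def o_def by blast
  qed
  have W'0: "form y y = 0" "form u y = 0" if "y \<in> W'" for y
    using isotropic_spacesD(4)[OF d(2)] perpD[OF u'(2)] that by auto
  have lie: "(eichler u y, 0 :: 'n mat_nn) \<in> lie_algebra SO0 \<times> lie_algebra SO0" if "y \<in> W'" for y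
    using eichler_lie_algebra[OF u'(3)] W'0[OF that] T by simp
  have pos: "b y y > 0" if y: "y \<in> W'" "y \<noteq> 0" for y
  proof -
    \<comment> \<open>Vanishing would make \<open>eichler u y\<close> preserve \<open>?W\<close>. As
      \<open>u\<close> is orthogonal to \<open>w \<in> ?W\<close>, the image of \<open>w\<close> is
      \<open>form y w\<close> times \<open>u\<close>; since \<open>u \<notin> ?W\<close>, this
      coefficient is 0, and \<open>y \<in> W'\<close> would be orthogonal to \<open>?W\<close>,
      against transversality.\<close>
    have "b y y \<noteq> 0"
    proof
      assume "b y y = 0"
      then have st: "eichler u y \<in> stab_algebra (f <#\<^bsub>SO0_group\<^esub> P_plus)" using BN[OF lie[OF y(1)]] by (simp add: b_def)
      have "form y w = 0" if w: "w \<in> ?W" for w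
      proof (rule ccontr)
        assume nz: "form y w \<noteq> 0"
        have "form y w *\<^sub>R u \<in> ?W"
          using stab_algebra_image[OF st w] perpD[OF u'(1) w] by simp
        then have "(1 / form y w) *\<^sub>R (form y w *\<^sub>R u) \<in> ?W"
          by (rule subspace_scale[OF isotropic_spacesD(1)[OF d(1)]])
        then show False using u'(4) nz by simp
      qed
      then have "y \<in> perp ?W" by (rule perpI)
      then show False using y transverse_commute[OF d(1-3)] by auto
    qed
    then show ?thesis using BN[OF lie[OF y(1)]] by (simp add: b_def less_le)
  qed
  obtain c where c: "c > 0" "\<And>y. y \<in> W' \<Longrightarrow> c * (norm y)\<^sup>2 \<le> b y y"
    using bilinear_coercive[OF bil isotropic_spacesD(1)[OF d(2)] pos] by blast
  let ?y = "\<lambda>m. a ^ m *\<^sub>R ((*v) g ^^ m) x"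
  have yW: "?y m \<in> W'" for m
    using funpow_image_invariant[OF gW', of m] x isotropic_spacesD(1)[OF d(2)] by (intro subspace_scale) auto
  have "norm (?y m) \<le> (K * N0 (eichler u x, 0) / sqrt c) * r ^ m" for m
  proof -
    have e: "eichler (((*v) g ^^ m) u) (((*v) g ^^ m) x) = eichler u (?y m)"
      by (simp add: funpow_eigen[where f = "(*v) g", OF _ gu] eichler_scaleR)
    have "sqrt c * norm (?y m) = sqrt (c * (norm (?y m))\<^sup>2)" by (simp add: real_sqrt_mult)
    also have "\<dots> \<le> sqrt (b (?y m) (?y m))" using c(2)[OF yW] by simp
    also have "\<dots> = N0 (eichler u (?y m), 0)" using BN[OF lie[OF yW]] by (simp add: b_def)
    also have "\<dots> \<le> K * r ^ m * N0 (eichler u x, 0)"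
      using contr[OF u'(3) W'0[OF x], of m] by (simp add: e)
    finally show ?thesis using c(1) by (simp add: field_simps)
  qed
  moreover have "(\<lambda>m. (K * N0 (eichler u x, 0) / sqrt c) * r ^ m) \<longlonglongrightarrow> 0"
    using r by (intro tendsto_mult_right_zero LIMSEQ_realpow_zero)
  ultimately show ?thesis by (intro Lim_null_comparison[of ?y]) auto
qed

section \<open>Limit spaces of Anosov representations\<close>

text \<open>All representatives of a coset yield the same subspace, so the union spares the choice
  of one.\<close>

definition coset_space :: "real \<Rightarrow> 'n::{finite,linorder} mat_nn set \<Rightarrow> 'n vec_nn set" where
  "coset_space s x = (\<Union>g\<in>x. (*v) g ` base s)"

lemma coset_space_l_coset:
  "coset_space s (f <#\<^bsub>SO0_group\<^esub> oriented_stab s) = (*v) f ` base s"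
proof
  show "coset_space s (f <#\<^bsub>SO0_group\<^esub> oriented_stab s) \<subseteq> (*v) f ` base s"
  proof
    fix x assume "x \<in> coset_space s (f <#\<^bsub>SO0_group\<^esub> oriented_stab s)"
    then obtain h y where h: "h \<in> oriented_stab s" and y: "y \<in> base s" "x = (f ** h) *v y"
      by (auto simp: coset_space_def l_coset_SO0)
    have "h *v y \<in> base s" using oriented_stab_image(2)[OF h] y(1) by blast
    then show "x \<in> (*v) f ` base s" by (simp add: y(2) matrix_vector_mul_assoc[symmetric])
  qed
  show "(*v) f ` base s \<subseteq> coset_space s (f <#\<^bsub>SO0_group\<^esub> oriented_stab s)"
    unfolding coset_space_def l_coset_SO0 using oriented_stab_one[of s] by force
qed

lemma loxodromic_rescale:
  assumes g: "loxodromic g W W' p q a" and n: "null_pair W W' p q" and n': "null_pair W W' p' q'"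
  shows "loxodromic g W W' p' q' a"
proof -
  note d' = null_pairD[OF n']
  obtain c where c: "p' = c *\<^sub>R p" using null_pair_ruling(1)[OF n d'(4,5,8,11,13)] by blast
  obtain d where d: "q' = d *\<^sub>R q" using null_pair_ruling(2)[OF n d'(6,7,9,12,14)] by blast
  have "g *v p' = a *\<^sub>R p'" "g *v q' = (1 / a) *\<^sub>R q'"
    using g by (simp_all add: loxodromic_def c d linear_scale)
  then show ?thesis using g d' unfolding loxodromic_def by blast
qed

text \<open>The orbit under the power is a subsequence. Together with uniqueness of attractors this
  shows that an element and its powers have the same limit spaces, without comparing their boundary
  points.\<close>

lemma attracting_fixed_point_mat_pow:
  fixes g :: "'n::finite mat_nn"
  assumes g: "attracting_fixed_point g W" and k: "k > 0"
  shows "attracting_fixed_point (mat_pow g k) W"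
proof -
  obtain e where W: "W \<in> isotropic_spaces" "(*v) g ` W = W" and e: "e > 0"
    "\<And>V. V \<in> isotropic_spaces \<Longrightarrow> gap V W < e \<Longrightarrow> (\<lambda>m. gap (((\<lambda>V. (*v) g ` V) ^^ m) V) W) \<longlonglongrightarrow> 0"
    using g unfolding attracting_fixed_point_def by blast
  have mp: "(*v) (mat_pow g k) = (*v) g ^^ k" by (simp add: fun_eq_iff mat_pow_vec)
  have sm: "strict_mono (\<lambda>m. k * m)" using k by (simp add: strict_mono_def)
  have "(\<lambda>m. gap (((\<lambda>V. (*v) (mat_pow g k) ` V) ^^ m) V) W) \<longlonglongrightarrow> 0"
    if V: "V \<in> isotropic_spaces" "gap V W < e" for V
    using LIMSEQ_subseq_LIMSEQ[OF e(2)[OF V] sm] by (simp add: mp funpow_image o_def funpow_mult)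
  then show ?thesis
    unfolding attracting_fixed_point_def using W e(1) funpow_image_invariant[OF W(2), of k]
    by (auto simp: mp)
qed

locale anosov_limit =
  fixes G :: "('a, 'b) monoid_scheme" (structure)
    and S :: "'a set"
    and act :: "'a \<Rightarrow> 'a flowpoint \<Rightarrow> 'a flowpoint"
    and \<rho> :: "'a \<Rightarrow> 'n::{finite,linorder} mat_nn"
    and \<xi>p \<xi>m :: "'a bdpoint \<Rightarrow> 'n mat_nn set"
    and N :: "'a flowpoint \<Rightarrow> 'n mat_nn \<times> 'n mat_nn \<Rightarrow> real"
    and C c :: real
  assumes group: "group G"
    and action: "gromov_action G S act"
    and ev: "even CARD('n)"
    and hom: "\<rho> \<in> hom G SO0_group"
    and equivariant_p: "\<And>g a. g \<in> carrier G \<Longrightarrow> a \<in> boundary G S \<Longrightarrow> \<xi>p (bd_act G g a) = \<rho> g <#\<^bsub>SO0_group\<^esub> \<xi>p a"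
    and equivariant_m: "\<And>g a. g \<in> carrier G \<Longrightarrow> a \<in> boundary G S \<Longrightarrow> \<xi>m (bd_act G g a) = \<rho> g <#\<^bsub>SO0_group\<^esub> \<xi>m a"
    and X: "\<And>p q t. (p, q, t) \<in> flow_space G S \<Longrightarrow> (\<xi>p p, \<xi>m q) \<in> X_space"
    and c_pos: "c > 0"
    and norm: "\<And>p q t. (p, q, t) \<in> flow_space G S \<Longrightarrow>
      euclidean_norm_mod (lie_algebra SO0 \<times> lie_algebra SO0)
        (stab_algebra (\<xi>p p) \<times> stab_algebra (\<xi>m q)) (N (p, q, t))"
    and N_equivariant: "\<And>g z Z Y. g \<in> carrier G \<Longrightarrow> z \<in> flow_space G S \<Longrightarrow> Z \<in> lie_algebra SO0 \<Longrightarrow>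
      Y \<in> lie_algebra SO0 \<Longrightarrow> N (act g z) (Ad (\<rho> g) Z, Ad (\<rho> g) Y) = N z (Z, Y)"
    and contraction: "\<And>z t Z. z \<in> flow_space G S \<Longrightarrow> t \<ge> 0 \<Longrightarrow> Z \<in> lie_algebra SO0 \<Longrightarrow>
      N (flow (- t) z) (Z, 0) \<le> C * exp (- c * t) * N z (Z, 0)"
begin

interpretation group G by (rule group)

abbreviation "attr \<equiv> bd_attr G S"
abbreviation "rep \<equiv> bd_rep G S"
abbreviation "iord \<equiv> infinite_order G"
abbreviation "LS \<equiv> limit_space G S \<rho>"

lemma rho_SO0: "g \<in> carrier G \<Longrightarrow> \<rho> g \<in> SO0"
  using hom by (auto simp: hom_def SO0_group_def)

lemma rho_mult: "g \<in> carrier G \<Longrightarrow> h \<in> carrier G \<Longrightarrow> \<rho> (g \<otimes> h) = \<rho> g ** \<rho> h"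
  using hom by (auto simp: hom_def SO0_group_def)

lemma rho_one: "\<rho> \<one> = mat 1"
proof -
  have "\<rho> \<one> ** \<rho> \<one> = \<rho> \<one>" using rho_mult[of \<one> \<one>] by simp
  then have "matrix_inv (\<rho> \<one>) ** (\<rho> \<one> ** \<rho> \<one>) = matrix_inv (\<rho> \<one>) ** \<rho> \<one>" by simp
  then show ?thesis
    using matrix_inv_SO_nn(2)[OF SO0_subset[OF rho_SO0[OF one_closed]]] by (simp add: matrix_mul_assoc)
qed

lemma rho_inv:
  assumes "g \<in> carrier G"
  shows "\<rho> g ** \<rho> (inv g) = mat 1" "\<rho> (inv g) ** \<rho> g = mat 1" "\<rho> (inv g) = matrix_inv (\<rho> g)"
proof -
  show 1: "\<rho> g ** \<rho> (inv g) = mat 1" "\<rho> (inv g) ** \<rho> g = mat 1"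
    using assms by (simp_all add: rho_mult[symmetric] rho_one)
  have "matrix_inv (\<rho> g) ** (\<rho> g ** \<rho> (inv g)) = matrix_inv (\<rho> g)" by (simp add: 1)
  then show "\<rho> (inv g) = matrix_inv (\<rho> g)"
    using matrix_inv_SO_nn(2)[OF SO0_subset[OF rho_SO0[OF assms]]] by (simp add: matrix_mul_assoc)
qed

lemma rho_pow: "g \<in> carrier G \<Longrightarrow> \<rho> (g [^] (k::nat)) = mat_pow (\<rho> g) k"
proof (induction k)
  case (Suc k)
  then show ?case using nat_pow_Suc2[of g k] by (simp add: rho_mult)
qed (simp add: rho_one)

lemma iord_carrier: "iord g \<Longrightarrow> g \<in> carrier G"
  by (simp add: infinite_order_def)

lemma iord_inv: "iord g \<Longrightarrow> iord (inv g)"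
  by (simp add: infinite_order_def)

lemma iord_pow:
  assumes "iord g" "k > 0"
  shows "iord (g [^] (k::nat))"
proof -
  have g: "g \<in> carrier G" "ord g = 0" using assms(1) by (auto simp: infinite_order_def)
  have "ord (g [^] k) = 0"
  proof (subst ord_eq_0, goal_cases)
    case 2
    show ?case
    proof (intro allI impI)
      fix n :: nat assume "n \<noteq> 0"
      then have "g [^] (k * n) \<noteq> \<one>" using g assms(2) by (simp add: pow_eq_id)
      then show "(g [^] k) [^] n \<noteq> \<one>" using g by (simp add: nat_pow_pow)
    qed
  qed (use g in simp)
  then show ?thesis using g by (simp add: infinite_order_def)
qed

lemma attr_inv: "attr (inv g) = rep g"
  by (simp add: bd_attr_def bd_rep_def)

lemma rep_inv: "g \<in> carrier G \<Longrightarrow> rep (inv g) = attr g"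
  by (simp add: bd_attr_def bd_rep_def)

text \<open>
  The map \<open>act h\<close> is undefined outside the flow space, whereas it translates the axis of h
  non-trivially; so the axis lies in the flow space.
\<close>

lemma axis:
  assumes h: "iord h"
  shows "(attr h, rep h, t) \<in> flow_space G S"
    and "\<exists>l>0. \<forall>t. act h (attr h, rep h, t) = (attr h, rep h, t + l)"
    and "bd_act G h (attr h) = attr h" "bd_act G h (rep h) = rep h"
proof -
  have "\<forall>g. iord g \<longrightarrow> (\<exists>l>0. \<forall>t. act g (attr g, rep g, t) = flow l (attr g, rep g, t))"
    using action unfolding gromov_action_def by (elim conjE)
  then obtain l where l: "l > 0" "\<And>t. act h (attr h, rep h, t) = flow l (attr h, rep h, t)"
    using h by blast
  then have l': "act h (attr h, rep h, t) = (attr h, rep h, t + l)" for t by (simp add: flow_def)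
  then show "\<exists>l>0. \<forall>t. act h (attr h, rep h, t) = (attr h, rep h, t + l)" using l(1) by blast
  have "group_action G (flow_space G S) act" using action by (simp add: gromov_action_def)
  then have "act \<in> hom G (BijGroup (flow_space G S))"
    by (simp add: group_action_def group_hom_def group_hom_axioms_def)
  then have "act h \<in> carrier (BijGroup (flow_space G S))" using iord_carrier[OF h] by (auto simp: hom_def)
  then have ext: "act h \<in> extensional (flow_space G S)" by (simp add: BijGroup_def Bij_def)
  have ax: "(attr h, rep h, t) \<in> flow_space G S" for t
  proof (rule ccontr)
    assume "(attr h, rep h, t) \<notin> flow_space G S"
    then have "(attr h, rep h, s) \<notin> flow_space G S" for s by (simp add: flow_space_def)
    then have "act h (attr h, rep h, s) = undefined" for s using ext by (simp add: extensional_def)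
    then have "act h (attr h, rep h, 0) = act h (attr h, rep h, 1)" by simp
    then show False unfolding l' by simp
  qed
  then show "(attr h, rep h, t) \<in> flow_space G S" .
  have "\<forall>g\<in>carrier G. \<forall>p q t. (p, q, t) \<in> flow_space G S \<longrightarrow> (\<exists>t'. act g (p, q, t) = (bd_act G g p, bd_act G g q, t'))"
    using action unfolding gromov_action_def by (elim conjE)
  then obtain t' where "act h (attr h, rep h, 0) = (bd_act G h (attr h), bd_act G h (rep h), t')"
    using ax[of 0] iord_carrier[OF h] by blast
  then show "bd_act G h (attr h) = attr h" "bd_act G h (rep h) = rep h" unfolding l' by simp_all
qed

lemma axis_distinct:
  assumes "iord h"
  shows "attr h \<in> boundary G S" "rep h \<in> boundary G S" "attr h \<noteq> rep h"
  using axis(1)[OF assms, of 0] by (auto simp: flow_space_def)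

lemma zero_lie_algebra: "0 \<in> lie_algebra (SO0 :: 'n mat_nn set)"
proof -
  have "eichler 0 0 = (0 :: 'n mat_nn)" by (simp add: matrix_eq)
  then show ?thesis using eichler_lie_algebra[of "0 :: 'n vec_nn" 0] by simp
qed

text \<open>On its own axis \<open>h\<close> acts as the flow by \<open>l\<close>. Equivariance
  therefore trades the \<open>m\<close>-th iterate at time 0 for the original vector at time
  \<open>- (m * l)\<close>, where the Anosov estimate supplies the factor
  \<open>exp (- c * l) ^ m\<close>.\<close>

lemma axis_contraction:
  assumes h: "iord h"
  shows "\<exists>r. 0 \<le> r \<and> r < 1 \<and> (\<forall>u x m. form u u = 0 \<longrightarrow> form x x = 0 \<longrightarrow> form u x = 0 \<longrightarrow>
    N (attr h, rep h, 0) (eichler (((*v) (\<rho> h) ^^ m) u) (((*v) (\<rho> h) ^^ m) x), 0)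
      \<le> C * r ^ m * N (attr h, rep h, 0) (eichler u x, 0))"
proof -
  let ?g = "\<rho> h"
  obtain l where l: "l > 0" "\<And>t. act h (attr h, rep h, t) = (attr h, rep h, t + l)"
    using axis(2)[OF h] by blast
  note hc = iord_carrier[OF h] and gS = rho_SO0[OF iord_carrier[OF h]]
  have fp: "form (((*v) ?g ^^ m) v) (((*v) ?g ^^ m) w) = form v w" for m v w
    by (rule form_preserving_funpow[OF SO0_form[OF gS]])
  have Ad0: "Ad ?g 0 = 0" by (simp add: Ad_def)
  have step: "N (attr h, rep h, t + real m * l) (eichler (((*v) ?g ^^ m) u) (((*v) ?g ^^ m) x), 0)
      = N (attr h, rep h, t) (eichler u x, 0)"
    if "form u u = 0" "form x x = 0" "form u x = 0" for t m u x
  proof (induction m)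
    case (Suc m)
    let ?u = "((*v) ?g ^^ m) u" and ?x = "((*v) ?g ^^ m) x"
    have "eichler ?u ?x \<in> lie_algebra SO0" using that by (intro eichler_lie_algebra) (simp_all add: fp)
    from N_equivariant[OF hc axis(1)[OF h, of "t + real m * l"] this zero_lie_algebra]
    have "N (attr h, rep h, t + real m * l + l) (eichler (?g *v ?u) (?g *v ?x), 0)
        = N (attr h, rep h, t + real m * l) (eichler ?u ?x, 0)"
      by (simp add: l(2) Ad0 Ad_eichler[OF gS])
    then show ?case using Suc by (simp add: algebra_simps)
  qed simp
  let ?r = "exp (- c * l)"
  have "N (attr h, rep h, 0) (eichler (((*v) ?g ^^ m) u) (((*v) ?g ^^ m) x), 0)
      \<le> C * ?r ^ m * N (attr h, rep h, 0) (eichler u x, 0)"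
    if ux: "form u u = 0" "form x x = 0" "form u x = 0" for m u x
  proof -
    have "N (attr h, rep h, 0) (eichler (((*v) ?g ^^ m) u) (((*v) ?g ^^ m) x), 0)
        = N (attr h, rep h, - (real m * l)) (eichler u x, 0)"
      using step[OF ux, of "- (real m * l)" m] by simp
    also have "\<dots> \<le> C * exp (- c * (real m * l)) * N (attr h, rep h, 0) (eichler u x, 0)"
      using contraction[OF axis(1)[OF h, of 0], of "real m * l" "eichler u x"] l(1) eichler_lie_algebra[OF ux]
      by (simp add: flow_def)
    also have "exp (- c * (real m * l)) = ?r ^ m"
      by (simp add: exp_of_nat_mult[symmetric] mult_ac)
    finally show ?thesis .
  qed
  moreover have "?r < 1" using c_pos l(1) by simp
  ultimately show ?thesis by (intro exI[of _ ?r]) simp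
qed

lemma flow_space_frame:
  assumes "(p, q, t) \<in> flow_space G S"
  shows "\<exists>f\<in>SO0. \<xi>p p = f <#\<^bsub>SO0_group\<^esub> P_plus \<and> \<xi>m q = f <#\<^bsub>SO0_group\<^esub> P_minus"
  using X[OF assms] by (auto simp: X_space_def)

lemma loxodromic_axis:
  assumes h: "iord h"
  shows "\<exists>p q a. loxodromic (\<rho> h) (coset_space 1 (\<xi>p (attr h))) (coset_space (-1) (\<xi>m (rep h))) p q a \<and>
    null_pair (coset_space 1 (\<xi>p (attr h))) (coset_space (-1) (\<xi>m (rep h))) p q"
proof -
  let ?g = "\<rho> h"
  note hc = iord_carrier[OF h] and gS = rho_SO0[OF iord_carrier[OF h]]
  obtain f where f: "f \<in> SO0" "\<xi>p (attr h) = f <#\<^bsub>SO0_group\<^esub> P_plus" "\<xi>m (rep h) = f <#\<^bsub>SO0_group\<^esub> P_minus"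
    using flow_space_frame[OF axis(1)[OF h]] by blast
  let ?W = "(*v) f ` base 1" and ?W' = "(*v) f ` base (-1)"
  let ?p = "f *v frame 1 last_index" and ?q = "f *v frame (-1) last_index"
  have n: "null_pair ?W ?W' ?p ?q" by (rule frame_null_pair(1)[OF f(1) ev])
  note d = null_pairD[OF n]
  have gW: "(*v) ?g ` ?W = ?W"
    using equivariant_p[OF hc axis_distinct(1)[OF h]] unfolding axis(3)[OF h] f(2)
    by (intro coset_fixed_image) simp
  have gW': "(*v) ?g ` ?W' = ?W'"
    using equivariant_m[OF hc axis_distinct(2)[OF h]] unfolding axis(4)[OF h] f(3)
    by (intro coset_fixed_image) simp
  note gf = SO0_form[OF gS]
  have img: "?g *v x \<in> perp ?W" "?g *v x \<in> perp ?W'" if "x \<in> perp ?W" "x \<in> perp ?W'" for x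
    using perp_image[OF gf, of ?W] perp_image[OF gf, of ?W'] gW gW' that by auto
  have nz: "?g *v x \<noteq> 0" if "x \<noteq> 0" for x
    using form_preserving_inj[OF gf] that by (metis injD matrix_vector_mult_0_right)
  have sp: "span (insert (?g *v x) ?W) = (*v) ?g ` span (insert x ?W)" for x
  proof -
    have "(*v) ?g ` span (insert x ?W) = span (insert (?g *v x) ((*v) ?g ` ?W))"
      by (simp only: linear_span_image[OF matrix_vector_mul_linear, symmetric] image_insert)
    then show ?thesis by (simp only: gW)
  qed
  \<comment> \<open>\<open>?g\<close> permutes the two null lines of the invariant plane; as it
    preserves rulings and the subspace \<open>?W\<close>, it fixes each of them.\<close>
  have "ruling 1 (span (insert (?g *v ?p) ?W))"
    unfolding sp by (rule SO0_ruling[OF d(13) span_insert_null[OF d(1,4,8)] gS])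
  then obtain a where a: "a \<noteq> 0" "?g *v ?p = a *\<^sub>R ?p"
    using null_pair_ruling(1)[OF n img[OF d(4,5)]] gf d(8) nz[OF d(11)] by auto
  have "ruling (-1) (span (insert (?g *v ?q) ?W))"
    unfolding sp by (rule SO0_ruling[OF d(14) span_insert_null[OF d(1,6,9)] gS])
  then obtain b where b: "?g *v ?q = b *\<^sub>R ?q"
    using null_pair_ruling(2)[OF n img[OF d(6,7)]] gf d(9) nz[OF d(12)] by auto
  have "b * (a * form ?p ?q) = form ?p ?q"
    using gf[of ?p ?q] unfolding a(2) b form_scaleR_left form_scaleR_right .
  then have "(b * a) * form ?p ?q = 1 * form ?p ?q" by (simp only: mult.assoc mult_1_left)
  then have "b * a = 1" by (simp only: mult_right_cancel[OF d(10)])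
  then have "b = 1 / a" using a(1) by (metis nonzero_eq_divide_eq)
  then have gq: "?g *v ?q = (1 / a) *\<^sub>R ?q" using b by simp
  obtain r where r: "0 \<le> r" "r < 1" and contr: "\<And>u x m. form u u = 0 \<Longrightarrow> form x x = 0 \<Longrightarrow> form u x = 0 \<Longrightarrow>
    N (attr h, rep h, 0) (eichler (((*v) ?g ^^ m) u) (((*v) ?g ^^ m) x), 0)
      \<le> C * r ^ m * N (attr h, rep h, 0) (eichler u x, 0)"
    using axis_contraction[OF h] by blast
  note norm' = norm[OF axis(1)[OF h, of 0], unfolded f(2)]
  \<comment> \<open>Taking \<open>u\<close> on either null line gives both decay statements:
    \<open>?p\<close> contributes the factor \<open>a\<close>, and \<open>?q\<close> the factor
    \<open>1 / a\<close>.\<close>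
  have "(\<lambda>m. a ^ m *\<^sub>R ((*v) ?g ^^ m) x) \<longlonglongrightarrow> 0" if "x \<in> ?W'" for x
    by (rule eichler_contraction[OF n disjI1[OF refl] a(2) gW' norm' zero_lie_algebra contr r that])
  moreover have "(\<lambda>m. (1 / a) ^ m *\<^sub>R ((*v) ?g ^^ m) x) \<longlonglongrightarrow> 0" if "x \<in> ?W'" for x
    by (rule eichler_contraction[OF n disjI2[OF refl] gq gW' norm' zero_lie_algebra contr r that])
  ultimately have "loxodromic ?g ?W ?W' ?p ?q a"
    unfolding loxodromic_def using gf d gW gW' a gq by blast
  with n show ?thesis unfolding f(2,3) coset_space_l_coset by blast
qed

section \<open>Identification of the limit spaces with the boundary maps\<close>

lemma attracting_axis:
  assumes "iord h"
  shows "attracting_fixed_point (\<rho> h) (coset_space 1 (\<xi>p (attr h)))"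
  using loxodromic_axis[OF assms] lox.attracting[OF lox.intro] by blast

lemma attracting_unique_axis:
  assumes "iord h" "attracting_fixed_point (\<rho> h) U"
  shows "U = coset_space 1 (\<xi>p (attr h))"
  using loxodromic_axis[OF assms(1)] lox.attracting_unique[OF lox.intro] assms(2) by blast

text \<open>The candidate depends on the boundary point only, through \<open>\<xi>p\<close>, so it
  serves every element that attracts or repels there; and \<open>h\<close> itself has no other
  attracting fixed point.\<close>

lemma limit_space_attr:
  assumes h: "iord h"
  shows "LS (attr h) = coset_space 1 (\<xi>p (attr h))"
  unfolding limit_space_def
proof (rule the_equality)
  show "\<forall>g. iord g \<longrightarrow> (attr g = attr h \<longrightarrow> attracting_fixed_point (\<rho> g) (coset_space 1 (\<xi>p (attr h)))) \<and>
    (rep g = attr h \<longrightarrow> repelling_fixed_point (\<rho> g) (coset_space 1 (\<xi>p (attr h))))"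
  proof (intro allI impI conjI)
    fix g assume g: "iord g"
    show "attracting_fixed_point (\<rho> g) (coset_space 1 (\<xi>p (attr h)))" if "attr g = attr h"
      using attracting_axis[OF g] that by simp
    show "repelling_fixed_point (\<rho> g) (coset_space 1 (\<xi>p (attr h)))" if "rep g = attr h"
      using attracting_axis[OF iord_inv[OF g]] that rho_inv(3)[OF iord_carrier[OF g]]
      by (simp add: attr_inv repelling_fixed_point_def)
  qed
  show "W = coset_space 1 (\<xi>p (attr h))"
    if "\<forall>g. iord g \<longrightarrow> (attr g = attr h \<longrightarrow> attracting_fixed_point (\<rho> g) W) \<and>
      (rep g = attr h \<longrightarrow> repelling_fixed_point (\<rho> g) W)" for W
    using that h by (intro attracting_unique_axis) auto
qed

text \<open>For the inverse of \<open>h\<close>, the map \<open>\<xi>m\<close> gives the repelling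
  space at this point, which is attracting for \<open>h\<close>; uniqueness identifies it with the
  space from \<open>\<xi>p\<close>. Points of \<open>X_space\<close> combine \<open>\<xi>p\<close>
  at one boundary point with \<open>\<xi>m\<close> at another, so limit spaces have to be known
  through both maps.\<close>

lemma limit_space_attr_m:
  assumes h: "iord h"
  shows "LS (attr h) = coset_space (-1) (\<xi>m (attr h))"
proof -
  note hc = iord_carrier[OF h]
  obtain p q a where "loxodromic (\<rho> (inv h)) (coset_space 1 (\<xi>p (rep h))) (coset_space (-1) (\<xi>m (attr h))) p q a"
    using loxodromic_axis[OF iord_inv[OF h]] unfolding attr_inv rep_inv[OF hc] by blast
  from lox.inverse[OF lox.intro[OF this] rho_inv(1,2)[OF hc]]
  have "loxodromic (\<rho> h) (coset_space (-1) (\<xi>m (attr h))) (coset_space 1 (\<xi>p (rep h))) p q (1 / a)" .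
  then have "attracting_fixed_point (\<rho> h) (coset_space (-1) (\<xi>m (attr h)))"
    using lox.attracting[OF lox.intro] by blast
  from attracting_unique_axis[OF h this] show ?thesis using limit_space_attr[OF h] by simp
qed

lemma limit_space_rep:
  assumes h: "iord h"
  shows "LS (rep h) = coset_space 1 (\<xi>p (rep h))" "LS (rep h) = coset_space (-1) (\<xi>m (rep h))"
  using limit_space_attr[OF iord_inv[OF h]] limit_space_attr_m[OF iord_inv[OF h]] by (simp_all add: attr_inv)

section \<open>Null pairs and eigenvalues attached to limit points\<close>

definition limit_point :: "'a bdpoint \<Rightarrow> bool" where
  "limit_point a \<longleftrightarrow> (\<exists>h. iord h \<and> a = attr h)"

lemma limit_point_attr: "iord h \<Longrightarrow> limit_point (attr h)"
  and limit_point_rep: "iord h \<Longrightarrow> limit_point (rep h)"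
  unfolding limit_point_def by (auto simp: attr_inv[symmetric] intro: iord_inv)

lemma opposite_limit_space:
  assumes "limit_point a" "limit_point b" "a \<noteq> b"
  shows "opposite (LS a) (LS b)"
proof -
  have LS: "x \<in> boundary G S \<and> LS x = coset_space 1 (\<xi>p x) \<and> LS x = coset_space (-1) (\<xi>m x)" if "limit_point x" for x
    using that axis_distinct(1) limit_space_attr limit_space_attr_m unfolding limit_point_def by metis
  have "(a, b, 0) \<in> flow_space G S" using LS[OF assms(1)] LS[OF assms(2)] assms(3) by (simp add: flow_space_def)
  from flow_space_frame[OF this] obtain f where f: "f \<in> SO0" "\<xi>p a = f <#\<^bsub>SO0_group\<^esub> P_plus" "\<xi>m b = f <#\<^bsub>SO0_group\<^esub> P_minus"
    by blast
  have "LS a = (*v) f ` base 1" using LS[OF assms(1)] unfolding f(2) coset_space_l_coset by simp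
  moreover have "LS b = (*v) f ` base (-1)" using conjunct2[OF conjunct2[OF LS[OF assms(2)]]] unfolding f(3) coset_space_l_coset .
  ultimately show ?thesis unfolding opposite_def using f(1) by blast
qed

lemma null_pair_limit_space:
  assumes "limit_point a" "limit_point b" "a \<noteq> b"
  shows "null_pair (LS a) (LS b) (v_plus (LS a) (LS b)) (v_minus (LS a) (LS b))"
  by (rule v_plus_minus_null_pair[OF opposite_limit_space[OF assms] ev])

lemma lambda_eq:
  assumes "iord h" and g: "\<rho> h *v v_plus (LS (attr h)) (LS (rep h)) = a *\<^sub>R v_plus (LS (attr h)) (LS (rep h))"
  shows "lambda G S \<rho> h = a"
proof -
  let ?v = "v_plus (LS (attr h)) (LS (rep h))"
  have "?v \<noteq> 0"
    using null_pairD(11)[OF null_pair_limit_space[OF limit_point_attr limit_point_rep]] assms(1) axis_distinct(3) by blast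
  then have "(THE \<mu>. \<rho> h *v ?v = \<mu> *\<^sub>R ?v) = a" unfolding g by (intro the_equality) auto
  then show ?thesis by (simp add: lambda_def Let_def)
qed

text \<open>\<open>lambda\<close> refers to one chosen null vector; null pairs of the same subspaces
  differ by scalars, so the eigenvalue is the same for each of them.\<close>

lemma loxodromic_limit_space:
  assumes h: "iord h" and n: "null_pair (LS (attr h)) (LS (rep h)) p q"
  shows "loxodromic (\<rho> h) (LS (attr h)) (LS (rep h)) p q (lambda G S \<rho> h)"
proof -
  obtain p' q' a where l: "loxodromic (\<rho> h) (LS (attr h)) (LS (rep h)) p' q' a"
    and n': "null_pair (LS (attr h)) (LS (rep h)) p' q'"
    using loxodromic_axis[OF h] unfolding limit_space_attr[OF h, symmetric] limit_space_rep(2)[OF h, symmetric] by blast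
  have "loxodromic (\<rho> h) (LS (attr h)) (LS (rep h)) (v_plus (LS (attr h)) (LS (rep h))) (v_minus (LS (attr h)) (LS (rep h))) a"
    by (rule loxodromic_rescale[OF l n' null_pair_limit_space[OF limit_point_attr[OF h] limit_point_rep[OF h] axis_distinct(3)[OF h]]])
  then have "lambda G S \<rho> h = a" by (intro lambda_eq[OF h]) (simp add: loxodromic_def)
  then show ?thesis using loxodromic_rescale[OF l n' n] by simp
qed

lemma limit_space_pow:
  assumes h: "iord h" and k: "k > 0"
  shows "LS (attr (h [^] (k::nat))) = LS (attr h)" "LS (rep (h [^] k)) = LS (rep h)"
proof -
  have *: "LS (attr (g [^] k)) = LS (attr g)" if g: "iord g" for g
  proof -
    have "attracting_fixed_point (\<rho> (g [^] k)) (LS (attr g))"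
      unfolding rho_pow[OF iord_carrier[OF g]] limit_space_attr[OF g]
      by (rule attracting_fixed_point_mat_pow[OF attracting_axis[OF g] k])
    from attracting_unique_axis[OF iord_pow[OF g k] this] show ?thesis
      using limit_space_attr[OF iord_pow[OF g k]] by simp
  qed
  show "LS (attr (h [^] k)) = LS (attr h)" by (rule *[OF h])
  have "rep (h [^] k) = attr (inv h [^] k)"
    using iord_carrier[OF h] by (simp add: attr_inv[symmetric] nat_pow_inv)
  then show "LS (rep (h [^] k)) = LS (rep h)" using *[OF iord_inv[OF h]] by (simp add: attr_inv)
qed

lemma lambda_pow:
  assumes h: "iord h" and k: "k > 0"
  shows "lambda G S \<rho> (h [^] (k::nat)) = lambda G S \<rho> h ^ k"
proof (rule lambda_eq[OF iord_pow[OF h k]])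
  have "loxodromic (\<rho> h) (LS (attr h)) (LS (rep h)) (v_plus (LS (attr h)) (LS (rep h)))
    (v_minus (LS (attr h)) (LS (rep h))) (lambda G S \<rho> h)"
    by (intro loxodromic_limit_space h null_pair_limit_space limit_point_attr limit_point_rep axis_distinct)
  then have "\<rho> h *v v_plus (LS (attr h)) (LS (rep h)) = lambda G S \<rho> h *\<^sub>R v_plus (LS (attr h)) (LS (rep h))"
    by (simp add: loxodromic_def)
  then show "\<rho> (h [^] k) *v v_plus (LS (attr (h [^] k))) (LS (rep (h [^] k))) =
      lambda G S \<rho> h ^ k *\<^sub>R v_plus (LS (attr (h [^] k))) (LS (rep (h [^] k)))"
    unfolding limit_space_pow[OF h k] rho_pow[OF iord_carrier[OF h]] by (rule mat_pow_eigen)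
qed

text \<open>The representatives of the null lines cancel in every quotient, so no sign is lost, and
  squaring is left to the end.\<close>

theorem lambda_product_limit:
  assumes \<gamma>: "iord \<gamma>" and \<eta>: "iord \<eta>" and dist: "distinct [attr \<gamma>, rep \<gamma>, attr \<eta>, rep \<eta>]"
    and k: "strict_mono k" and iord: "\<And>i::nat. iord (\<gamma> [^] (k i::nat) \<otimes> \<eta> [^] k i)"
  shows "(\<lambda>i. lambda G S \<rho> (\<gamma> [^] k i \<otimes> \<eta> [^] k i) /
      (lambda G S \<rho> (\<gamma> [^] k i) * lambda G S \<rho> (\<eta> [^] k i)))
    \<longlonglongrightarrow> theta G S \<rho> (rep \<eta>) (rep \<gamma>) (attr \<gamma>) (attr \<eta>)"
proof -
  let ?W1 = "LS (rep \<eta>)" and ?W2 = "LS (rep \<gamma>)" and ?W3 = "LS (attr \<gamma>)" and ?W4 = "LS (attr \<eta>)"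
  note pts = limit_point_attr[OF \<gamma>] limit_point_rep[OF \<gamma>] limit_point_attr[OF \<eta>] limit_point_rep[OF \<eta>]
  note \<gamma>c = iord_carrier[OF \<gamma>] and \<eta>c = iord_carrier[OF \<eta>]
  have n13: "null_pair ?W1 ?W3 (v_plus ?W1 ?W3) (v_minus ?W1 ?W3)"
    and n24: "null_pair ?W2 ?W4 (v_plus ?W2 ?W4) (v_minus ?W2 ?W4)"
    and n23: "null_pair ?W2 ?W3 (v_plus ?W2 ?W3) (v_minus ?W2 ?W3)"
    and n14: "null_pair ?W1 ?W4 (v_plus ?W1 ?W4) (v_minus ?W1 ?W4)"
    using dist by (intro null_pair_limit_space pts; auto)+
  let ?gi = "\<lambda>i. \<gamma> [^] k i \<otimes> \<eta> [^] k i"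
  have nU: "null_pair (LS (attr (?gi i))) (LS (rep (?gi i)))
      (v_plus (LS (attr (?gi i))) (LS (rep (?gi i)))) (v_minus (LS (attr (?gi i))) (LS (rep (?gi i))))" for i
    by (intro null_pair_limit_space limit_point_attr limit_point_rep iord axis_distinct)
  have rho: "\<rho> (?gi i) = mat_pow (\<rho> \<gamma>) (k i) ** mat_pow (\<rho> \<eta>) (k i)" for i
    using \<gamma>c \<eta>c by (simp add: rho_mult rho_pow)
  have lim: "(\<lambda>i. lambda G S \<rho> (?gi i) / (lambda G S \<rho> \<gamma> ^ k i * lambda G S \<rho> \<eta> ^ k i))
    \<longlonglongrightarrow> theta G S \<rho> (rep \<eta>) (rep \<gamma>) (attr \<gamma>) (attr \<eta>)"
    unfolding theta_def crossratio_def
    by (rule eigenvalue_crossratio_limit[OF rho_SO0[OF \<gamma>c] rho_SO0[OF \<eta>c]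
          rho_inv(1,2)[OF \<gamma>c] rho_inv(1,2)[OF \<eta>c]
          loxodromic_limit_space[OF \<gamma> null_pair_commute[OF n23]]
          loxodromic_limit_space[OF \<eta> null_pair_commute[OF n14]]
          n13 n24 n23 n14 k loxodromic_limit_space[OF iord nU, unfolded rho] nU])
  \<comment> \<open>\<open>k 0\<close> may be 0, and the power is then the identity, which has no
    infinite order; hence the restriction to \<open>i \<ge> 1\<close>.\<close>
  have kpos: "k i > 0" if "i \<ge> 1" for i using seq_suble[OF k, of i] that by linarith
  have "\<forall>\<^sub>F i in sequentially. lambda G S \<rho> (?gi i) / (lambda G S \<rho> \<gamma> ^ k i * lambda G S \<rho> \<eta> ^ k i) =
      lambda G S \<rho> (?gi i) / (lambda G S \<rho> (\<gamma> [^] k i) * lambda G S \<rho> (\<eta> [^] k i))"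
    by (rule eventually_mono[OF eventually_ge_at_top[of 1]]) (simp add: lambda_pow[OF \<gamma> kpos] lambda_pow[OF \<eta> kpos])
  from Lim_transform_eventually[OF lim this] show ?thesis .
qed

end

theorem proposition1p2:
  fixes G :: "('a, 'b) monoid_scheme"
    and S :: "'a set"
    and act :: "'a \<Rightarrow> 'a flowpoint \<Rightarrow> 'a flowpoint"
    and \<rho> :: "'a \<Rightarrow> 'n::{finite,linorder} mat_nn"
    and \<gamma> \<eta> :: 'a
    and k :: "nat \<Rightarrow> nat"
  assumes "word_hyperbolic G S"
    and "gromov_action G S act"
    and "even CARD('n)"
    and "\<rho> \<in> hom G SO0_group" and "inj_on \<rho> (carrier G)"
    and "anosov G S act \<rho>"
    and "infinite_order G \<gamma>" and "infinite_order G \<eta>"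
    and "distinct [bd_attr G S \<gamma>, bd_rep G S \<gamma>, bd_attr G S \<eta>, bd_rep G S \<eta>]"
    and "strict_mono k"
    and "\<And>i. infinite_order G (\<gamma> [^]\<^bsub>G\<^esub> k i \<otimes>\<^bsub>G\<^esub> \<eta> [^]\<^bsub>G\<^esub> k i)"
  shows "(\<lambda>i. (lambda G S \<rho> (\<gamma> [^]\<^bsub>G\<^esub> k i \<otimes>\<^bsub>G\<^esub> \<eta> [^]\<^bsub>G\<^esub> k i))\<^sup>2 /
            ((lambda G S \<rho> (\<gamma> [^]\<^bsub>G\<^esub> k i))\<^sup>2 * (lambda G S \<rho> (\<eta> [^]\<^bsub>G\<^esub> k i))\<^sup>2))
         \<longlonglongrightarrow> (theta G S \<rho> (bd_rep G S \<eta>) (bd_rep G S \<gamma>) (bd_attr G S \<gamma>) (bd_attr G S \<eta>))\<^sup>2"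
proof -
  obtain \<xi>p \<xi>m N C c where
    p: "boundary_map G S \<rho> P_plus \<xi>p" and m: "boundary_map G S \<rho> P_minus \<xi>m" and
    X: "\<forall>(p, q, t)\<in>flow_space G S. (\<xi>p p, \<xi>m q) \<in> X_space" and c: "c > 0" and
    norm: "\<forall>(p, q, t)\<in>flow_space G S. euclidean_norm_mod (lie_algebra SO0 \<times> lie_algebra SO0)
       (stab_algebra (\<xi>p p) \<times> stab_algebra (\<xi>m q)) (N (p, q, t))" and
    eq: "\<forall>g\<in>carrier G. \<forall>z\<in>flow_space G S. \<forall>Z\<in>lie_algebra SO0. \<forall>Y\<in>lie_algebra SO0.
       N (act g z) (Ad (\<rho> g) Z, Ad (\<rho> g) Y) = N z (Z, Y)" and
    contr: "\<forall>z\<in>flow_space G S. \<forall>t\<ge>0. \<forall>Z\<in>lie_algebra SO0.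
       N (flow (- t) z) (Z, 0) \<le> C * exp (- c * t) * N z (Z, 0) \<and>
       N (flow t z) (0, Z) \<le> C * exp (- c * t) * N z (0, Z)"
    using assms(6) unfolding anosov_def by (elim exE conjE)
  have "anosov_limit G S act \<rho> \<xi>p \<xi>m N C c"
  proof (rule anosov_limit.intro)
    show "group G" using assms(1) by (simp add: word_hyperbolic_def)
    show "\<xi>p (bd_act G g a) = \<rho> g <#\<^bsub>SO0_group\<^esub> \<xi>p a" if "g \<in> carrier G" "a \<in> boundary G S" for g a
      using p that by (simp add: boundary_map_def)
    show "\<xi>m (bd_act G g a) = \<rho> g <#\<^bsub>SO0_group\<^esub> \<xi>m a" if "g \<in> carrier G" "a \<in> boundary G S" for g a
      using m that by (simp add: boundary_map_def)
    show "(\<xi>p p, \<xi>m q) \<in> X_space" if "(p, q, t) \<in> flow_space G S" for p q t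
      using bspec[OF X that] by simp
    show "euclidean_norm_mod (lie_algebra SO0 \<times> lie_algebra SO0)
       (stab_algebra (\<xi>p p) \<times> stab_algebra (\<xi>m q)) (N (p, q, t))" if "(p, q, t) \<in> flow_space G S" for p q t
      using bspec[OF norm that] by simp
    show "N (act g z) (Ad (\<rho> g) Z, Ad (\<rho> g) Y) = N z (Z, Y)"
      if "g \<in> carrier G" "z \<in> flow_space G S" "Z \<in> lie_algebra SO0" "Y \<in> lie_algebra SO0" for g z Z Y
      using eq that by blast
    show "N (flow (- t) z) (Z, 0) \<le> C * exp (- c * t) * N z (Z, 0)"
      if "z \<in> flow_space G S" "t \<ge> 0" "Z \<in> lie_algebra SO0" for z t Z
      using contr that by blast
  qed (use assms c in auto)
  from tendsto_power[OF anosov_limit.lambda_product_limit[OF this assms(7-11)], of 2]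
  show ?thesis by (simp add: power_divide power_mult_distrib)
qed

end
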